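(* Let $F\in\mathcal C$, let $\theta_0\in\mathbb R$, and for each $n$ let $\pi$ be a random permutation in $S_n$ with law $\mathbb P_{n,\theta_0}$, where $$\mathbb P_{n,\theta}(\pi)=\exp\Big(\theta\sum_{i=1}^nF\Big(\frac in,\frac{\pi(i)}n\Big)-Z_n(\theta)\Big),\qquad \theta\in\mathbb R.$$ Then, with probability tending to $1$ as $n\to\infty$, the pseudo-likelihood estimator $\hat\theta_{PL}$ exists, and it satisfies $$\sqrt n\,(\hat\theta_{PL}-\theta_0)\xrightarrow{D}N\Big(0,\frac{\sigma^2(\theta_0)}{a(\theta_0)^2}\Big),$$ where $$\sigma^2(\theta):=\int_{[0,1]^6}\frac{G(\mathbf z_1,\mathbf z_2)\,G(\mathbf z_1,\mathbf z_3)}{(1+e^{\theta G(\mathbf z_1,\mathbf z_2)})(1+e^{\theta G(\mathbf z_1,\mathbf z_3)})}\prod_{a=1}^3d\mu_\theta(\mathbf z_a),$$ $$a(\theta):=\frac12\int_{[0,1]^4}\frac{G^2(\mathbf z_1,\mathbf z_2)\,e^{\theta G(\mathbf z_1,\mathbf z_2)}}{(1+e^{\theta G(\mathbf z_1,\mathbf z_2)})^2}\prod_{a=1}^2d\mu_\theta(\mathbf z_a),$$ and $G((x_1,y_1),(x_2,y_2))=F(x_1,y_1)+F(x_2,y_2)-F(x_1,y_2)-F(x_2,y_1)$.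
   Context: $S_n$ is the set of permutations of $[n]=\{1,\ldots,n\}$; $Z_n(\theta)$ is the log normalizing constant making $\mathbb P_{n,\theta}$ a probability on $S_n$. Class $\mathcal C$: the set of continuous $F:[0,1]^2\to\mathbb R$, not almost everywhere $0$, such that $\int_0^1F(x,z)\,dz=0$ for all $x$ and $\int_0^1F(z,y)\,dz=0$ for all $y$. Pseudo-likelihood estimator: for $1\le i<j\le n$ let $y_\pi(i,j)=F(\frac in,\frac{\pi(i)}n)+F(\frac jn,\frac{\pi(j)}n)-F(\frac in,\frac{\pi(j)}n)-F(\frac jn,\frac{\pi(i)}n)$. Then $\hat\theta_{PL}$ is the root $\theta\in\mathbb R$ of $$\sum_{1\le i<j\le n}\frac{y_\pi(i,j)}{1+e^{\theta y_\pi(i,j)}}=0.$$ $\mathcal M$ is the set of probability measures on $[0,1]^2$ with both marginals uniform on $[0,1]$, $u$ is the uniform distribution on $[0,1]^2$, and $D(\cdot\|\cdot)$ is Kullback–Leibler divergence ($+\infty$ without absolute continuity). $\mu_\theta$ is the unique maximizer over $\mu\in\mathcal M$ of $\theta\int F\,d\mu-D(\mu\|u)$. Each $\mathbf z_a$ ranges over $[0,1]^2$. *)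

theory Defs
  imports "HOL-Probability.Probability" "HOL-Combinatorics.Permutations"
begin

abbreviation unit_square :: "(real \<times> real) set" where
  "unit_square \<equiv> {0..1} \<times> {0..1}"

text \<open>
  Functions on the unit square are total functions on the plane whose values off the square are
  irrelevant: they need not even be measurable there, so integrals are taken over the square.
\<close>

definition class_C :: "(real \<times> real \<Rightarrow> real) set" where
  "class_C = {F. continuous_on unit_square F
     \<and> \<not> (AE z in uniform_measure lborel unit_square. F z = 0)
     \<and> (\<forall>x\<in>{0..1}. integral {0..1} (\<lambda>z. F (x, z)) = 0)
     \<and> (\<forall>y\<in>{0..1}. integral {0..1} (\<lambda>z. F (z, y)) = 0)}"

definition perms :: "nat \<Rightarrow> (nat \<Rightarrow> nat) set" where
  "perms n = {p. p permutes {1..n}}"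

definition perm_stat :: "(real \<times> real \<Rightarrow> real) \<Rightarrow> nat \<Rightarrow> (nat \<Rightarrow> nat) \<Rightarrow> real" where
  "perm_stat F n p = (\<Sum>i = 1..n. F (real i / real n, real (p i) / real n))"

definition log_Z :: "(real \<times> real \<Rightarrow> real) \<Rightarrow> nat \<Rightarrow> real \<Rightarrow> real" where
  "log_Z F n \<theta> = ln (\<Sum>p\<in>perms n. exp (\<theta> * perm_stat F n p))"

definition perm_law :: "(real \<times> real \<Rightarrow> real) \<Rightarrow> nat \<Rightarrow> real \<Rightarrow> (nat \<Rightarrow> nat) measure" where
  "perm_law F n \<theta> = point_measure (perms n) (\<lambda>p. ennreal (exp (\<theta> * perm_stat F n p - log_Z F n \<theta>)))"

lemma prob_space_perm_law: "prob_space (perm_law F n \<theta>)"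
proof (rule prob_spaceI)
  have fin: "finite (perms n)"
    by (simp add: perms_def finite_permutations)
  have "id \<in> perms n"
    by (simp add: perms_def permutes_id)
  with fin have pos: "(\<Sum>p\<in>perms n. exp (\<theta> * perm_stat F n p)) > 0"
    by (intro sum_pos) auto
  have "(\<Sum>p\<in>perms n. exp (\<theta> * perm_stat F n p - log_Z F n \<theta>)) = 1"
    using pos by (simp add: exp_diff log_Z_def flip: sum_divide_distrib)
  then show "emeasure (perm_law F n \<theta>) (space (perm_law F n \<theta>)) = 1"
    using fin by (simp add: perm_law_def space_point_measure emeasure_point_measure_finite sum_ennreal)
qed

definition y_diff :: "(real \<times> real \<Rightarrow> real) \<Rightarrow> nat \<Rightarrow> (nat \<Rightarrow> nat) \<Rightarrow> nat \<Rightarrow> nat \<Rightarrow> real" where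
  "y_diff F n p i j =
     F (real i / real n, real (p i) / real n) + F (real j / real n, real (p j) / real n)
     - F (real i / real n, real (p j) / real n) - F (real j / real n, real (p i) / real n)"

definition PL_score :: "(real \<times> real \<Rightarrow> real) \<Rightarrow> nat \<Rightarrow> (nat \<Rightarrow> nat) \<Rightarrow> real \<Rightarrow> real" where
  "PL_score F n p \<theta> =
     (\<Sum>j = 1..n. \<Sum>i = 1..<j. y_diff F n p i j / (1 + exp (\<theta> * y_diff F n p i j)))"

definition PL_exists :: "(real \<times> real \<Rightarrow> real) \<Rightarrow> nat \<Rightarrow> (nat \<Rightarrow> nat) \<Rightarrow> bool" where
  "PL_exists F n p \<longleftrightarrow> (\<exists>!\<theta>. PL_score F n p \<theta> = 0)"

text \<open>Unspecified for those permutations that do not satisfy \<^const>\<open>PL_exists\<close>.\<close>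

definition theta_PL :: "(real \<times> real \<Rightarrow> real) \<Rightarrow> nat \<Rightarrow> (nat \<Rightarrow> nat) \<Rightarrow> real" where
  "theta_PL F n p = (THE \<theta>. PL_score F n p \<theta> = 0)"

text \<open>
  Borel measures on the plane with both marginals uniform on the unit interval; the marginal
  conditions force such a measure to be concentrated on the unit square.
\<close>

definition permutons :: "(real \<times> real) measure set" where
  "permutons = {\<mu>. prob_space \<mu> \<and> sets \<mu> = sets borel
     \<and> distr \<mu> borel fst = uniform_measure lborel {0..1}
     \<and> distr \<mu> borel snd = uniform_measure lborel {0..1}}"

text \<open>
  The divergence of \<open>\<mu>\<close> from \<open>\<nu>\<close> (in nats) with values in the extended reals. The library's
  \<^const>\<open>KL_divergence\<close> is real-valued and takes the reference measure \<open>\<nu>\<close> first. For probability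
  measures the negative part of the log density is always \<open>\<mu>\<close>-integrable, so in the absolutely
  continuous case non-integrability means that the divergence is infinite.
\<close>

definition KL :: "'a measure \<Rightarrow> 'a measure \<Rightarrow> ereal" where
  "KL \<mu> \<nu> = (if absolutely_continuous \<nu> \<mu> \<and> integrable \<mu> (entropy_density (exp 1) \<nu> \<mu>)
             then ereal (KL_divergence (exp 1) \<nu> \<mu>) else \<infinity>)"

definition objective :: "(real \<times> real \<Rightarrow> real) \<Rightarrow> real \<Rightarrow> (real \<times> real) measure \<Rightarrow> ereal" where
  "objective F \<theta> \<mu> =
     ereal (\<theta> * (LINT z:unit_square|\<mu>. F z)) - KL \<mu> (uniform_measure lborel unit_square)"

definition mu_opt :: "(real \<times> real \<Rightarrow> real) \<Rightarrow> real \<Rightarrow> (real \<times> real) measure" where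
  "mu_opt F \<theta> = (THE \<mu>. is_arg_max (objective F \<theta>) (\<lambda>\<mu>. \<mu> \<in> permutons) \<mu>)"

definition G_diff :: "(real \<times> real \<Rightarrow> real) \<Rightarrow> real \<times> real \<Rightarrow> real \<times> real \<Rightarrow> real" where
  "G_diff F z w = F (fst z, snd z) + F (fst w, snd w) - F (fst z, snd w) - F (fst w, snd z)"

definition sigma_sq :: "(real \<times> real \<Rightarrow> real) \<Rightarrow> real \<Rightarrow> real" where
  "sigma_sq F \<theta> =
     (LINT (z1, z2, z3):unit_square \<times> unit_square \<times> unit_square
        | mu_opt F \<theta> \<Otimes>\<^sub>M mu_opt F \<theta> \<Otimes>\<^sub>M mu_opt F \<theta>.
        G_diff F z1 z2 * G_diff F z1 z3
          / ((1 + exp (\<theta> * G_diff F z1 z2)) * (1 + exp (\<theta> * G_diff F z1 z3))))"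

definition a_coeff :: "(real \<times> real \<Rightarrow> real) \<Rightarrow> real \<Rightarrow> real" where
  "a_coeff F \<theta> = 1 / 2 *
     (LINT (z1, z2):unit_square \<times> unit_square | mu_opt F \<theta> \<Otimes>\<^sub>M mu_opt F \<theta>.
        (G_diff F z1 z2)\<^sup>2 * exp (\<theta> * G_diff F z1 z2) / (1 + exp (\<theta> * G_diff F z1 z2))\<^sup>2)"

text \<open>Parametrised by mean and variance; variance \<open>0\<close> gives a point mass.\<close>

definition normal_law :: "real \<Rightarrow> real \<Rightarrow> real measure" where
  "normal_law m v =
     (if v = 0 then return borel m else density lborel (normal_density m (sqrt v)))"

end

theory Submission
  imports Defs
begin

text \<open>
  Write \<open>z\<^sub>i = (i / n, \<pi>(i) / n)\<close> and let \<open>G\<close> be the function \<^const>\<open>G_diff\<close>. Exchanging the images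
  of \<open>i\<close> and \<open>j\<close> multiplies the weight of a permutation by \<open>exp (- \<theta> G(z\<^sub>i, z\<^sub>j))\<close>. If a kernel
  \<open>Q(z\<^sub>i, z\<^sub>j)\<close> changes sign under the exchange once this factor is taken into account (\<open>swap_odd\<close>),
  then \<open>Q(z\<^sub>i, z\<^sub>j) \<psi>\<close> has expectation \<open>0\<close> for every \<open>\<psi>\<close> that the exchange leaves unchanged
  (\<open>swap_odd_centered\<close>). Both limit theorems come from this one cancellation.

  Law of large numbers. For functions \<open>A\<close> and \<open>B\<close> of one variable the kernel
  \<open>A(x\<^sub>1) (B(y\<^sub>2) - B(y\<^sub>1)) exp (- \<theta> (F(z\<^sub>1) + F(z\<^sub>2)))\<close> is odd in this sense, so its sum over all
  pairs is small in mean square: weighted by \<open>exp (- \<theta> F)\<close>, the empirical measure of the points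
  \<open>z\<^sub>i\<close> is asymptotically a product. With Helly's theorem for the two marginals this shows that
  every limit point of the empirical measures has a density \<open>\<alpha>(x) \<beta>(y) exp (\<theta> F(x, y))\<close> and
  uniform marginals (\<open>gibbs_limit_exists\<close>). For a measure \<open>\<mu>\<close> of this form the objective of a
  permuton \<open>\<nu>\<close> is a constant minus the divergence of \<open>\<nu>\<close> from \<open>\<mu>\<close>, so \<open>\<mu>\<close> is the unique maximiser
  (\<open>gibbs_form_objective\<close>). All limit points therefore coincide with \<^const>\<open>mu_opt\<close>, whose existence
  is obtained along the way, and averages of continuous functions of several points \<open>z\<^sub>i\<close> converge
  in probability (\<open>lln_in_probability\<close>).

  Central limit theorem. The score at the true parameter is half the sum of the odd symmetric
  kernel \<open>h = G / (1 + exp (\<theta> G))\<close> over all pairs. Let \<open>U\<^sub>i\<^sub>j\<close> collect the part of the score \<open>S\<close> that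
  involves \<open>i\<close> or \<open>j\<close>. Since \<open>S - U\<^sub>i\<^sub>j\<close> is unchanged by the exchange,
  \<open>E[h\<^sub>i\<^sub>j g(S)] = E[h\<^sub>i\<^sub>j (g(S) - g(S - U\<^sub>i\<^sub>j))]\<close>, and a Taylor expansion for \<open>g(s) = exp (i \<tau> s)\<close> shows that
  \<open>E[S g(S)]\<close> is close to \<open>E[g'(S) V]\<close> with \<open>V\<close> the sum of \<open>h\<^sub>i\<^sub>j h\<^sub>i\<^sub>k\<close> over all triples
  (\<open>stein_identity\<close>). By the law of large numbers \<open>V / n\<^sup>3\<close> tends to \<open>\<sigma>\<^sup>2\<close>, so the characteristic
  function \<open>\<phi>\<close> of \<open>W = S / (n sqrt n)\<close> nearly satisfies \<open>\<phi>'(t) = - \<sigma>\<^sup>2 t \<phi>(t)\<close>, whose solution is the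
  Gaussian one (\<open>scaled_score_char_tendsto\<close>).

  Estimator. The score at \<open>\<theta> + x / sqrt n\<close>, divided by \<open>n sqrt n\<close>, is \<open>W - a x\<close> up to an error that
  vanishes in probability uniformly over bounded \<open>x\<close>. Here \<open>a > 0\<close>, because \<open>\<mu>\<close> has a positive density
  and \<open>G\<close> is not almost everywhere \<open>0\<close>. As the score is decreasing in the parameter, with high
  probability it has exactly one root, and the rescaled error of that root is close to \<open>W / a\<close>
  (\<open>estimator_close_in_probability\<close>). Levy's continuity theorem concludes.
\<close>

section \<open>Weak convergence on compact sets\<close>

text \<open>
  The test functions include sines and cosines, so the characteristic functions agree.
\<close>

lemma real_measure_eqI_continuous:
  fixes M N :: "real measure"
  assumes M: "prob_space M" "sets M = sets borel" and N: "prob_space N" "sets N = sets borel"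
    and eq: "\<And>f. continuous_on UNIV f \<Longrightarrow> bounded (range f) \<Longrightarrow> (LINT x|M. f x) = (LINT x|N. f x :: real)"
  shows "M = N"
proof (rule Levy_uniqueness)
  show rM: "real_distribution M" and rN: "real_distribution N"
    using assms by (auto simp: real_distribution_def real_distribution_axioms_def sets_eq_imp_space_eq)
  have char: "char L t = complex_of_real (LINT x|L. cos (t * x)) + \<i> * complex_of_real (LINT x|L. sin (t * x))"
    if L: "real_distribution L" for L t
  proof -
    interpret real_distribution L by fact
    have "integrable L (\<lambda>x. complex_of_real (cos (t * x)))" "integrable L (\<lambda>x. complex_of_real (sin (t * x)))"
      by (intro integrable_const_bound[where B = 1]; simp)+
    then have "(CLINT x|L. complex_of_real (cos (t * x)) + \<i> * complex_of_real (sin (t * x)))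
       = complex_of_real (LINT x|L. cos (t * x)) + \<i> * complex_of_real (LINT x|L. sin (t * x))"
      by simp
    then show ?thesis
      unfolding char_def by (simp add: exp_Euler cos_of_real sin_of_real flip: of_real_mult)
  qed
  have "(LINT x|M. cos (t * x)) = (LINT x|N. cos (t * x))" "(LINT x|M. sin (t * x))
      = (LINT x|N. sin (t * x))" for t
    by (intro eq continuous_intros boundedI[of _ 1]; auto)+
  then show "char M = char N"
    by (intro ext) (simp add: char[OF rM] char[OF rN])
qed

text \<open>
  On a compact set every continuous function is bounded, so integrability never depends on the
  behaviour of a test function far away.
\<close>

definition on_compact :: "'a::metric_space set \<Rightarrow> 'a measure \<Rightarrow> bool" where
  "on_compact K M \<longleftrightarrow> prob_space M \<and> sets M = sets borel \<and> compact K \<and> (AE x in M. x \<in> K)"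

lemma on_compact_integrable:
  fixes f :: "'a::metric_space \<Rightarrow> real"
  assumes M: "on_compact K M" and f: "continuous_on UNIV f"
  shows "integrable M f"
proof -
  interpret prob_space M using M by (simp add: on_compact_def)
  have [measurable]: "f \<in> borel_measurable M"
    using M f borel_measurable_continuous_onI[OF f] by (simp add: on_compact_def cong: measurable_cong_sets)
  have "compact (f ` K)"
    using M f by (intro compact_continuous_image) (auto simp: on_compact_def intro: continuous_on_subset)
  then obtain B where "\<And>x. x \<in> K \<Longrightarrow> \<bar>f x\<bar> \<le> B"
    using compact_imp_bounded[of "f ` K"] by (force simp: bounded_iff)
  with M show ?thesis
    by (intro integrable_const_bound[where B = B]) (auto simp: on_compact_def elim!: AE_mp)
qed

lemma on_compact_integral_diff_le:
  fixes f g :: "'a::metric_space \<Rightarrow> real"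
  assumes M: "on_compact K M" and f: "continuous_on UNIV f" and g: "continuous_on UNIV g"
    and le: "\<And>x. x \<in> K \<Longrightarrow> \<bar>f x - g x\<bar> \<le> e"
  shows "\<bar>(LINT x|M. f x) - (LINT x|M. g x)\<bar> \<le> e"
proof -
  interpret prob_space M using M by (simp add: on_compact_def)
  note int = on_compact_integrable[OF M f] on_compact_integrable[OF M g]
  have "\<bar>(LINT x|M. f x) - (LINT x|M. g x)\<bar> = norm (LINT x|M. f x - g x)"
    using int by simp
  also have "\<dots> \<le> (LINT x|M. norm (f x - g x))" by (rule integral_norm_bound)
  also have "\<dots> \<le> (LINT x|M. e)"
    using int M le by (intro integral_mono_AE) (auto simp: on_compact_def elim!: AE_mp)
  also have "\<dots> = e" using prob_space by simp
  finally show ?thesis .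
qed

lemma on_compact_pair:
  fixes M :: "'a::{metric_space, second_countable_topology} measure"
    and N :: "'b::{metric_space, second_countable_topology} measure"
  assumes M: "on_compact K M" and N: "on_compact L N"
  shows "on_compact (K \<times> L) (M \<Otimes>\<^sub>M N)"
proof -
  interpret M: prob_space M using M by (simp add: on_compact_def)
  interpret N: prob_space N using N by (simp add: on_compact_def)
  interpret pair_prob_space M N ..
  have sets: "sets (M \<Otimes>\<^sub>M N) = sets borel"
    using M N by (simp add: on_compact_def borel_prod[symmetric] cong: sets_pair_measure_cong)
  have KL: "compact (K \<times> L)"
    using M N by (intro compact_Times) (auto simp: on_compact_def)
  have space: "space (M \<Otimes>\<^sub>M N) = UNIV" 
    using sets_eq_imp_space_eq[OF sets] by simp
  have "AE x in M. AE y in N. (x, y) \<in> K \<times> L"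
    using M N by (auto simp: on_compact_def elim!: AE_mp)
  moreover have "{z \<in> space (M \<Otimes>\<^sub>M N). z \<in> K \<times> L} \<in> sets (M \<Otimes>\<^sub>M N)"
    using KL unfolding sets space by (simp add: borel_closed compact_imp_closed)
  ultimately have "AE z in M \<Otimes>\<^sub>M N. z \<in> K \<times> L"
    by (intro AE_pair_measure)
  then show ?thesis
    using M N sets prob_space_axioms by (simp add: on_compact_def compact_Times)
qed

text \<open>
  The linear span of the products \<open>g(x) h(y)\<close>, generated one summand at a time so that its
  properties follow by induction.
\<close>

inductive_set tensor_span :: "('a::topological_space \<Rightarrow> real) set \<Rightarrow> ('b::topological_space \<Rightarrow> real) set
    \<Rightarrow> ('a \<times> 'b \<Rightarrow> real) set" for G H where
  zero: "(\<lambda>z. 0) \<in> tensor_span G H"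
| add: "f \<in> tensor_span G H \<Longrightarrow> g \<in> G \<Longrightarrow> h \<in> H \<Longrightarrow> (\<lambda>z. f z + c * (g (fst z) * h (snd z))) \<in> tensor_span G H"

lemma tensor_span_continuous:
  fixes G :: "('a::topological_space \<Rightarrow> real) set" and H :: "('b::topological_space \<Rightarrow> real) set"
  assumes f: "f \<in> tensor_span G H"
    and G: "\<And>g. g \<in> G \<Longrightarrow> continuous_on UNIV g" and H: "\<And>h. h \<in> H \<Longrightarrow> continuous_on UNIV h"
  shows "continuous_on UNIV f"
  using f
proof induction
  case (add f g h c)
  have "continuous_on UNIV (\<lambda>z :: 'a \<times> 'b. g (fst z))" "continuous_on UNIV (\<lambda>z :: 'a \<times> 'b. h (snd z))"
    by (rule continuous_on_compose2[OF G[OF add(2)] continuous_on_fst[OF continuous_on_id]]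
          continuous_on_compose2[OF H[OF add(3)] continuous_on_snd[OF continuous_on_id]]; simp)+
  with add show ?case by (intro continuous_intros)
qed simp

lemma tensor_span_add:
  assumes "f \<in> tensor_span G H" "f' \<in> tensor_span G H"
  shows "(\<lambda>z. f z + f' z) \<in> tensor_span G H"
  using assms(2)
proof induction
  case (add f' g h c)
  from tensor_span.add[OF add(4) add(2,3), of c] show ?case by (simp add: add.assoc)
qed (simp add: assms(1))

lemma tensor_span_mult:
  assumes f: "f \<in> tensor_span G H" and f': "f' \<in> tensor_span G H"
    and G: "\<And>g g'. g \<in> G \<Longrightarrow> g' \<in> G \<Longrightarrow> (\<lambda>x. g x * g' x) \<in> G"
    and H: "\<And>h h'. h \<in> H \<Longrightarrow> h' \<in> H \<Longrightarrow> (\<lambda>x. h x * h' x) \<in> H"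
  shows "(\<lambda>z. f z * f' z) \<in> tensor_span G H"
  using f'
proof induction
  case (add f' g h c)
  have "(\<lambda>z. f z * (c * (g (fst z) * h (snd z)))) \<in> tensor_span G H"
    using f
  proof induction
    case (add k g' h' c')
    have "(\<lambda>z. k z * (c * (g (fst z) * h (snd z)))
        + (c * c') * ((g' (fst z) * g (fst z)) * (h' (snd z) * h (snd z)))) \<in> tensor_span G H"
      using tensor_span.add[OF add(4) G[OF add(2) \<open>g \<in> G\<close>] H[OF add(3) \<open>h \<in> H\<close>]] by simp
    then show ?case by (simp add: algebra_simps)
  qed (simp add: tensor_span.zero)
  from tensor_span_add[OF add(4) this] show ?case by (simp add: algebra_simps)
qed (simp add: tensor_span.zero)

text \<open>
  The Stone--Weierstrass theorem: the span is an algebra because \<open>G\<close> and \<open>H\<close> are closed under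
  products, and it separates points because each factor does and contains the constant \<open>1\<close>.
\<close>

lemma tensor_span_dense:
  fixes f :: "'a::metric_space \<times> 'b::metric_space \<Rightarrow> real"
  assumes K: "compact K" and L: "compact L" and f: "continuous_on (K \<times> L) f" and e: "0 < e"
    and contG: "\<And>g. g \<in> G \<Longrightarrow> continuous_on UNIV g" and contH: "\<And>h. h \<in> H \<Longrightarrow> continuous_on UNIV h"
    and oneG: "(\<lambda>x. 1) \<in> G" and oneH: "(\<lambda>x. 1) \<in> H"
    and multG: "\<And>g g'. g \<in> G \<Longrightarrow> g' \<in> G \<Longrightarrow> (\<lambda>x. g x * g' x) \<in> G"
    and multH: "\<And>h h'. h \<in> H \<Longrightarrow> h' \<in> H \<Longrightarrow> (\<lambda>x. h x * h' x) \<in> H"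
    and sepG: "\<And>x x'. x \<noteq> x' \<Longrightarrow> \<exists>g\<in>G. g x \<noteq> g x'" and sepH: "\<And>x x'. x \<noteq> x' \<Longrightarrow> \<exists>h\<in>H. h x \<noteq> h x'"
  shows "\<exists>g\<in>tensor_span G H. \<forall>z\<in>K \<times> L. \<bar>f z - g z\<bar> < e"
proof -
  interpret function_ring_on "tensor_span G H" "K \<times> L"
  proof unfold_locales
    show "compact (K \<times> L)" using K L by (rule compact_Times)
    show "continuous_on (K \<times> L) f" if "f \<in> tensor_span G H" for f
      using tensor_span_continuous[OF that contG contH] by (rule continuous_on_subset) auto
    show "(\<lambda>z. f z + g z) \<in> tensor_span G H" if "f \<in> tensor_span G H" "g \<in> tensor_span G H" for f g
      using that by (rule tensor_span_add)
    show "(\<lambda>z. f z * g z) \<in> tensor_span G H" if "f \<in> tensor_span G H" "g \<in> tensor_span G H" for f g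
      using that multG multH by (rule tensor_span_mult)
    show "(\<lambda>_. c) \<in> tensor_span G H" for c
      using tensor_span.add[OF tensor_span.zero oneG oneH, of c] by simp
    show "\<exists>f\<in>tensor_span G H. f z \<noteq> f z'" if neq: "z \<noteq> z'" for z z'
    proof (cases "fst z = fst z'")
      case False
      then obtain g where "g \<in> G" "g (fst z) \<noteq> g (fst z')" using sepG by blast
      with tensor_span.add[OF tensor_span.zero \<open>g \<in> G\<close> oneH, of 1] show ?thesis
        by (intro bexI[of _ "\<lambda>z. 0 + 1 * (g (fst z) * 1)"]) auto
    next
      case True
      then have "snd z \<noteq> snd z'" using neq by (simp add: prod_eq_iff)
      then obtain h where "h \<in> H" "h (snd z) \<noteq> h (snd z')" using sepH by blast
      with tensor_span.add[OF tensor_span.zero oneG \<open>h \<in> H\<close>, of 1] show ?thesis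
        by (intro bexI[of _ "\<lambda>z. 0 + 1 * (1 * h (snd z))"]) auto
    qed
  qed
  show ?thesis by (rule Stone_Weierstrass_basic[OF f e])
qed

text \<open>
  The test functions may be unbounded. For measures on a common compact set, the only ones
  considered here, this is ordinary weak convergence.
\<close>

definition weak_lim :: "(nat \<Rightarrow> 'a::topological_space measure) \<Rightarrow> 'a measure \<Rightarrow> bool" where
  "weak_lim M_seq M \<longleftrightarrow>
     (\<forall>f :: 'a \<Rightarrow> real. continuous_on UNIV f \<longrightarrow> (\<lambda>n. LINT x|M_seq n. f x) \<longlonglongrightarrow> (LINT x|M. f x))"

lemma weak_limD: "weak_lim M_seq M \<Longrightarrow> continuous_on UNIV f \<Longrightarrow> (\<lambda>n. LINT x|M_seq n. f x) \<longlonglongrightarrow> (LINT x|M. f x :: real)"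
  by (simp add: weak_lim_def)

text \<open>
  The functions whose integrals converge form a linear space that is closed under uniform limits
  on \<open>K \<times> L\<close>, so products of functions of one coordinate suffice.
\<close>

lemma weak_limI_tensor_span:
  fixes M_seq :: "nat \<Rightarrow> ('a::metric_space \<times> 'b::metric_space) measure"
  assumes Mn: "\<And>n. on_compact (K \<times> L) (M_seq n)" and M: "on_compact (K \<times> L) M"
    and K: "compact K" and L: "compact L"
    and contG: "\<And>g. g \<in> G \<Longrightarrow> continuous_on UNIV g" and contH: "\<And>h. h \<in> H \<Longrightarrow> continuous_on UNIV h"
    and dense: "\<And>f e. continuous_on UNIV f \<Longrightarrow> 0 < e \<Longrightarrow> \<exists>g\<in>tensor_span G H. \<forall>z\<in>K \<times> L. \<bar>f z - g z\<bar> < (e :: real)"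
    and conv: "\<And>g h. g \<in> G \<Longrightarrow> h \<in> H \<Longrightarrow>
       (\<lambda>n. LINT z|M_seq n. g (fst z) * h (snd z)) \<longlonglongrightarrow> (LINT z|M. g (fst z) * h (snd z))"
  shows "weak_lim M_seq M"
  unfolding weak_lim_def
proof (intro allI impI)
  fix f :: "'a \<times> 'b \<Rightarrow> real" assume f: "continuous_on UNIV f"
  have span: "(\<lambda>n. LINT z|M_seq n. k z) \<longlonglongrightarrow> (LINT z|M. k z)" if "k \<in> tensor_span G H" for k
    using that
  proof induction
    case (add k g h c)
    have k: "continuous_on UNIV k" using add(1) contG contH by (rule tensor_span_continuous)
    have gh: "continuous_on UNIV (\<lambda>z :: 'a \<times> 'b. g (fst z) * h (snd z))"
      using tensor_span_continuous[OF tensor_span.add[OF tensor_span.zero add(2,3), of 1] contG contH] by simp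
    have "integral\<^sup>L P (\<lambda>z. k z + c * (g (fst z) * h (snd z)))
        = integral\<^sup>L P k + c * integral\<^sup>L P (\<lambda>z. g (fst z) * h (snd z))"
      if "on_compact (K \<times> L) P" for P
      using on_compact_integrable[OF that k] on_compact_integrable[OF that gh] by simp
    then show ?case
      using Mn M by (simp only:) (intro tendsto_intros add(4) conv add(2,3))
  qed simp
  show "(\<lambda>n. LINT z|M_seq n. f z) \<longlonglongrightarrow> (LINT z|M. f z)"
  proof (rule LIMSEQ_I)
    fix r :: real assume "0 < r"
    then obtain k where k: "k \<in> tensor_span G H" "\<And>z. z \<in> K \<times> L \<Longrightarrow> \<bar>f z - k z\<bar> < r / 3"
      using dense[OF f, of "r / 3"] by auto
    have kc: "continuous_on UNIV k" using k(1) contG contH by (rule tensor_span_continuous)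
    from LIMSEQ_D[OF span[OF k(1)], of "r / 3"] \<open>0 < r\<close>
    obtain N where N: "\<And>n. n \<ge> N \<Longrightarrow> norm ((LINT z|M_seq n. k z) - (LINT z|M. k z)) < r / 3" by auto
    have near: "\<bar>(LINT z|P. f z) - (LINT z|P. k z)\<bar> \<le> r / 3" if "on_compact (K \<times> L) P" for P
      using that f kc k(2) by (intro on_compact_integral_diff_le) (auto intro: less_imp_le)
    have "norm ((LINT z|M_seq n. f z) - (LINT z|M. f z)) < r" if "n \<ge> N" for n
      using N[OF that] near[OF Mn[of n]] near[OF M] unfolding real_norm_def by linarith
    then show "\<exists>no. \<forall>n\<ge>no. norm ((LINT z|M_seq n. f z) - (LINT z|M. f z)) < r" by blast
  qed
qed

lemma integral_pair_mult:
  fixes g :: "'a \<Rightarrow> real" and h :: "'b \<Rightarrow> real"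
  assumes "prob_space M" "prob_space N" and g: "integrable M g" and h: "integrable N h"
  shows "(LINT z|(M \<Otimes>\<^sub>M N). g (fst z) * h (snd z)) = (LINT x|M. g x) * (LINT y|N. h y)"
proof -
  interpret M: prob_space M by fact
  interpret N: prob_space N by fact
  interpret pair_prob_space M N ..
  have [measurable]: "g \<in> borel_measurable M" "h \<in> borel_measurable N" using g h by auto
  have "integrable (M \<Otimes>\<^sub>M N) (\<lambda>z. g (fst z) * h (snd z))"
  proof (rule Fubini_integrable)
    have "integrable M (\<lambda>x. norm (g x) * (LINT y|N. norm (h y)))" using g by simp
    then show "integrable M (\<lambda>x. LINT y|N. norm (g (fst (x, y)) * h (snd (x, y))))"
      by (simp add: abs_mult)
  qed (use h in auto)
  from integral_fst'[OF this] show ?thesis by simp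
qed

lemma weak_lim_pair:
  fixes M :: "'a::{metric_space, second_countable_topology} measure"
    and N :: "'b::{metric_space, second_countable_topology} measure"
  assumes Mn: "\<And>n. on_compact K (M_seq n)" and M: "on_compact K M"
    and Nn: "\<And>n. on_compact L (N_seq n)" and N: "on_compact L N"
    and limM: "weak_lim M_seq M" and limN: "weak_lim N_seq N"
  shows "weak_lim (\<lambda>n. M_seq n \<Otimes>\<^sub>M N_seq n) (M \<Otimes>\<^sub>M N)"
proof (rule weak_limI_tensor_span[where K = K and L = L and G = "Collect (continuous_on UNIV)"
      and H = "Collect (continuous_on UNIV)"])
  have K: "compact K" and L: "compact L" using M N by (auto simp: on_compact_def)
  then show "compact K" "compact L" .
  show "\<exists>g\<in>tensor_span (Collect (continuous_on UNIV)) (Collect (continuous_on UNIV)).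
      \<forall>z\<in>K \<times> L. \<bar>f z - g z\<bar> < e" if "continuous_on UNIV f" "0 < e" for f and e :: real
  proof (rule tensor_span_dense[OF K L _ that(2)])
    show "\<exists>g\<in>Collect (continuous_on UNIV). g x \<noteq> (g x' :: real)" if "x \<noteq> x'" for x x' :: 'a
      using that by (intro bexI[of _ "\<lambda>y. dist x y"]) (auto intro!: continuous_intros)
    show "\<exists>g\<in>Collect (continuous_on UNIV). g x \<noteq> (g x' :: real)" if "x \<noteq> x'" for x x' :: 'b
      using that by (intro bexI[of _ "\<lambda>y. dist x y"]) (auto intro!: continuous_intros)
  qed (use that in \<open>auto intro: continuous_intros continuous_on_subset\<close>)
  fix g :: "'a \<Rightarrow> real" and h :: "'b \<Rightarrow> real"
  assume gh: "g \<in> Collect (continuous_on UNIV)" "h \<in> Collect (continuous_on UNIV)"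
  have "(LINT z|(P \<Otimes>\<^sub>M Q). g (fst z) * h (snd z)) = (LINT x|P. g x) * (LINT y|Q. h y)"
    if "on_compact K P" "on_compact L Q" for P Q
    using that gh by (intro integral_pair_mult on_compact_integrable) (auto simp: on_compact_def)
  then show "(\<lambda>n. LINT z|(M_seq n \<Otimes>\<^sub>M N_seq n). g (fst z) * h (snd z))
      \<longlonglongrightarrow> (LINT z|(M \<Otimes>\<^sub>M N). g (fst z) * h (snd z))"
    using Mn M Nn N limM limN gh by (auto simp: weak_lim_def intro!: tendsto_intros)
qed (use assms in \<open>auto intro: on_compact_pair\<close>)

lemma continuous_on_fst_snd_UNIV:
  fixes f :: "real \<Rightarrow> real"
  assumes f: "continuous_on UNIV f"
  shows "continuous_on UNIV (\<lambda>z :: real \<times> real. f (fst z))" "continuous_on UNIV (\<lambda>z :: real \<times> real. f (snd z))"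
  by (rule continuous_on_compose2[OF f continuous_on_fst[OF continuous_on_id]]
        continuous_on_compose2[OF f continuous_on_snd[OF continuous_on_id]]; simp)+

section \<open>Permutons of Gibbs form maximise the objective\<close>

abbreviation unif :: "real measure" where
  "unif \<equiv> uniform_measure lborel {0..1}"

lemma unif_eq_density: "unif = density lborel (indicator {0..1})"
  by (simp add: uniform_measure_def divide_ennreal_def)

lemma prob_space_unif: "prob_space unif"
  by (rule prob_space_uniform_measure) auto

lemma unit_square_sets [measurable]: "unit_square \<in> sets borel"
  by (intro borel_closed closed_Times) auto

lemma uniform_square_eq_pair: "uniform_measure lborel unit_square = unif \<Otimes>\<^sub>M unif"
proof -
  have e: "emeasure (lborel :: (real \<times> real) measure) unit_square = 1"
    by (subst lborel_prod[symmetric], subst lborel.emeasure_pair_measure_Times) auto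
  have "sigma_finite_measure (density lborel (indicator {0..1} :: real \<Rightarrow> ennreal))"
    using prob_space_unif by (simp add: unif_eq_density[symmetric] prob_space_imp_sigma_finite)
  then have "unif \<Otimes>\<^sub>M unif = density (lborel \<Otimes>\<^sub>M lborel) (\<lambda>(x, y). indicator {0..1} x * indicator {0..1} y)"
    unfolding unif_eq_density by (intro pair_measure_density) (auto intro: lborel.sigma_finite_measure_axioms)
  also have "\<dots> = density lborel (indicator unit_square)"
    unfolding lborel_prod by (intro arg_cong[where f = "density lborel"]) (auto simp: fun_eq_iff indicator_def)
  also have "\<dots> = uniform_measure lborel unit_square"
    by (simp add: uniform_measure_def e divide_ennreal_def)
  finally show ?thesis by simp
qed

lemma AE_unif: "AE x in unif. x \<in> {0..1}"
  by (intro AE_uniform_measureI) auto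

lemma on_compact_unif: "on_compact {0..1} unif"
  using prob_space_unif AE_unif by (simp add: on_compact_def)

text \<open>
  Connects the Lebesgue integrals used below with the gauge integrals in \<^const>\<open>class_C\<close>.
\<close>

lemma integral_unif:
  fixes f :: "real \<Rightarrow> real"
  assumes "continuous_on UNIV f"
  shows "(LINT x|unif. f x) = integral {0..1} f"
proof -
  have [measurable]: "f \<in> borel_measurable borel" using assms by (rule borel_measurable_continuous_onI)
  have "unif = density lborel (\<lambda>x. ennreal (indicator {0..1} x))"
    unfolding unif_eq_density by (simp add: ennreal_indicator)
  moreover have "(LINT x|density lborel (\<lambda>x. ennreal (indicator {0..1} x)). f x)
      = (LINT x|lborel. indicator {0..1} x *\<^sub>R f x)"
    by (rule integral_density) auto
  ultimately have "(LINT x|unif. f x) = (LINT x:{0..1}|lborel. f x)"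
    by (simp only: set_lebesgue_integral_def)
  also have "\<dots> = integral {0..1} f"
    using assms by (intro set_borel_integral_eq_integral borel_integrable_atLeastAtMost')
       (auto intro: continuous_on_subset)
  finally show ?thesis .
qed

lemma permutons_on_compact:
  assumes "\<mu> \<in> permutons"
  shows "on_compact unit_square \<mu>"
proof -
  have *: "prob_space \<mu>" "sets \<mu> = sets borel" "distr \<mu> borel fst = unif" "distr \<mu> borel snd = unif"
    using assms by (auto simp: permutons_def)
  have meas: "fst \<in> measurable \<mu> borel" "snd \<in> measurable \<mu> borel"
    using *(2) by (auto cong: measurable_cong_sets simp: borel_prod[symmetric])
  have "AE z in \<mu>. fst z \<in> {0..1}" "AE z in \<mu>. snd z \<in> {0..1}"
    by (rule AE_distrD[OF meas(1)], simp only: * AE_unif) (rule AE_distrD[OF meas(2)], simp only: * AE_unif)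
  then have "AE z in \<mu>. z \<in> unit_square" by eventually_elim (auto simp: mem_Times_iff)
  with * show ?thesis by (simp add: on_compact_def compact_Times)
qed

lemma permutons_integral_marginal:
  assumes "\<mu> \<in> permutons" and [measurable]: "f \<in> borel_measurable borel"
  shows "(LINT z|\<mu>. f (fst z)) = (LINT x|unif. f x :: real)"
    and "(LINT z|\<mu>. f (snd z)) = (LINT x|unif. f x :: real)"
proof -
  have *: "sets \<mu> = sets borel" "distr \<mu> borel fst = unif" "distr \<mu> borel snd = unif"
    using assms by (auto simp: permutons_def)
  have meas: "fst \<in> measurable \<mu> borel" "snd \<in> measurable \<mu> borel"
    using *(1) by (auto cong: measurable_cong_sets simp: borel_prod[symmetric])
  show "(LINT z|\<mu>. f (fst z)) = (LINT x|unif. f x)"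
    unfolding *(2)[symmetric] by (rule integral_distr[symmetric]) (use meas in auto)
  show "(LINT z|\<mu>. f (snd z)) = (LINT x|unif. f x)"
    unfolding *(3)[symmetric] by (rule integral_distr[symmetric]) (use meas in auto)
qed

lemma on_compact_set_integral:
  fixes f :: "'a::metric_space \<Rightarrow> real"
  assumes "on_compact K M" and f: "f \<in> borel_measurable borel"
  shows "(LINT x:K|M. f x) = (LINT x|M. f x)"
proof -
  have [measurable]: "f \<in> borel_measurable M" "K \<in> sets M"
    using assms by (auto simp: on_compact_def compact_imp_closed borel_closed cong: measurable_cong_sets)
  show ?thesis
    unfolding set_lebesgue_integral_def
    using assms by (intro integral_cong_AE) (auto simp: on_compact_def elim!: AE_mp)
qed

text \<open>
  The stationary points of the objective: \<open>ln \<alpha>\<close> and \<open>ln \<beta>\<close> are the Lagrange multipliers of the two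
  marginal constraints. The bounds make \<open>ln \<alpha>\<close> and \<open>ln \<beta>\<close> integrable with respect to every permuton.
\<close>

definition gibbs_form :: "(real \<times> real \<Rightarrow> real) \<Rightarrow> real \<Rightarrow> (real \<times> real) measure \<Rightarrow> bool" where
  "gibbs_form F \<theta> \<mu> \<longleftrightarrow> \<mu> \<in> permutons \<and> (\<exists>\<alpha> \<beta> l u. \<alpha> \<in> borel_measurable borel \<and> \<beta> \<in> borel_measurable borel
     \<and> 0 < l \<and> (\<forall>x. l \<le> \<alpha> x \<and> \<alpha> x \<le> u) \<and> (\<forall>x. l \<le> \<beta> x \<and> \<beta> x \<le> u)
     \<and> \<mu> = density (unif \<Otimes>\<^sub>M unif) (\<lambda>z. ennreal (\<alpha> (fst z) * \<beta> (snd z) * exp (\<theta> * F z))))"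

lemma log_exp_1: "log (exp 1) x = ln x"
  by (simp add: log_def)

text \<open>
  Expresses the divergence by a given density instead of the Radon--Nikodym derivative, which is
  determined only almost everywhere.
\<close>

lemma KL_real_density:
  fixes D :: "'a \<Rightarrow> real"
  assumes "prob_space M" and D [measurable]: "D \<in> borel_measurable M" "\<And>x. 0 \<le> D x"
    and "prob_space (density M D)"
  shows "KL (density M D) M =
    (if integrable M (\<lambda>x. D x * ln (D x)) then ereal (LINT x|M. D x * ln (D x)) else \<infinity>)"
proof -
  interpret M: prob_space M by fact
  have ac: "absolutely_continuous M (density M D)"
    by (intro absolutely_continuousI_density) auto
  have "AE x in M. ennreal (D x) = RN_deriv M (density M D) x"
    by (rule M.RN_deriv_unique) auto
  then have "AE x in M. entropy_density (exp 1) M (density M D) x = ln (D x)"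
  proof eventually_elim
    case (elim x)
    have "enn2real (RN_deriv M (density M D) x) = D x" unfolding elim[symmetric] using D(2) by simp
    then show ?case by (simp add: entropy_density_def log_exp_1)
  qed
  then have "AE x in density M D. entropy_density (exp 1) M (density M D) x = ln (D x)"
    by (intro absolutely_continuous_AE[OF _ ac]) auto
  then have "integrable (density M D) (entropy_density (exp 1) M (density M D))
      \<longleftrightarrow> integrable (density M D) (\<lambda>x. ln (D x))"
    by (intro integrable_cong_AE) auto
  also have "\<dots> \<longleftrightarrow> integrable M (\<lambda>x. D x * ln (D x))"
    using D(2) by (subst integrable_real_density) auto
  finally show ?thesis
    using ac D(2) by (simp add: KL_def M.KL_density log_exp_1)
qed

text \<open>
  The logarithm of the density of \<open>\<mu>\<close> is \<open>\<theta> F\<close> plus a function of each coordinate, and integrals of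
  functions of one coordinate are the same for all permutons. Hence the objective at \<open>\<nu>\<close> is a
  constant \<open>c\<close> minus the divergence of \<open>\<nu>\<close> from \<open>\<mu>\<close>, which is positive unless \<open>\<nu> = \<mu>\<close>.
\<close>

lemma gibbs_form_objective:
  assumes F: "continuous_on UNIV F" and \<mu>: "gibbs_form F \<theta> \<mu>"
  obtains c where "objective F \<theta> \<mu> = ereal c"
    and "\<And>\<nu>. \<nu> \<in> permutons \<Longrightarrow> \<nu> \<noteq> \<mu> \<Longrightarrow> objective F \<theta> \<nu> < ereal c"
proof -
  let ?u = "uniform_measure lborel unit_square"
  from \<mu> obtain \<alpha> \<beta> l u where \<mu>P: "\<mu> \<in> permutons" 
    and [measurable]: "\<alpha> \<in> borel_measurable borel" "\<beta> \<in> borel_measurable borel"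
    and l: "0 < l" and \<alpha>: "\<And>x. l \<le> \<alpha> x" "\<And>x. \<alpha> x \<le> u" and \<beta>: "\<And>x. l \<le> \<beta> x" "\<And>x. \<beta> x \<le> u"
    and \<mu>_eq: "\<mu> = density (unif \<Otimes>\<^sub>M unif) (\<lambda>z. ennreal (\<alpha> (fst z) * \<beta> (snd z) * exp (\<theta> * F z)))"
    unfolding gibbs_form_def by blast
  have Fm [measurable]: "F \<in> borel_measurable borel" using F by (rule borel_measurable_continuous_onI)
  have fs [measurable]: "fst \<in> measurable (borel :: (real \<times> real) measure) borel"
      "snd \<in> measurable (borel :: (real \<times> real) measure) borel"
    by (auto simp: borel_prod[symmetric])
  define f0 where "f0 z = \<alpha> (fst z) * \<beta> (snd z) * exp (\<theta> * F z)" for z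
  have f0m [measurable]: "f0 \<in> borel_measurable borel" unfolding f0_def by measurable
  have \<alpha>0: "0 < \<alpha> x" for x using l \<alpha>[of x] by linarith
  have \<beta>0: "0 < \<beta> x" for x using l \<beta>[of x] by linarith
  have f0: "0 < f0 z" for z by (simp add: f0_def \<alpha>0 \<beta>0)
  interpret u: prob_space ?u
    unfolding uniform_square_eq_pair
    by (intro prob_space_pair prob_space_unif)
  interpret \<mu>: prob_space \<mu> using \<mu>P by (simp add: permutons_def)
  interpret \<mu>: information_space \<mu> "exp 1" by unfold_locales simp
  have \<mu>_density: "\<mu> = density ?u f0" 
    unfolding \<mu>_eq uniform_square_eq_pair f0_def ..
  define c where "c = - (LINT x|unif. ln (\<alpha> x)) - (LINT x|unif. ln (\<beta> x))"
  have ln_bound: "\<bar>ln x\<bar> \<le> \<bar>ln l\<bar> + \<bar>ln u\<bar>" if "l \<le> x" "x \<le> u" for x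
  proof -
    have "ln l \<le> ln x" "ln x \<le> ln u" using that l by auto
    then show ?thesis by linarith
  qed
  have int_ln: "integrable \<nu> (\<lambda>z. ln (f0 z))" 
    "(LINT z|\<nu>. ln (f0 z)) = \<theta> * (LINT z:unit_square|\<nu>. F z) - c" if \<nu>: "\<nu> \<in> permutons" for \<nu>
  proof -
    interpret \<nu>: prob_space \<nu> using \<nu> by (simp add: permutons_def)
    have [measurable_cong]: "sets \<nu> = sets borel" using \<nu> by (simp add: permutons_def)
    have i1: "integrable \<nu> (\<lambda>z. ln (\<alpha> (fst z)))" and i2: "integrable \<nu> (\<lambda>z. ln (\<beta> (snd z)))"
      by (rule \<nu>.integrable_const_bound[of _ "\<bar>ln l\<bar> + \<bar>ln u\<bar>"]; simp add: ln_bound \<alpha> \<beta>)+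
    have i3: "integrable \<nu> F" by (rule on_compact_integrable[OF permutons_on_compact[OF \<nu>] F])
    have eq: "ln (f0 z) = ln (\<alpha> (fst z)) + ln (\<beta> (snd z)) + \<theta> * F z" for z
      using \<alpha>0[of "fst z"] \<beta>0[of "snd z"] by (simp add: f0_def ln_mult)
    show "integrable \<nu> (\<lambda>z. ln (f0 z))" unfolding eq using i1 i2 i3 by auto
    have "(LINT z|\<nu>. ln (f0 z)) = (LINT z|\<nu>. ln (\<alpha> (fst z))) + (LINT z|\<nu>. ln (\<beta> (snd z))) + \<theta> * (LINT z|\<nu>. F z)"
      unfolding eq using i1 i2 i3 by simp
    then show "(LINT z|\<nu>. ln (f0 z)) = \<theta> * (LINT z:unit_square|\<nu>. F z) - c"
      using permutons_integral_marginal[OF \<nu>, of "\<lambda>x. ln (\<alpha> x)"] permutons_integral_marginal[OF \<nu>, of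
          "\<lambda>x. ln (\<beta> x)"]
        on_compact_set_integral[OF permutons_on_compact[OF \<nu>] Fm]
      by (simp add: c_def)
  qed
  have fin: "integrable ?u (\<lambda>z. D z * ln (f0 z))" "(LINT z|?u. D z * ln (f0 z))
      = \<theta> * (LINT z:unit_square|\<nu>. F z) - c"
    if \<nu>: "\<nu> \<in> permutons" and D: "\<nu> = density ?u D" "D \<in> borel_measurable borel" "\<And>z. 0 \<le> D z" for \<nu> D
  proof -
    have [measurable]: "D \<in> borel_measurable borel" by fact
    show "integrable ?u (\<lambda>z. D z * ln (f0 z))"
      using int_ln(1)[OF \<nu>] D(3) unfolding D(1) by (subst (asm) integrable_real_density) auto
    show "(LINT z|?u. D z * ln (f0 z)) = \<theta> * (LINT z:unit_square|\<nu>. F z) - c"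
      unfolding int_ln(2)[OF \<nu>, symmetric] using D(3) unfolding D(1) by (subst integral_real_density) auto
  qed
  \<comment> \<open>The entropy of \<open>\<mu>\<close> cancels the energy term up to the two marginal integrals.\<close>
  have obj_\<mu>: "objective F \<theta> \<mu> = ereal c"
  proof -
    note f = fin[OF \<mu>P \<mu>_density f0m less_imp_le[OF f0]]
    have "KL \<mu> ?u = ereal (LINT z|?u. f0 z * ln (f0 z))"
      unfolding \<mu>_density using f(1) f0 \<mu>.prob_space_axioms
      by (subst KL_real_density) (auto simp: \<mu>_density[symmetric] u.prob_space_axioms less_imp_le)
    then show ?thesis by (simp add: objective_def f(2))
  qed
  have obj_less: "objective F \<theta> \<nu> < ereal c" if \<nu>: "\<nu> \<in> permutons" and neq: "\<nu> \<noteq> \<mu>" for \<nu>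
  proof (cases "KL \<nu> ?u = \<infinity>")
    case True
    then show ?thesis by (simp add: objective_def)
  next
    case False
    interpret \<nu>: prob_space \<nu> using \<nu> by (simp add: permutons_def)
    have sets: "sets \<nu> = sets ?u" using \<nu> by (simp add: permutons_def)
    have ac: "absolutely_continuous ?u \<nu>" using False by (auto simp: KL_def split: if_splits)
    from u.real_RN_deriv[OF \<nu>.finite_measure_axioms ac sets] obtain D
      where D: "D \<in> borel_measurable ?u" "AE x in ?u. RN_deriv ?u \<nu> x = ennreal (D x)" "\<And>x. 0 \<le> D x"
      by blast
    have Dm [measurable]: "D \<in> borel_measurable borel" using D(1) by simp
    have "\<nu> = density ?u (RN_deriv ?u \<nu>)" using ac sets by (rule u.density_RN_deriv[symmetric])
    also have "\<dots> = density ?u D" using D by (intro density_cong) auto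
    finally have \<nu>_eq: "\<nu> = density ?u D" .
    have "prob_space (density ?u D)" using \<nu>.prob_space_axioms \<nu>_eq by simp
    note KL_D = KL_real_density[OF u.prob_space_axioms D(1,3) this]
    have int: "integrable ?u (\<lambda>z. D z * ln (D z))"
      using False unfolding \<nu>_eq KL_D by (auto split: if_splits)
    have KL_\<nu>: "KL \<nu> ?u = ereal (LINT z|?u. D z * ln (D z))"
      using int unfolding \<nu>_eq KL_D by simp
    note f = fin[OF \<nu> \<nu>_eq Dm D(3)]
    have eq: "D z * ln (D z / f0 z) = D z * ln (D z) - D z * ln (f0 z)" for z
      using D(3)[of z] f0[of z] by (cases "D z = 0") (auto simp: ln_div right_diff_distrib less_le)
    \<comment> \<open>The density of \<open>\<nu>\<close> with respect to \<open>\<mu>\<close>\<close>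
    define D' where "D' z = D z / f0 z" for z
    have D'm [measurable]: "D' \<in> borel_measurable \<mu>" 
      unfolding D'_def \<mu>_density by simp
    have D'_nonneg: "0 \<le> D' z" for z
      using D(3)[of z] f0[of z] by (simp add: D'_def)
    have \<nu>_eq': "\<nu> = density \<mu> D'"
      unfolding \<mu>_density D'_def \<nu>_eq
      using D(3) f0 by (subst density_density_divide) (auto simp: less_imp_le less_imp_neq[symmetric])
    have int': "integrable \<mu> (\<lambda>z. D' z * log (exp 1) (D' z))"
    proof -
      have "integrable ?u (\<lambda>z. f0 z * (D' z * ln (D' z)))"
        using Bochner_Integration.integrable_diff[OF int f(1)] f0
        by (simp add: D'_def eq[symmetric] less_imp_neq[symmetric])
      then show ?thesis
        unfolding log_exp_1 \<mu>_density using f0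
            by (subst integrable_real_density) (auto simp: less_imp_le D'_def)
    qed
    have "0 < KL_divergence (exp 1) \<mu> (density \<mu> D')"
      using \<nu>_eq' neq \<nu>.prob_space_axioms D'm int' D'_nonneg
      by (intro \<mu>.KL_gt_0) auto
    also have "KL_divergence (exp 1) \<mu> (density \<mu> D') = (LINT z|\<mu>. D' z * ln (D' z))"
      using D'm D(3) f0 by (subst \<mu>.KL_density) (auto simp: log_exp_1 D'_def less_imp_le)
    also have "\<dots> = (LINT z|?u. f0 z * (D' z * ln (D' z)))"
      unfolding \<mu>_density using f0 by (subst integral_real_density) (auto simp: less_imp_le D'_def)
    also have "\<dots> = (LINT z|?u. D z * ln (D z) - D z * ln (f0 z))"
      unfolding eq[symmetric] using f0 by (simp add: D'_def less_imp_neq[symmetric])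
    also have "\<dots> = (LINT z|?u. D z * ln (D z)) - (\<theta> * (LINT z:unit_square|\<nu>. F z) - c)"
      using int f by simp
    finally show ?thesis
      unfolding objective_def KL_\<nu> by simp
  qed
  show ?thesis by (rule that[OF obj_\<mu> obj_less])
qed

lemma mu_opt_eq:
  assumes "continuous_on UNIV F" and \<mu>: "gibbs_form F \<theta> \<mu>"
  shows "mu_opt F \<theta> = \<mu>"
proof -
  from gibbs_form_objective[OF assms] obtain c where c: "objective F \<theta> \<mu> = ereal c"
    "\<And>\<nu>. \<nu> \<in> permutons \<Longrightarrow> \<nu> \<noteq> \<mu> \<Longrightarrow> objective F \<theta> \<nu> < ereal c" by blast
  have "\<mu> \<in> permutons" using \<mu> by (simp add: gibbs_form_def)
  with c show ?thesis
    unfolding mu_opt_def is_arg_max_def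
    by (intro the_equality) (auto, metis less_asym order.irrefl, metis)
qed

section \<open>The limiting constants\<close>

lemma continuous_on_Pair_compose:
  assumes F: "continuous_on UNIV F" and f: "continuous_on A f" and g: "continuous_on A g"
  shows "continuous_on A (\<lambda>x. F (f x, g x))"
  by (rule continuous_on_compose2[OF F continuous_on_Pair[OF f g]]) simp

lemma continuous_G_diff:
  assumes F: "continuous_on UNIV F" and f: "continuous_on A f" and g: "continuous_on A g"
  shows "continuous_on A (\<lambda>x. G_diff F (f x) (g x))"
  unfolding G_diff_def by (intro continuous_intros continuous_on_Pair_compose[OF F] f g)

lemma class_C_integral_zero:
  assumes F: "F \<in> class_C" and Fc: "continuous_on UNIV F"
  shows "x \<in> {0..1} \<Longrightarrow> (LINT y|unif. F (x, y)) = 0"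
    and "y \<in> {0..1} \<Longrightarrow> (LINT x|unif. F (x, y)) = 0"
    and "(LINT z|(unif \<Otimes>\<^sub>M unif). F z) = 0"
proof -
  have c1: "continuous_on UNIV (\<lambda>y. F (x, y))" and c2: "continuous_on UNIV (\<lambda>x. F (x, y))" for x y
    by (intro continuous_on_Pair_compose[OF Fc] continuous_intros)+
  show 1: "(LINT y|unif. F (x, y)) = 0" if "x \<in> {0..1}" for x
    using F that by (simp add: class_C_def integral_unif[OF c1])
  show "(LINT x|unif. F (x, y)) = 0" if "y \<in> {0..1}"
    using F that by (simp add: class_C_def integral_unif[OF c2])
  interpret U: prob_space unif by (rule prob_space_unif)
  interpret pair_prob_space unif unif ..
  have "(LINT z|(unif \<Otimes>\<^sub>M unif). F z) = (LINT x|unif. LINT y|unif. F (x, y))"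
    by (rule integral_fst'[symmetric], rule on_compact_integrable[OF on_compact_pair[OF on_compact_unif on_compact_unif] Fc])
  also have "\<dots> = (LINT x|unif. 0)"
    using AE_unif
  proof (intro integral_cong_AE)
    show "(\<lambda>x. LINT y|unif. F (x, y)) \<in> borel_measurable unif"
      using on_compact_integrable[OF on_compact_pair[OF on_compact_unif on_compact_unif] Fc]
      by (intro U.borel_measurable_lebesgue_integral) simp
  qed (auto elim!: AE_mp simp: 1)
  finally show "(LINT z|(unif \<Otimes>\<^sub>M unif). F z) = 0" by simp
qed

lemma sigma_sq_eq:
  assumes F: "continuous_on UNIV F" and \<mu>: "gibbs_form F \<theta> \<mu>"
  shows "sigma_sq F \<theta> = (LINT w|(\<mu> \<Otimes>\<^sub>M (\<mu> \<Otimes>\<^sub>M \<mu>)).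
     (G_diff F (fst w) (fst (snd w)) / (1 + exp (\<theta> * G_diff F (fst w) (fst (snd w)))))
     * (G_diff F (fst w) (snd (snd w)) / (1 + exp (\<theta> * G_diff F (fst w) (snd (snd w))))))"
proof -
  have \<mu>c: "on_compact unit_square \<mu>" using \<mu> by (simp add: gibbs_form_def permutons_on_compact)
  have m: "(\<lambda>w. G_diff F (fst w) (fst (snd w)) * G_diff F (fst w) (snd (snd w)) /
     ((1 + exp (\<theta> * G_diff F (fst w) (fst (snd w)))) * (1 + exp (\<theta>
         * G_diff F (fst w) (snd (snd w)))))) \<in> borel_measurable borel"
    by (intro borel_measurable_continuous_onI continuous_intros continuous_G_diff F)
       (auto simp: add_nonneg_eq_0_iff)
  show ?thesis
    unfolding sigma_sq_def mu_opt_eq[OF F \<mu>] case_prod_beta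
    by (subst on_compact_set_integral[OF on_compact_pair[OF \<mu>c on_compact_pair[OF \<mu>c \<mu>c]] m])
       (simp add: times_divide_times_eq)
qed

text \<open>
  Minus the derivative of \<open>G / (1 + exp (\<theta> G))\<close> with respect to \<open>\<theta>\<close>.
\<close>

definition info_kernel :: "(real \<times> real \<Rightarrow> real) \<Rightarrow> real \<Rightarrow> real \<times> real \<Rightarrow> real \<times> real \<Rightarrow> real" where
  "info_kernel F \<theta> z w = (G_diff F z w)\<^sup>2 * exp (\<theta> * G_diff F z w) / (1 + exp (\<theta> * G_diff F z w))\<^sup>2"

lemma continuous_info_kernel:
  assumes "continuous_on UNIV F" "continuous_on A f" "continuous_on A g"
  shows "continuous_on A (\<lambda>x. info_kernel F \<theta> (f x) (g x))"
  unfolding info_kernel_def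
  by (intro continuous_intros continuous_G_diff assms) (auto simp: add_nonneg_eq_0_iff)

lemma a_coeff_eq:
  assumes F: "continuous_on UNIV F" and \<mu>: "gibbs_form F \<theta> \<mu>"
  shows "a_coeff F \<theta> = 1 / 2 * (LINT w|(\<mu> \<Otimes>\<^sub>M \<mu>). info_kernel F \<theta> (fst w) (snd w))"
proof -
  have \<mu>c: "on_compact unit_square \<mu>" using \<mu> by (simp add: gibbs_form_def permutons_on_compact)
  have m: "(\<lambda>w. info_kernel F \<theta> (fst w) (snd w)) \<in> borel_measurable borel"
    by (intro borel_measurable_continuous_onI continuous_intros continuous_info_kernel F)
  show ?thesis
    unfolding a_coeff_def mu_opt_eq[OF F \<mu>] case_prod_beta info_kernel_def[symmetric]
    by (subst on_compact_set_integral[OF on_compact_pair[OF \<mu>c \<mu>c] m]) simp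
qed

text \<open>
  The density of \<open>\<mu>\<close> is positive everywhere, so the two measures have the same null sets.
\<close>

lemma gibbs_form_AE_imp_AE_square:
  assumes F: "continuous_on UNIV F" and \<mu>: "gibbs_form F \<theta> \<mu>" and P: "AE z in \<mu>. P z"
  shows "AE z in unif \<Otimes>\<^sub>M unif. P z"
proof -
  from \<mu> obtain \<alpha> \<beta> l u where [measurable]: "\<alpha> \<in> borel_measurable borel" "\<beta> \<in> borel_measurable borel"
    and l: "0 < l" and \<alpha>: "\<And>x. l \<le> \<alpha> x" and \<beta>: "\<And>x. l \<le> \<beta> x"
    and \<mu>_eq: "\<mu> = density (unif \<Otimes>\<^sub>M unif) (\<lambda>z. ennreal (\<alpha> (fst z) * \<beta> (snd z) * exp (\<theta> * F z)))"
    unfolding gibbs_form_def by blast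
  have [measurable]: "F \<in> borel_measurable (borel \<Otimes>\<^sub>M borel)"
    using F by (simp add: borel_prod borel_measurable_continuous_onI)
  have pos: "0 < \<alpha> x" "0 < \<beta> x" for x using l \<alpha>[of x] \<beta>[of x] by auto
  have "(\<lambda>z. ennreal (\<alpha> (fst z) * \<beta> (snd z) * exp (\<theta> * F z))) \<in> borel_measurable (unif \<Otimes>\<^sub>M unif)"
    by measurable
  from P[unfolded \<mu>_eq AE_density[OF this]] show ?thesis
    by eventually_elim (simp add: pos)
qed

text \<open>
  If the integral vanished, \<open>F(x\<^sub>1, y\<^sub>1) + F(x\<^sub>2, y\<^sub>2) = F(x\<^sub>1, y\<^sub>2) + F(x\<^sub>2, y\<^sub>1)\<close> would hold for almost
  all pairs of points. Integration over the second point removes every term except \<open>F(x\<^sub>1, y\<^sub>1)\<close>,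
  because the integrals of \<open>F\<close> in either coordinate are \<open>0\<close>; so \<open>F\<close> would be \<open>0\<close> almost everywhere.
\<close>

lemma a_coeff_pos:
  assumes FC: "F \<in> class_C" and F: "continuous_on UNIV F" and \<mu>: "gibbs_form F \<theta> \<mu>"
  shows "0 < a_coeff F \<theta>"
proof (rule ccontr)
  assume "\<not> 0 < a_coeff F \<theta>"
  have \<mu>c: "on_compact unit_square \<mu>" using \<mu> by (simp add: gibbs_form_def permutons_on_compact)
  interpret \<mu>: prob_space \<mu> using \<mu>c by (simp add: on_compact_def)
  interpret \<mu>\<mu>: pair_prob_space \<mu> \<mu> ..
  interpret U: prob_space unif by (rule prob_space_unif)
  interpret UU: pair_prob_space unif unif ..
  have kc: "continuous_on UNIV (\<lambda>w :: (real \<times> real) \<times> (real \<times> real). info_kernel F \<theta> (fst w) (snd w))"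
    by (intro continuous_intros continuous_info_kernel F)
  have k0: "0 \<le> info_kernel F \<theta> z w" for z w by (simp add: info_kernel_def)
  have int: "integrable (\<mu> \<Otimes>\<^sub>M \<mu>) (\<lambda>w. info_kernel F \<theta> (fst w) (snd w))"
    by (rule on_compact_integrable[OF on_compact_pair[OF \<mu>c \<mu>c] kc])
  have "(LINT w|(\<mu> \<Otimes>\<^sub>M \<mu>). info_kernel F \<theta> (fst w) (snd w)) \<ge> 0"
    by (rule integral_nonneg_AE) (simp add: k0)
  with \<open>\<not> 0 < a_coeff F \<theta>\<close> have "(LINT w|(\<mu> \<Otimes>\<^sub>M \<mu>). info_kernel F \<theta> (fst w) (snd w)) = 0"
    by (simp add: a_coeff_eq[OF F \<mu>])
  then have "AE w in \<mu> \<Otimes>\<^sub>M \<mu>. info_kernel F \<theta> (fst w) (snd w) = 0"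
    using integral_nonneg_eq_0_iff_AE[OF int] k0 by simp
  then have "AE w in \<mu> \<Otimes>\<^sub>M \<mu>. G_diff F (fst w) (snd w) = 0"
  proof eventually_elim
    case (elim w)
    have "1 + exp (\<theta> * G_diff F (fst w) (snd w)) > 0" by (simp add: add_pos_pos)
    with elim show ?case by (auto simp: info_kernel_def)
  qed
  from \<mu>\<mu>.AE_pair[OF this] have "AE z in \<mu>. AE w in \<mu>. G_diff F z w = 0" by simp
  then have "AE z in \<mu>. AE w in unif \<Otimes>\<^sub>M unif. G_diff F z w = 0"
    by eventually_elim (rule gibbs_form_AE_imp_AE_square[OF F \<mu>])
  then have "AE z in \<mu>. F z = 0"
    using \<mu>c[unfolded on_compact_def, THEN conjunct2, THEN conjunct2, THEN conjunct2]
  proof eventually_elim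
    case (elim z)
    let ?UU = "unif \<Otimes>\<^sub>M unif"
    have UUc: "on_compact unit_square ?UU" by (rule on_compact_pair[OF on_compact_unif on_compact_unif])
    have c: "continuous_on UNIV (\<lambda>w. F (fst z, snd w))" "continuous_on UNIV (\<lambda>w. F (fst w, snd z))"
      by (intro continuous_on_Pair_compose[OF F] continuous_intros)+
    note ints = on_compact_integrable[OF UUc F] on_compact_integrable[OF UUc c(1)] on_compact_integrable[OF UUc c(2)]
    have z: "fst z \<in> {0..1}" "snd z \<in> {0..1}" using elim(2) by (auto simp: mem_Times_iff)
    have c1: "continuous_on UNIV (\<lambda>y. F (fst z, y))" "continuous_on UNIV (\<lambda>y. F (y, snd z))"
      by (intro continuous_on_Pair_compose[OF F] continuous_intros)+
    note i1 = on_compact_integrable[OF on_compact_unif c1(1)] on_compact_integrable[OF on_compact_unif c1(2)]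
    have m1: "(LINT w|?UU. F (fst z, snd w)) = 0"
      using integral_pair_mult[OF prob_space_unif prob_space_unif _ i1(1), of "\<lambda>_. 1"]
        class_C_integral_zero(1)[OF FC F z(1)] by simp
    have m2: "(LINT w|?UU. F (fst w, snd z)) = 0"
      using integral_pair_mult[OF prob_space_unif prob_space_unif i1(2), of "\<lambda>_. 1"]
        class_C_integral_zero(2)[OF FC F z(2)] by simp
    have "0 = (LINT w|?UU. 0 :: real)" by simp
    also have "\<dots> = (LINT w|?UU. F z + F w - F (fst z, snd w) - F (fst w, snd z))"
      using elim(1) ints by (intro integral_cong_AE) (auto simp: G_diff_def elim!: AE_mp)
    also have "\<dots> = F z"
      using ints by (simp add: m1 m2 class_C_integral_zero(3)[OF FC F] UU.prob_space)
    finally show ?case by simp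
  qed
  from gibbs_form_AE_imp_AE_square[OF F \<mu> this] FC show False
    unfolding class_C_def uniform_square_eq_pair by blast
qed

section \<open>Exchanging two images of a random permutation\<close>

definition grid_pt :: "nat \<Rightarrow> (nat \<Rightarrow> nat) \<Rightarrow> nat \<Rightarrow> real \<times> real" where
  "grid_pt n p i = (real i / real n, real (p i) / real n)"

text \<open>
  Exchanging second coordinates turns the points \<open>(x\<^sub>1, y\<^sub>1)\<close>, \<open>(x\<^sub>2, y\<^sub>2)\<close> into \<open>(x\<^sub>1, y\<^sub>2)\<close>, \<open>(x\<^sub>2, y\<^sub>1)\<close>;
  the exponential is the factor by which the weight of a permutation changes.
\<close>

definition swap_odd :: "(real \<times> real \<Rightarrow> real) \<Rightarrow> real \<Rightarrow> (real \<times> real \<Rightarrow> real \<times> real \<Rightarrow> real) \<Rightarrow> bool" where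
  "swap_odd F \<theta> Q \<longleftrightarrow>
     (\<forall>x1 y1 x2 y2. Q (x1, y2) (x2, y1) * exp (- \<theta> * G_diff F (x1, y1) (x2, y2)) = - Q (x1, y1) (x2, y2))"

definition perm_weight :: "(real \<times> real \<Rightarrow> real) \<Rightarrow> nat \<Rightarrow> real \<Rightarrow> (nat \<Rightarrow> nat) \<Rightarrow> real" where
  "perm_weight F n \<theta> p = exp (\<theta> * perm_stat F n p - log_Z F n \<theta>)"

lemma finite_perms [simp]: "finite (perms n)"
  by (simp add: perms_def finite_permutations)

lemma perms_in_range: "p \<in> perms n \<Longrightarrow> i \<in> {1..n} \<Longrightarrow> p i \<in> {1..n}"
  by (metis mem_Collect_eq perms_def permutes_in_image)

lemma y_diff_eq_G_diff: "y_diff F n p i j = G_diff F (grid_pt n p i) (grid_pt n p j)"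
  by (simp add: y_diff_def G_diff_def grid_pt_def)

lemma integral_perm_law:
  fixes f :: "(nat \<Rightarrow> nat) \<Rightarrow> 'b::{banach, second_countable_topology}"
  shows "(LINT p|perm_law F n \<theta>. f p) = (\<Sum>p\<in>perms n. perm_weight F n \<theta> p *\<^sub>R f p)"
  unfolding perm_law_def perm_weight_def
  by (subst lebesgue_integral_point_measure_finite) auto

lemma integrable_perm_law [simp]:
  fixes f :: "(nat \<Rightarrow> nat) \<Rightarrow> 'b::{banach, second_countable_topology}"
  shows "integrable (perm_law F n \<theta>) f"
  unfolding perm_law_def by (intro integrable_point_measure_finite) auto

lemma space_perm_law [simp]: "space (perm_law F n \<theta>) = perms n"
  by (simp add: perm_law_def space_point_measure)

lemma sets_perm_law [simp]: "sets (perm_law F n \<theta>) = Pow (perms n)"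
  by (simp add: perm_law_def sets_point_measure)

lemma measurable_perm_law [simp]: "f \<in> measurable (perm_law F n \<theta>) M \<longleftrightarrow> f \<in> perms n \<rightarrow> space M"
  by (simp add: perm_law_def)

lemma perm_stat_swap:
  assumes p: "p \<in> perms n" and ij: "i \<in> {1..n}" "j \<in> {1..n}"
  shows "perm_stat F n (p \<circ> Transposition.transpose i j) = perm_stat F n p - y_diff F n p i j"
proof (cases "i = j")
  case True
  then show ?thesis by (simp add: y_diff_def)
next
  case False
  let ?f = "\<lambda>q k. F (real k / real n, real (q k) / real n)"
  have split: "perm_stat F n q = ?f q i + ?f q j + (\<Sum>k\<in>{1..n} - {i, j}. ?f q k)" for q
  proof -
    have "perm_stat F n q = (\<Sum>k\<in>{i, j}. ?f q k) + (\<Sum>k\<in>{1..n} - {i, j}. ?f q k)"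
      unfolding perm_stat_def using ij
      by (subst sum.subset_diff[of "{i, j}"]) auto
    then show ?thesis using False by simp
  qed
  have "(\<Sum>k\<in>{1..n} - {i, j}. ?f (p \<circ> Transposition.transpose i j) k) = (\<Sum>k\<in>{1..n} - {i, j}. ?f p k)"
    by (intro sum.cong) (auto simp: Transposition.transpose_def)
  then show ?thesis
    by (simp add: split[of p] split[of "p \<circ> Transposition.transpose i j"] y_diff_def)
qed

lemma bij_betw_perms_swap:
  assumes ij: "i \<in> {1..n}" "j \<in> {1..n}"
  shows "bij_betw (\<lambda>p. p \<circ> Transposition.transpose i j) (perms n) (perms n)"
proof (rule bij_betwI[where g = "\<lambda>p. p \<circ> Transposition.transpose i j"])
  show "(\<lambda>p. p \<circ> Transposition.transpose i j) \<in> perms n \<rightarrow> perms n"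
    using ij by (auto simp: perms_def intro!: permutes_compose permutes_swap_id)
  then show "(\<lambda>p. p \<circ> Transposition.transpose i j) \<in> perms n \<rightarrow> perms n" .
qed (auto simp: comp_assoc)

text \<open>
  Composition with a transposition permutes the set of permutations, and the exponential is the
  quotient of the weights of the two permutations involved.
\<close>

lemma swap_change_of_law:
  fixes \<psi> :: "(nat \<Rightarrow> nat) \<Rightarrow> 'b::{banach, second_countable_topology}"
  assumes ij: "i \<in> {1..n}" "j \<in> {1..n}"
  shows "(LINT p|perm_law F n \<theta>. \<psi> (p \<circ> Transposition.transpose i j))
       = (LINT p|perm_law F n \<theta>. exp (- \<theta> * y_diff F n p i j) *\<^sub>R \<psi> p)"
proof -
  have w: "perm_weight F n \<theta> (p \<circ> Transposition.transpose i j)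
      = perm_weight F n \<theta> p * exp (- \<theta> * y_diff F n p i j)" if "p \<in> perms n" for p
    unfolding perm_weight_def perm_stat_swap[OF that ij] exp_add[symmetric]
    by (rule arg_cong[where f = exp]) (simp add: algebra_simps)
  have "(\<Sum>p\<in>perms n. perm_weight F n \<theta> p *\<^sub>R (exp (- \<theta> * y_diff F n p i j) *\<^sub>R \<psi> p))
      = (\<Sum>p\<in>perms n. perm_weight F n \<theta> (p \<circ> Transposition.transpose i j) *\<^sub>R \<psi> p)"
    by (intro sum.cong refl) (simp only: w scaleR_scaleR)
  also have "\<dots> = (\<Sum>p\<in>perms n. perm_weight F n \<theta> ((p \<circ> Transposition.transpose i j) \<circ> Transposition.transpose i j)
                     *\<^sub>R \<psi> (p \<circ> Transposition.transpose i j))"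
    by (rule sum.reindex_bij_betw[OF bij_betw_perms_swap[OF ij], symmetric])
  also have "\<dots> = (\<Sum>p\<in>perms n. perm_weight F n \<theta> p *\<^sub>R \<psi> (p \<circ> Transposition.transpose i j))"
    by (simp add: comp_assoc)
  finally show ?thesis
    by (simp add: integral_perm_law)
qed

lemma grid_pt_swap:
  "grid_pt n (p \<circ> Transposition.transpose i j) k =
     (if k = i then (fst (grid_pt n p i), snd (grid_pt n p j))
      else if k = j then (fst (grid_pt n p j), snd (grid_pt n p i)) else grid_pt n p k)"
  by (auto simp: grid_pt_def Transposition.transpose_def)

text \<open>
  The change of variables by the transposition turns the integral into its negative.
\<close>

lemma swap_odd_centered:
  fixes \<psi> :: "(nat \<Rightarrow> nat) \<Rightarrow> 'b::{banach, second_countable_topology}"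
  assumes Q: "swap_odd F \<theta> Q" and ij: "i \<in> {1..n}" "j \<in> {1..n}"
    and inv: "\<And>p. p \<in> perms n \<Longrightarrow> \<psi> (p \<circ> Transposition.transpose i j) = \<psi> p"
  shows "(LINT p|perm_law F n \<theta>. Q (grid_pt n p i) (grid_pt n p j) *\<^sub>R \<psi> p) = 0"
proof -
  define \<xi> where "\<xi> p = Q (grid_pt n (p \<circ> Transposition.transpose i j) i) (grid_pt n (p \<circ> Transposition.transpose i j) j) *\<^sub>R \<psi> p" for p
  have Q0: "Q z z = 0" for z
    using Q[unfolded swap_odd_def, rule_format, of "fst z" "snd z" "fst z" "snd z"]
    by (cases z) (simp add: G_diff_def)
  have odd: "exp (- \<theta> * y_diff F n p i j)
      * Q (grid_pt n (p \<circ> Transposition.transpose i j) i) (grid_pt n (p \<circ> Transposition.transpose i j) j)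
      = - Q (grid_pt n p i) (grid_pt n p j)" for p
  proof (cases "i = j")
    case False
    have "Q (fst (grid_pt n p i), snd (grid_pt n p j)) (fst (grid_pt n p j), snd (grid_pt n p i))
        * exp (- \<theta> * G_diff F (grid_pt n p i) (grid_pt n p j)) = - Q (grid_pt n p i) (grid_pt n p j)"
      using Q[unfolded swap_odd_def, rule_format, of "fst (grid_pt n p i)" "snd (grid_pt n p j)"
         "fst (grid_pt n p j)" "snd (grid_pt n p i)"] by (simp only: prod.collapse)
    with False show ?thesis
      unfolding y_diff_eq_G_diff by (simp add: grid_pt_swap mult.commute)
  qed (simp add: Q0)
  have "(LINT p|perm_law F n \<theta>. Q (grid_pt n p i) (grid_pt n p j) *\<^sub>R \<psi> p)
      = (LINT p|perm_law F n \<theta>. \<xi> (p \<circ> Transposition.transpose i j))"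
    by (intro Bochner_Integration.integral_cong refl)
       (simp add: \<xi>_def inv comp_assoc)
  also have "\<dots> = (LINT p|perm_law F n \<theta>. exp (- \<theta> * y_diff F n p i j) *\<^sub>R \<xi> p)"
    by (rule swap_change_of_law[OF ij])
  also have "\<dots> = (LINT p|perm_law F n \<theta>. - (Q (grid_pt n p i) (grid_pt n p j) *\<^sub>R \<psi> p))"
    by (intro Bochner_Integration.integral_cong refl) (simp only: \<xi>_def scaleR_scaleR odd scaleR_minus_left)
  finally have "(LINT p|perm_law F n \<theta>. Q (grid_pt n p i) (grid_pt n p j) *\<^sub>R \<psi> p)
      = - (LINT p|perm_law F n \<theta>. Q (grid_pt n p i) (grid_pt n p j) *\<^sub>R \<psi> p)"
    by simp
  then have "2 *\<^sub>R (LINT p|perm_law F n \<theta>. Q (grid_pt n p i) (grid_pt n p j) *\<^sub>R \<psi> p) = 0"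
    unfolding scaleR_2 by (simp only: eq_neg_iff_add_eq_0)
  then show ?thesis by simp
qed

definition pair_sum :: "(real \<times> real \<Rightarrow> real \<times> real \<Rightarrow> real) \<Rightarrow> nat \<Rightarrow> (nat \<Rightarrow> nat) \<Rightarrow> real" where
  "pair_sum Q n p = (\<Sum>i\<in>{1..n}. \<Sum>j\<in>{1..n}. Q (grid_pt n p i) (grid_pt n p j))"

text \<open>
  The part of the double sum that does not change when the images of \<open>i\<close> and \<open>j\<close> are exchanged.
\<close>

definition pair_sum_off :: "(real \<times> real \<Rightarrow> real \<times> real \<Rightarrow> real) \<Rightarrow> nat \<Rightarrow> nat \<Rightarrow> nat \<Rightarrow> (nat \<Rightarrow> nat) \<Rightarrow> real" where
  "pair_sum_off Q n i j p =
     (\<Sum>k\<in>{1..n} - {i, j}. \<Sum>l\<in>{1..n} - {i, j}. Q (grid_pt n p k) (grid_pt n p l))"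

lemma pair_sum_off_swap: "pair_sum_off Q n i j (p \<circ> Transposition.transpose i j) = pair_sum_off Q n i j p"
  unfolding pair_sum_off_def by (intro sum.cong refl) (auto simp: grid_pt_swap)

lemma pair_sum_split:
  fixes n i j p
  assumes ij: "i \<in> {1..n}" "j \<in> {1..n}"
  shows "pair_sum Q n p = pair_sum_off Q n i j p
    + ((\<Sum>k\<in>{i, j}. \<Sum>l\<in>{1..n}. Q (grid_pt n p k) (grid_pt n p l))
      + (\<Sum>k\<in>{1..n} - {i, j}. \<Sum>l\<in>{i, j}. Q (grid_pt n p k) (grid_pt n p l)))"
proof -
  let ?q = "\<lambda>k l. Q (grid_pt n p k) (grid_pt n p l)"
  have sub: "{i, j} \<subseteq> {1..n}" using ij by auto
  have inner: "(\<Sum>l\<in>{1..n}. ?q k l) = (\<Sum>l\<in>{1..n} - {i, j}. ?q k l) + (\<Sum>l\<in>{i, j}. ?q k l)" for k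
    by (rule sum.subset_diff[OF sub]) simp
  have "pair_sum Q n p = (\<Sum>k\<in>{1..n} - {i, j}. \<Sum>l\<in>{1..n}. ?q k l) + (\<Sum>k\<in>{i, j}. \<Sum>l\<in>{1..n}. ?q k l)"
    unfolding pair_sum_def by (rule sum.subset_diff[OF sub]) simp
  also have "(\<Sum>k\<in>{1..n} - {i, j}. \<Sum>l\<in>{1..n}. ?q k l)
     = pair_sum_off Q n i j p + (\<Sum>k\<in>{1..n} - {i, j}. \<Sum>l\<in>{i, j}. ?q k l)"
    unfolding inner pair_sum_off_def by (rule sum.distrib)
  finally show ?thesis by (simp add: algebra_simps)
qed

lemma grid_pt_in_square: "p \<in> perms n \<Longrightarrow> i \<in> {1..n} \<Longrightarrow> grid_pt n p i \<in> unit_square"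
  using perms_in_range[of p n i] by (auto simp: grid_pt_def)

lemma pair_sum_diff_off_le:
  assumes p: "p \<in> perms n" and ij: "i \<in> {1..n}" "j \<in> {1..n}" and C: "\<And>z w. z \<in> unit_square \<Longrightarrow> w \<in> unit_square
      \<Longrightarrow> \<bar>Q z w\<bar> \<le> C"
  shows "\<bar>pair_sum Q n p - pair_sum_off Q n i j p\<bar> \<le> 4 * real n * C"
proof -
  let ?q = "\<lambda>k l. Q (grid_pt n p k) (grid_pt n p l)"
  have C0: "0 \<le> C" using C[of "(0, 0)" "(0, 0)"] by simp
  have card2: "card {i, j} \<le> 2" by (simp add: card_insert_if)
  have bd: "\<bar>\<Sum>k\<in>A. \<Sum>l\<in>B. ?q k l\<bar> \<le> real (card A) * (real (card B) * C)"
    if "A \<subseteq> {1..n}" "B \<subseteq> {1..n}" for A B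
  proof -
    have "\<bar>\<Sum>k\<in>A. \<Sum>l\<in>B. ?q k l\<bar> \<le> (\<Sum>k\<in>A. \<Sum>l\<in>B. \<bar>?q k l\<bar>)"
      by (intro order.trans[OF sum_abs] sum_mono order.refl)
    also have "\<dots> \<le> (\<Sum>k\<in>A. \<Sum>l\<in>B. C)" using that by (intro sum_mono C grid_pt_in_square[OF p]) auto
    finally show ?thesis by simp
  qed
  have "\<bar>\<Sum>k\<in>{i, j}. \<Sum>l\<in>{1..n}. ?q k l\<bar> \<le> 2 * (real n * C)"
    using C0 card2 ij by (intro order.trans[OF bd] mult_mono) auto
  moreover have "\<bar>\<Sum>k\<in>{1..n} - {i, j}. \<Sum>l\<in>{i, j}. ?q k l\<bar> \<le> real n * (2 * C)"
  proof (intro order.trans[OF bd] mult_mono)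
    have "card ({1..n} - {i, j}) \<le> card {1..n}" by (intro card_mono) auto
    then show "real (card ({1..n} - {i, j})) \<le> real n" by simp
  qed (use C0 card2 ij in auto)
  ultimately show ?thesis
    unfolding pair_sum_split[OF ij, of Q p] add_diff_cancel_left' by linarith
qed

lemma swap_odd_expectation_cong:
  fixes f g :: "(nat \<Rightarrow> nat) \<Rightarrow> 'b::{banach, second_countable_topology}"
  assumes Q: "swap_odd F \<theta> Q" and ij: "i \<in> {1..n}" "j \<in> {1..n}"
    and inv: "\<And>p. g (p \<circ> Transposition.transpose i j) = g p"
  shows "(LINT p|perm_law F n \<theta>. Q (grid_pt n p i) (grid_pt n p j) *\<^sub>R f p)
    = (LINT p|perm_law F n \<theta>. Q (grid_pt n p i) (grid_pt n p j) *\<^sub>R (f p - g p))"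
  using swap_odd_centered[OF Q ij, of g] inv by (simp add: scaleR_diff_right)

lemma norm_expectation_le:
  fixes f :: "(nat \<Rightarrow> nat) \<Rightarrow> 'b::{banach, second_countable_topology}"
  assumes "\<And>p. p \<in> perms n \<Longrightarrow> norm (f p) \<le> B"
  shows "norm (LINT p|perm_law F n \<theta>. f p) \<le> B"
proof -
  interpret prob_space "perm_law F n \<theta>" by (rule prob_space_perm_law)
  have "norm (LINT p|perm_law F n \<theta>. f p) \<le> (LINT p|perm_law F n \<theta>. norm (f p))"
    by (rule integral_norm_bound)
  also have "\<dots> \<le> (LINT p|perm_law F n \<theta>. B)"
    using assms by (intro integral_mono) auto
  also have "\<dots> = B" using prob_space by simp
  finally show ?thesis .
qed

text \<open>
  In the expansion of the square, a term \<open>Q(z\<^sub>i, z\<^sub>j)\<close> is orthogonal to the sum of all terms that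
  involve neither \<open>i\<close> nor \<open>j\<close>. Only \<open>O(n)\<close> partners remain for each of the \<open>n\<^sup>2\<close> terms.
\<close>

lemma pair_sum_second_moment:
  assumes Q: "swap_odd F \<theta> Q" and C: "\<And>z w. z \<in> unit_square \<Longrightarrow> w \<in> unit_square \<Longrightarrow> \<bar>Q z w\<bar> \<le> C"
  shows "(LINT p|perm_law F n \<theta>. (pair_sum Q n p)\<^sup>2) \<le> 4 * C\<^sup>2 * real n ^ 3"
proof -
  let ?q = "\<lambda>i j p. Q (grid_pt n p i) (grid_pt n p j)"
  have C0: "0 \<le> C" using C[of "(0, 0)" "(0, 0)"] by simp
  have le: "(LINT p|perm_law F n \<theta>. ?q i j p * pair_sum Q n p) \<le> C * (4 * real n * C)"
    if ij: "i \<in> {1..n}" "j \<in> {1..n}" for i j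
  proof -
    have "(LINT p|perm_law F n \<theta>. ?q i j p * pair_sum Q n p)
       = (LINT p|perm_law F n \<theta>. ?q i j p * (pair_sum Q n p - pair_sum_off Q n i j p))"
      using swap_odd_expectation_cong[OF Q ij, of "pair_sum_off Q n i j" "pair_sum Q n"]
      by (simp add: pair_sum_off_swap)
    also have "\<dots> \<le> norm \<dots>" by simp
    also have "\<dots> \<le> C * (4 * real n * C)"
      by (intro norm_expectation_le)
         (auto simp: abs_mult intro!: mult_mono C grid_pt_in_square pair_sum_diff_off_le[OF _ ij] C0 simp del: mem_Times_iff intro: ij)
    finally show ?thesis .
  qed
  have "(LINT p|perm_law F n \<theta>. (pair_sum Q n p)\<^sup>2)
      = (LINT p|perm_law F n \<theta>. (\<Sum>i\<in>{1..n}. \<Sum>j\<in>{1..n}. ?q i j p * pair_sum Q n p))"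
    by (simp add: power2_eq_square pair_sum_def[of Q n] sum_distrib_right)
  also have "\<dots> = (\<Sum>i\<in>{1..n}. \<Sum>j\<in>{1..n}. LINT p|perm_law F n \<theta>. ?q i j p * pair_sum Q n p)"
    by (simp add: Bochner_Integration.integral_sum)
  also have "\<dots> \<le> (\<Sum>i\<in>{1..n}. \<Sum>j\<in>{1..n}. C * (4 * real n * C))"
    by (intro sum_mono le)
  also have "\<dots> = 4 * C\<^sup>2 * real n ^ 3"
    by (simp add: power2_eq_square power3_eq_cube algebra_simps)
  finally show ?thesis .
qed

text \<open>
  For a symmetric swap-odd kernel this is half of \<open>\<Sum> Q(z\<^sub>i, z\<^sub>j) U\<^sub>i\<^sub>j\<close>, where \<open>U\<^sub>i\<^sub>j\<close> is the sum of all
  terms for unordered pairs that contain \<open>i\<close> or \<open>j\<close>. The second sum corrects for the pair \<open>{i, j}\<close>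
  itself, which the first one counts twice.
\<close>

definition stein_var :: "(real \<times> real \<Rightarrow> real \<times> real \<Rightarrow> real) \<Rightarrow> nat \<Rightarrow> (nat \<Rightarrow> nat) \<Rightarrow> real" where
  "stein_var Q n p =
     (\<Sum>i\<in>{1..n}. \<Sum>j\<in>{1..n}. \<Sum>k\<in>{1..n}.
        Q (grid_pt n p i) (grid_pt n p j) * Q (grid_pt n p i) (grid_pt n p k))
     - 1 / 2 * (\<Sum>i\<in>{1..n}. \<Sum>j\<in>{1..n}. (Q (grid_pt n p i) (grid_pt n p j))\<^sup>2)"

lemma swap_odd_diag: "swap_odd F \<theta> Q \<Longrightarrow> Q z z = 0"
  unfolding swap_odd_def G_diff_def
  by (cases z, drule spec[of _ "fst z"], drule spec[of _ "snd z"], 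
      drule spec[of _ "fst z"], drule spec[of _ "snd z"]) simp

lemma pair_sum_diff_off_sym:
  assumes ij: "i \<in> {1..n}" "j \<in> {1..n}" and neq: "i \<noteq> j"
    and sym: "\<And>z w. Q z w = Q w z" and diag: "\<And>z. Q z z = 0"
  shows "pair_sum Q n p - pair_sum_off Q n i j p
    = 2 * ((\<Sum>k\<in>{1..n}. Q (grid_pt n p i) (grid_pt n p k)) + (\<Sum>k\<in>{1..n}. Q (grid_pt n p j) (grid_pt n p k))
        - Q (grid_pt n p i) (grid_pt n p j))"
proof -
  let ?q = "\<lambda>k l. Q (grid_pt n p k) (grid_pt n p l)"
  have sub: "{i, j} \<subseteq> {1..n}" using ij by auto
  have off: "(\<Sum>l\<in>{1..n} - {i, j}. ?q l k) = (\<Sum>l\<in>{1..n}. ?q k l) - ?q i j" if "k \<in> {i, j}" for k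
  proof -
    have "(\<Sum>l\<in>{1..n}. ?q k l) = (\<Sum>l\<in>{1..n} - {i, j}. ?q k l) + (\<Sum>l\<in>{i, j}. ?q k l)"
      by (rule sum.subset_diff[OF sub]) simp
    also have "(\<Sum>l\<in>{i, j}. ?q k l) = ?q i j"
      using that neq diag[of "grid_pt n p i"] diag[of "grid_pt n p j"]
        sym[of "grid_pt n p j" "grid_pt n p i"] by auto
    also have "(\<Sum>l\<in>{1..n} - {i, j}. ?q k l) = (\<Sum>l\<in>{1..n} - {i, j}. ?q l k)"
      by (intro sum.cong refl sym)
    finally show ?thesis by simp
  qed
  have "(\<Sum>k\<in>{1..n} - {i, j}. \<Sum>l\<in>{i, j}. ?q k l) = (\<Sum>l\<in>{i, j}. \<Sum>k\<in>{1..n} - {i, j}. ?q k l)"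
    by (rule sum.swap)
  also have "\<dots> = (\<Sum>l\<in>{i, j}. (\<Sum>k\<in>{1..n}. ?q l k) - ?q i j)"
    by (intro sum.cong refl off)
  finally show ?thesis
    unfolding pair_sum_split[OF ij, of Q p] using neq by simp
qed

text \<open>
  The second order Taylor bound for \<open>s \<mapsto> exp (i \<tau> s)\<close>, expanded backwards from \<open>s\<close>.
\<close>

lemma iexp_increment:
  "cmod (iexp (\<tau> * s) - iexp (\<tau> * (s - u)) - \<i> * \<tau> * u * iexp (\<tau> * s)) \<le> \<tau>\<^sup>2 * u\<^sup>2 / 2"
proof -
  have "iexp (\<tau> * s) - iexp (\<tau> * (s - u)) - \<i> * \<tau> * u * iexp (\<tau> * s)
      = - (iexp (\<tau> * s) * (iexp (- \<tau> * u) - (1 + \<i> * of_real (- \<tau> * u))))"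
    by (simp add: algebra_simps flip: exp_add)
  also have "cmod \<dots> = cmod (iexp (- \<tau> * u) - (1 + \<i> * of_real (- \<tau> * u)))"
    by (simp only: norm_minus_cancel norm_mult) simp
  also have "\<dots> \<le> (\<bar>- \<tau> * u\<bar>)\<^sup>2 / 2"
    using iexp_approx1[of "- \<tau> * u" 1] by (simp add: numeral_2_eq_2)
  also have "\<dots> = \<tau>\<^sup>2 * u\<^sup>2 / 2" by (simp add: power_mult_distrib)
  finally show ?thesis .
qed

text \<open>
  Let \<open>U\<^sub>i\<^sub>j\<close> be the part of \<open>S\<close> that involves \<open>i\<close> or \<open>j\<close>. As \<open>S - U\<^sub>i\<^sub>j\<close> is unchanged by the exchange,
  \<open>exp (i \<tau> (S - U\<^sub>i\<^sub>j))\<close> may be subtracted from \<open>exp (i \<tau> S)\<close> in the expectation of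
  \<open>Q(z\<^sub>i, z\<^sub>j) exp (i \<tau> S)\<close>. The difference is \<open>i \<tau> U\<^sub>i\<^sub>j exp (i \<tau> S)\<close> up to \<open>\<tau>\<^sup>2 U\<^sub>i\<^sub>j\<^sup>2 / 2\<close>, and \<open>U\<^sub>i\<^sub>j\<close> is of
  order \<open>n\<close>.
\<close>

lemma stein_identity:
  fixes n :: nat and \<tau> :: real
  assumes Q: "swap_odd F \<theta> Q" and sym: "\<And>z w. Q z w = Q w z" and C: "\<And>z w. z \<in> unit_square \<Longrightarrow> w \<in> unit_square
      \<Longrightarrow> \<bar>Q z w\<bar> \<le> C"
  defines "S \<equiv> \<lambda>p. pair_sum Q n p / 2"
  shows "cmod ((LINT p|perm_law F n \<theta>. S p * iexp (\<tau> * S p))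
      - \<i> * \<tau> * (LINT p|perm_law F n \<theta>. stein_var Q n p * iexp (\<tau> * S p))) \<le> \<tau>\<^sup>2 * C ^ 3 * real n ^ 4"
proof -
  let ?E = "\<lambda>f. (LINT p|perm_law F n \<theta>. f p)"
  let ?q = "\<lambda>i j p. Q (grid_pt n p i) (grid_pt n p j)"
  define U where "U i j p = (pair_sum Q n p - pair_sum_off Q n i j p) / 2" for i j p
  have C0: "0 \<le> C" using C[of "(0, 0)" "(0, 0)"] by simp
  have diag: "Q z z = 0" for z by (rule swap_odd_diag[OF Q])
  have S_sum: "S p = 1 / 2 * (\<Sum>i\<in>{1..n}. \<Sum>j\<in>{1..n}. ?q i j p)" for p
    by (simp add: S_def pair_sum_def)
  have var: "stein_var Q n p = 1 / 2 * (\<Sum>i\<in>{1..n}. \<Sum>j\<in>{1..n}. ?q i j p * U i j p)" for p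
  proof -
    let ?r = "\<lambda>i. \<Sum>k\<in>{1..n}. ?q i k p"
    have "?q i j p * U i j p = ?q i j p * ?r i + ?q j i p * ?r j - (?q i j p)\<^sup>2"
      if "i \<in> {1..n}" "j \<in> {1..n}" for i j
    proof (cases "i = j")
      case False
      then show ?thesis
        unfolding U_def pair_sum_diff_off_sym[where Q = Q, OF that False sym diag] 
        by (simp add: field_simps power2_eq_square sym[of "grid_pt n p j" "grid_pt n p i"])
    qed (simp add: diag)
    then have "(\<Sum>i\<in>{1..n}. \<Sum>j\<in>{1..n}. ?q i j p * U i j p)
       = (\<Sum>i\<in>{1..n}. \<Sum>j\<in>{1..n}. ?q i j p * ?r i + ?q j i p * ?r j - (?q i j p)\<^sup>2)"
      by (intro sum.cong refl) blast
    also have "\<dots> = (\<Sum>i\<in>{1..n}. \<Sum>j\<in>{1..n}. ?q i j p * ?r i) + (\<Sum>i\<in>{1..n}. \<Sum>j\<in>{1..n}. ?q j i p * ?r j)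
        - (\<Sum>i\<in>{1..n}. \<Sum>j\<in>{1..n}. (?q i j p)\<^sup>2)"
      by (simp add: sum.distrib sum_subtractf)
    also have "(\<Sum>i\<in>{1..n}. \<Sum>j\<in>{1..n}. ?q j i p * ?r j) = (\<Sum>i\<in>{1..n}. \<Sum>j\<in>{1..n}. ?q i j p * ?r i)"
      by (rule sum.swap)
    also have "(\<Sum>i\<in>{1..n}. \<Sum>j\<in>{1..n}. ?q i j p * ?r i)
        = (\<Sum>i\<in>{1..n}. \<Sum>j\<in>{1..n}. \<Sum>k\<in>{1..n}. ?q i j p * ?q i k p)"
      by (simp only: sum_distrib_left)
    finally show ?thesis
      unfolding stein_var_def by linarith
  qed
  have lhs: "?E (\<lambda>p. S p * iexp (\<tau> * S p))
     = (\<Sum>i\<in>{1..n}. \<Sum>j\<in>{1..n}. 1 / 2 * ?E (\<lambda>p. ?q i j p *\<^sub>R (iexp (\<tau> * S p) - iexp (\<tau> * (S p - U i j p)))))"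
  proof -
    have "?E (\<lambda>p. S p * iexp (\<tau> * S p))
       = ?E (\<lambda>p. \<Sum>i\<in>{1..n}. \<Sum>j\<in>{1..n}. 1 / 2 * (?q i j p *\<^sub>R iexp (\<tau> * S p)))"
      by (subst (1) S_sum) (simp add: sum_distrib_left sum_distrib_right scaleR_conv_of_real mult.assoc)
    also have "\<dots> = (\<Sum>i\<in>{1..n}. \<Sum>j\<in>{1..n}. 1 / 2 * ?E (\<lambda>p. ?q i j p *\<^sub>R iexp (\<tau> * S p)))"
      by (simp only: Bochner_Integration.integral_sum integrable_perm_law integral_mult_right_zero)
    also have "\<dots> = (\<Sum>i\<in>{1..n}. \<Sum>j\<in>{1..n}. 1 / 2 * ?E (\<lambda>p. ?q i j p *\<^sub>R (iexp (\<tau> * S p) - iexp (\<tau> * (S p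
        - U i j p)))))"
    proof (intro sum.cong refl arg_cong[where f = "(*) (1 / 2)"] swap_odd_expectation_cong[OF Q])
      fix i j p
      have SU: "S q - U i j q = pair_sum_off Q n i j q / 2" for q
        by (simp add: S_def U_def field_simps)
      show "iexp (\<tau> * (S (p \<circ> Transposition.transpose i j) - U i j (p \<circ> Transposition.transpose i j)))
         = iexp (\<tau> * (S p - U i j p))"
        unfolding SU pair_sum_off_swap ..
    qed auto
    finally show ?thesis .
  qed
  have rhs: "\<i> * \<tau> * ?E (\<lambda>p. stein_var Q n p * iexp (\<tau> * S p))
     = (\<Sum>i\<in>{1..n}. \<Sum>j\<in>{1..n}. 1 / 2 * ?E (\<lambda>p. ?q i j p *\<^sub>R (\<i> * \<tau> * U i j p * iexp (\<tau> * S p))))"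
  proof -
    have "\<i> * \<tau> * ?E (\<lambda>p. stein_var Q n p * iexp (\<tau> * S p))
       = ?E (\<lambda>p. \<i> * \<tau> * (stein_var Q n p * iexp (\<tau> * S p)))" by simp
    also have "\<dots> = ?E (\<lambda>p. \<Sum>i\<in>{1..n}. \<Sum>j\<in>{1..n}. 1 / 2 * (?q i j p *\<^sub>R (\<i> * \<tau> * U i j p * iexp (\<tau> * S p))))"
      by (subst var) (simp add: sum_distrib_left sum_distrib_right scaleR_conv_of_real mult_ac)
    also have "\<dots> = (\<Sum>i\<in>{1..n}. \<Sum>j\<in>{1..n}. 1 / 2 * ?E (\<lambda>p. ?q i j p *\<^sub>R (\<i> * \<tau> * U i j p * iexp (\<tau> * S p))))"
      by (simp only: Bochner_Integration.integral_sum integrable_perm_law integral_mult_right_zero)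
    finally show ?thesis .
  qed
  have increment: "cmod (1 / 2 * ?E (\<lambda>p. ?q i j p *\<^sub>R (iexp (\<tau> * S p) - iexp (\<tau> * (S p - U i j p))))
        - 1 / 2 * ?E (\<lambda>p. ?q i j p *\<^sub>R (\<i> * \<tau> * U i j p * iexp (\<tau> * S p))))
      \<le> 1 / 2 * (C * (\<tau>\<^sup>2 * (2 * real n * C)\<^sup>2 / 2))" (is "cmod ?d \<le> _")
    if ij: "i \<in> {1..n}" "j \<in> {1..n}" for i j
  proof -
    have "?d = 1 / 2 * ?E (\<lambda>p. ?q i j p *\<^sub>R (iexp (\<tau> * S p) - iexp (\<tau> * (S p - U i j p))
         - \<i> * \<tau> * U i j p * iexp (\<tau> * S p)))" (is "_ = 1 / 2 * ?e")
      unfolding right_diff_distrib[symmetric] scaleR_diff_right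
        Bochner_Integration.integral_diff[OF integrable_perm_law integrable_perm_law] ..
    then have "cmod ?d = 1 / 2 * cmod ?e"
      by (simp only: norm_mult) simp
    moreover have "cmod ?e \<le> C * (\<tau>\<^sup>2 * (2 * real n * C)\<^sup>2 / 2)"
    proof (rule norm_expectation_le)
      fix p assume p: "p \<in> perms n"
      have "\<bar>U i j p\<bar> \<le> 2 * real n * C"
        using pair_sum_diff_off_le[where Q = Q and p = p, OF p ij C] by (simp add: U_def mult.assoc)
      then have "(U i j p)\<^sup>2 \<le> (2 * real n * C)\<^sup>2"
        using C0 by (intro abs_le_square_iff[THEN iffD1]) simp
      then have "cmod (iexp (\<tau> * S p) - iexp (\<tau> * (S p - U i j p)) - \<i> * \<tau> * U i j p * iexp (\<tau> * S p))
          \<le> \<tau>\<^sup>2 * (2 * real n * C)\<^sup>2 / 2"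
        by (intro order.trans[OF iexp_increment] divide_right_mono mult_left_mono) auto
      then show "cmod (?q i j p *\<^sub>R (iexp (\<tau> * S p) - iexp (\<tau> * (S p - U i j p)) - \<i> * \<tau> * U i j p * iexp (\<tau>
          * S p)))
          \<le> C * (\<tau>\<^sup>2 * (2 * real n * C)\<^sup>2 / 2)"
        unfolding norm_scaleR real_norm_def by (intro mult_mono C grid_pt_in_square[OF p] ij C0) auto
    qed
    ultimately show ?thesis by simp
  qed
  have "cmod (?E (\<lambda>p. S p * iexp (\<tau> * S p)) - \<i> * \<tau> * ?E (\<lambda>p. stein_var Q n p * iexp (\<tau> * S p)))
      \<le> (\<Sum>i\<in>{1..n}. \<Sum>j\<in>{1..n}. 1 / 2 * (C * (\<tau>\<^sup>2 * (2 * real n * C)\<^sup>2 / 2)))"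
    unfolding lhs rhs sum_subtractf[symmetric]
    by (intro order.trans[OF norm_sum] sum_mono increment)
  also have "\<dots> = \<tau>\<^sup>2 * C ^ 3 * real n ^ 4"
    by (simp add: power2_eq_square power3_eq_cube power4_eq_xxxx)
  finally show ?thesis .
qed

section \<open>Limit points of empirical measures\<close>

definition emp :: "nat \<Rightarrow> (nat \<Rightarrow> nat) \<Rightarrow> (real \<times> real) measure" where
  "emp n p = distr (uniform_count_measure {1..n}) borel (grid_pt n p)"

lemma integral_emp:
  fixes f :: "real \<times> real \<Rightarrow> real"
  assumes "f \<in> borel_measurable borel"
  shows "(LINT z|emp n p. f z) = (\<Sum>i\<in>{1..n}. f (grid_pt n p i)) / real n"
proof -
  have "(LINT z|emp n p. f z) = (LINT i|uniform_count_measure {1..n}. f (grid_pt n p i))"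
    unfolding emp_def using assms by (intro integral_distr) (auto simp: uniform_count_measure_def)
  also have "\<dots> = (\<Sum>i\<in>{1..n}. f (grid_pt n p i)) / real n"
    by (simp add: integral_uniform_count_measure)
  finally show ?thesis .
qed

lemma on_compact_emp:
  assumes p: "p \<in> perms n" and n: "1 \<le> n"
  shows "on_compact unit_square (emp n p)"
proof -
  have "prob_space (uniform_count_measure {1..n})"
    using n by (intro prob_space_uniform_count_measure) auto
  then have "prob_space (emp n p)"
    unfolding emp_def by (rule prob_space.prob_space_distr) (auto simp: uniform_count_measure_def)
  moreover have "AE z in emp n p. z \<in> unit_square"
  proof -
    have "AE i in uniform_count_measure {1..n}. grid_pt n p i \<in> unit_square"
    proof (rule AE_I2)
      fix i assume "i \<in> space (uniform_count_measure {1..n})"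
      then have i: "i \<in> {1..n}" by (simp add: space_uniform_count_measure)
      with perms_in_range[OF p i] show "grid_pt n p i \<in> unit_square"
        by (auto simp: grid_pt_def)
    qed
    then show ?thesis
      unfolding emp_def by (subst AE_distr_iff) (auto simp: uniform_count_measure_def)
  qed
  moreover have "sets (emp n p) = sets borel" by (simp add: emp_def)
  ultimately show ?thesis
    by (simp add: on_compact_def compact_Times)
qed

text \<open>
  By uniform continuity each cell of length \<open>1 / n\<close> contributes an error of at most \<open>e / (2 n)\<close>.
\<close>

lemma riemann_sum_tendsto:
  fixes f :: "real \<Rightarrow> real"
  assumes f: "continuous_on {0..1} f"
  shows "(\<lambda>n. (\<Sum>i\<in>{1..n}. f (real i / real n)) / real n) \<longlonglongrightarrow> integral {0..1} f"
proof (rule LIMSEQ_I)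
  fix e :: real assume e: "0 < e"
  have "uniformly_continuous_on {0..1} f" using f by (intro compact_uniformly_continuous) auto
  then obtain d where d: "0 < d" "\<And>x y. x \<in> {0..1} \<Longrightarrow> y \<in> {0..1} \<Longrightarrow> dist x y < d \<Longrightarrow> dist (f x) (f y) < e / 2"
    using e unfolding uniformly_continuous_on_def by (metis half_gt_zero)
  obtain N where N: "inverse (real (Suc N)) < d" using reals_Archimedean[OF d(1)] by blast
  have "norm ((\<Sum>i\<in>{1..n}. f (real i / real n)) / real n - integral {0..1} f) < e" if n: "n \<ge> Suc N" for n
  proof -
    have n0: "0 < real n" using n by simp
    have "inverse (real n) \<le> inverse (real (Suc N))" using n by (intro le_imp_inverse_le) auto
    then have step: "1 / real n < d" using N by (simp add: inverse_eq_divide)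
    have int: "f integrable_on {a..b}" if "0 \<le> a" "b \<le> 1" for a b
      using that by (intro integrable_continuous_real continuous_on_subset[OF f]) auto
    have main: "\<bar>(\<Sum>i\<in>{1..k}. f (real i / real n)) / real n - integral {0..real k / real n} f\<bar>
        \<le> real k * (e / 2 / real n)"
      if "k \<le> n" for k
      using that
    proof (induction k)
      case (Suc k)
      let ?a = "real k / real n" and ?b = "real (Suc k) / real n"
      have ab: "0 \<le> ?a" "?a \<le> ?b" "?b \<le> 1" using Suc.prems n0 by (auto simp: divide_right_mono)
      have len: "?b - ?a = 1 / real n" by (simp add: diff_divide_distrib[symmetric])
      have "integral {0..?b} f = integral {0..?a} f + integral {?a..?b} f"
        by (rule Henstock_Kurzweil_Integration.integral_combine[symmetric, OF ab(1,2) int]) (use ab in auto)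
      moreover have "\<bar>f ?b / real n - integral {?a..?b} f\<bar> \<le> e / 2 / real n"
      proof -
        have "norm (integral {?a..?b} (\<lambda>x. f ?b - f x)) \<le> e / 2 * (?b - ?a)"
        proof (rule integral_bound)
          show "continuous_on {?a..?b} (\<lambda>x. f ?b - f x)"
            using ab by (intro continuous_intros continuous_on_subset[OF f]) auto
          fix x assume x: "x \<in> {?a..?b}"
          then have "dist ?b x < d" using step len by (auto simp: dist_real_def)
          moreover have "x \<in> {0..1}" "?b \<in> {0..1}"
            using x ab unfolding atLeastAtMost_iff by linarith+
          ultimately have "dist (f ?b) (f x) < e / 2" by (intro d(2))
          then show "norm (f ?b - f x) \<le> e / 2" by (simp add: dist_real_def)
        qed (use ab in auto)
        also have "integral {?a..?b} (\<lambda>x. f ?b - f x) = f ?b / real n - integral {?a..?b} f"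
          using ab len by (subst Henstock_Kurzweil_Integration.integral_diff) (auto intro: int)
        finally show ?thesis by (simp only: len real_norm_def) simp
      qed
      moreover have "(\<Sum>i\<in>{1..Suc k}. f (real i / real n)) / real n
          = (\<Sum>i\<in>{1..k}. f (real i / real n)) / real n + f ?b / real n"
        by (simp add: add_divide_distrib)
      moreover have "real (Suc k) * (e / 2 / real n) = real k * (e / 2 / real n) + e / 2 / real n"
        unfolding of_nat_Suc distrib_right by simp
      moreover have "\<bar>(\<Sum>i\<in>{1..k}. f (real i / real n)) / real n - integral {0..?a} f\<bar>
          \<le> real k * (e / 2 / real n)"
        using Suc by simp
      ultimately show ?case by linarith
    qed simp
    from main[of n] n0 have "\<bar>(\<Sum>i\<in>{1..n}. f (real i / real n)) / real n - integral {0..1} f\<bar> \<le> e / 2" by simp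
    then show ?thesis using e by simp
  qed
  then show "\<exists>no. \<forall>n\<ge>no. norm ((\<Sum>i\<in>{1..n}. f (real i / real n)) / real n - integral {0..1} f) < e" by blast
qed

lemma emp_marginal:
  fixes f :: "real \<Rightarrow> real"
  assumes p: "p \<in> perms n" and f: "continuous_on UNIV f"
  shows "(LINT z|emp n p. f (fst z)) = (\<Sum>i\<in>{1..n}. f (real i / real n)) / real n"
    and "(LINT z|emp n p. f (snd z)) = (\<Sum>i\<in>{1..n}. f (real i / real n)) / real n"
proof -
  have c: "continuous_on UNIV (\<lambda>z :: real \<times> real. f (fst z))"
      "continuous_on UNIV (\<lambda>z :: real \<times> real. f (snd z))"
    by (rule continuous_on_fst_snd_UNIV[OF f])+
  show "(LINT z|emp n p. f (fst z)) = (\<Sum>i\<in>{1..n}. f (real i / real n)) / real n"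
    using c by (subst integral_emp) (auto intro: borel_measurable_continuous_onI simp: grid_pt_def)
  have "(\<Sum>i\<in>{1..n}. f (real (p i) / real n)) = (\<Sum>i\<in>{1..n}. f (real i / real n))"
    using p by (intro sum.permute[of p "{1..n}" "\<lambda>i. f (real i / real n)", unfolded comp_def, symmetric])
      (simp add: perms_def)
  then show "(LINT z|emp n p. f (snd z)) = (\<Sum>i\<in>{1..n}. f (real i / real n)) / real n"
    using c by (subst integral_emp) (auto intro: borel_measurable_continuous_onI simp: grid_pt_def)
qed

text \<open>
  Integrating the bounded function \<open>min 1 (dist x [0, 1])\<close>, which vanishes along the sequence, shows
  that the limit is concentrated on the interval. There a continuous function agrees with its
  composition with the retraction onto the interval, which is bounded.
\<close>

lemma weak_conv_m_on_unit_interval: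
  assumes Mn: "\<And>n. on_compact {0..1} (M_seq n)" and M: "real_distribution M" and conv: "weak_conv_m M_seq M"
  shows "on_compact {0..1} M" and "weak_lim M_seq M"
proof -
  interpret M: real_distribution M by fact
  have rn: "real_distribution (M_seq n)" for n
    using Mn[of n] by (auto simp: on_compact_def real_distribution_def real_distribution_axioms_def sets_eq_imp_space_eq)
  have lim: "(\<lambda>n. LINT x|M_seq n. f x) \<longlonglongrightarrow> (LINT x|M. f x)"
    if "continuous_on UNIV f" "\<And>x. \<bar>f x\<bar> \<le> B" for f :: "real \<Rightarrow> real" and B
    using that(1) that(2)
    by (intro weak_conv_imp_integral_bdd_continuous_conv[OF rn M conv, of f B])
       (auto simp: continuous_on_eq_continuous_at)
  let ?c = "\<lambda>x :: real. max 0 (min 1 x)"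
  have c: "continuous_on UNIV ?c" by (intro continuous_intros)
  let ?g = "\<lambda>x. min 1 \<bar>x - ?c x\<bar>"
  have g: "continuous_on UNIV ?g" by (intro continuous_intros)
  have "(LINT x|M_seq n. ?g x) = 0" for n
  proof -
    have "(LINT x|M_seq n. ?g x) = (LINT x|M_seq n. 0)"
      using Mn[of n] by (intro integral_cong_AE) (auto simp: on_compact_def elim!: AE_mp cong: measurable_cong_sets)
    then show ?thesis by simp
  qed
  with lim[OF g, of 1] have "(LINT x|M. ?g x) = 0"
    using LIMSEQ_unique[OF _ tendsto_const[of "0::real"]] by auto
  moreover have "integrable M ?g" by (rule M.integrable_const_bound[of _ 1]) auto
  ultimately have "AE x in M. ?g x = 0"
    using integral_nonneg_eq_0_iff_AE[of M ?g] by auto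
  then have "AE x in M. x \<in> {0..1}"
    by eventually_elim (auto simp: min_def max_def split: if_splits)
  then show Mc: "on_compact {0..1} M"
    by (simp add: on_compact_def M.prob_space_axioms)
  show "weak_lim M_seq M"
    unfolding weak_lim_def
  proof (intro allI impI)
    fix f :: "real \<Rightarrow> real" assume f: "continuous_on UNIV f"
    have fc: "continuous_on UNIV (\<lambda>x. f (?c x))" by (rule continuous_on_compose2[OF f c]) simp
    have "compact (f ` {0..1})"
      by (rule compact_continuous_image) (auto intro: continuous_on_subset[OF f])
    then obtain B where B: "\<And>x. x \<in> {0..1} \<Longrightarrow> \<bar>f x\<bar> \<le> B"
      using compact_imp_bounded[of "f ` {0..1}"] by (force simp: bounded_iff)
    have eq: "(LINT x|L. f (?c x)) = (LINT x|L. f x)" if "on_compact {0..1} L" for L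
      using on_compact_integral_diff_le[OF that fc f, of 0] by auto
    show "(\<lambda>n. LINT x|M_seq n. f x) \<longlonglongrightarrow> (LINT x|M. f x)"
      using lim[OF fc, of B] B by (simp add: eq[OF Mn] eq[OF Mc])
  qed
qed

lemma tight_on_unit_interval:
  assumes "\<And>n. on_compact {0..1} (M_seq n)"
  shows "tight M_seq"
  unfolding tight_def
proof (intro conjI allI impI)
  show "real_distribution (M_seq n)" for n
    using assms[of n] by (auto simp: on_compact_def real_distribution_def real_distribution_axioms_def sets_eq_imp_space_eq)
  fix e :: real assume e: "0 < e"
  have "measure (M_seq n) {-1<..1} = 1" for n
  proof -
    interpret prob_space "M_seq n" using assms[of n] by (simp add: on_compact_def)
    have "AE x in M_seq n. x \<in> {-1<..1}"
      using assms[of n] by (auto simp: on_compact_def elim!: AE_mp)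
    then show ?thesis using assms[of n] by (subst prob_eq_1) (auto simp: on_compact_def)
  qed
  with e show "\<exists>a b. a < b \<and> (\<forall>n. 1 - e < measure (M_seq n) {a<..b})"
    by (intro exI[of _ "-1"] exI[of _ 1]) auto
qed

lemma weak_lim_subseq: "weak_lim M_seq M \<Longrightarrow> strict_mono r \<Longrightarrow> weak_lim (\<lambda>k. M_seq (r k)) M"
  unfolding weak_lim_def
proof (intro allI impI)
  fix f :: "'a \<Rightarrow> real"
  assume "\<forall>f. continuous_on UNIV f \<longrightarrow> (\<lambda>n. LINT x|M_seq n. f x) \<longlonglongrightarrow> (LINT x|M. f x :: real)"
    "strict_mono r" "continuous_on UNIV f"
  then show "(\<lambda>k. LINT x|M_seq (r k). f x) \<longlonglongrightarrow> (LINT x|M. f x)"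
    using LIMSEQ_subseq_LIMSEQ[of "\<lambda>n. LINT x|M_seq n. f x" _ r] by (auto simp: comp_def)
qed

text \<open>
  The kernel whose pair sum measures how far the empirical measure weighted by \<open>exp (- \<theta> F)\<close> is
  from a product measure, tested against \<open>x\<^sup>a y\<^sup>b\<close>.
\<close>

definition defect_kernel :: "(real \<times> real \<Rightarrow> real) \<Rightarrow> real \<Rightarrow> nat \<Rightarrow> nat \<Rightarrow> real \<times> real \<Rightarrow> real \<times> real \<Rightarrow> real" where
  "defect_kernel F \<theta> a b z w = exp (- \<theta> * F z) * exp (- \<theta> * F w) * fst z ^ a * (snd w ^ b - snd z ^ b)"

text \<open>
  The two exponentials cancel the contributions of both points to the weight of the permutation,
  and the last factor changes sign when \<open>y\<^sub>1\<close> and \<open>y\<^sub>2\<close> are exchanged.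
\<close>

lemma swap_odd_defect_kernel: "swap_odd F \<theta> (defect_kernel F \<theta> a b)"
  unfolding swap_odd_def
proof (intro allI)
  fix x1 y1 x2 y2
  have e: "exp (- \<theta> * F (x1, y2)) * exp (- \<theta> * F (x2, y1)) * exp (- \<theta> * G_diff F (x1, y1) (x2, y2))
      = exp (- \<theta> * F (x1, y1)) * exp (- \<theta> * F (x2, y2))"
    by (simp add: G_diff_def algebra_simps flip: exp_add)
  have "defect_kernel F \<theta> a b (x1, y2) (x2, y1) * exp (- \<theta> * G_diff F (x1, y1) (x2, y2))
     = (exp (- \<theta> * F (x1, y2)) * exp (- \<theta> * F (x2, y1)) * exp (- \<theta> * G_diff F (x1, y1) (x2, y2)))
        * (x1 ^ a * (y1 ^ b - y2 ^ b))"
    by (simp add: defect_kernel_def)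
  also have "\<dots> = - defect_kernel F \<theta> a b (x1, y1) (x2, y2)"
    unfolding e by (simp add: defect_kernel_def algebra_simps)
  finally show "defect_kernel F \<theta> a b (x1, y2) (x2, y1) * exp (- \<theta> * G_diff F (x1, y1) (x2, y2))
      = - defect_kernel F \<theta> a b (x1, y1) (x2, y2)" .
qed

lemma defect_kernel_bound:
  assumes F: "\<And>z. \<bar>F z\<bar> \<le> B" and z: "z \<in> unit_square" "w \<in> unit_square"
  shows "\<bar>defect_kernel F \<theta> a b z w\<bar> \<le> exp (2 * \<bar>\<theta>\<bar> * B)"
proof -
  have e: "exp (- \<theta> * F z) \<le> exp (\<bar>\<theta>\<bar> * B)" for z
  proof -
    have "- \<theta> * F z \<le> \<bar>\<theta>\<bar> * \<bar>F z\<bar>" by (metis abs_ge_self abs_minus_cancel abs_mult)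
    also have "\<dots> \<le> \<bar>\<theta>\<bar> * B" by (intro mult_left_mono F) auto
    finally show ?thesis by simp
  qed
  have pw: "0 \<le> x ^ k" "x ^ k \<le> 1" if "x \<in> {0..1}" for x :: real and k
    using that by (auto intro: power_le_one)
  have zw: "fst z \<in> {0..1}" "snd z \<in> {0..1}" "snd w \<in> {0..1}" using z by (auto simp: mem_Times_iff)
  have "\<bar>defect_kernel F \<theta> a b z w\<bar>
      = exp (- \<theta> * F z) * exp (- \<theta> * F w) * (\<bar>fst z ^ a\<bar> * \<bar>snd w ^ b - snd z ^ b\<bar>)"
    by (simp only: defect_kernel_def abs_mult abs_exp_cancel mult.assoc)
  also have "\<dots> \<le> exp (\<bar>\<theta>\<bar> * B) * exp (\<bar>\<theta>\<bar> * B) * (1 * 1)"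
    using pw[OF zw(1), of a] pw[OF zw(2), of b] pw[OF zw(3), of b]
    by (intro mult_mono e) (auto simp: abs_le_iff)
  also have "\<dots> = exp (2 * \<bar>\<theta>\<bar> * B)" by (simp add: algebra_simps flip: exp_add)
  finally show ?thesis .
qed

lemma pair_sum_defect_kernel:
  fixes \<theta> :: real
  assumes F: "continuous_on UNIV F"
  defines "w \<equiv> \<lambda>z. exp (- \<theta> * F z)"
  shows "pair_sum (defect_kernel F \<theta> a b) n p / (real n)\<^sup>2
    = (LINT z|emp n p. w z * fst z ^ a) * (LINT z|emp n p. w z * snd z ^ b)
      - (LINT z|emp n p. w z * (fst z ^ a * snd z ^ b)) * (LINT z|emp n p. w z)"
proof -
  have m: "f \<in> borel_measurable borel" if "continuous_on UNIV f" for f :: "real \<times> real \<Rightarrow> real"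
    using that by (rule borel_measurable_continuous_onI)
  let ?z = "grid_pt n p"
  have "pair_sum (defect_kernel F \<theta> a b) n p
    = (\<Sum>i\<in>{1..n}. w (?z i) * fst (?z i) ^ a) * (\<Sum>i\<in>{1..n}. w (?z i) * snd (?z i) ^ b)
      - (\<Sum>i\<in>{1..n}. w (?z i) * (fst (?z i) ^ a * snd (?z i) ^ b)) * (\<Sum>i\<in>{1..n}. w (?z i))"
    unfolding pair_sum_def sum_product sum_subtractf[symmetric]
    by (intro sum.cong refl) (simp add: defect_kernel_def w_def algebra_simps)
  moreover have "(LINT z|emp n p. w z * fst z ^ a) = (\<Sum>i\<in>{1..n}. w (?z i) * fst (?z i) ^ a) / real n"
    "(LINT z|emp n p. w z * snd z ^ b) = (\<Sum>i\<in>{1..n}. w (?z i) * snd (?z i) ^ b) / real n"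
    "(LINT z|emp n p. w z * (fst z ^ a * snd z ^ b))
        = (\<Sum>i\<in>{1..n}. w (?z i) * (fst (?z i) ^ a * snd (?z i) ^ b)) / real n"
    "(LINT z|emp n p. w z) = (\<Sum>i\<in>{1..n}. w (?z i)) / real n"
    unfolding w_def by (intro integral_emp m continuous_intros F)+
  ultimately show ?thesis
    by (simp add: power2_eq_square diff_divide_distrib)
qed

lemma on_compact_density:
  fixes f :: "'a::metric_space \<Rightarrow> real"
  assumes M: "on_compact K M" and f: "continuous_on UNIV f" "\<And>x. 0 \<le> f x" and one: "(LINT x|M. f x) = 1"
  shows "on_compact K (density M f)"
    and "continuous_on UNIV g \<Longrightarrow> (LINT x|density M f. g x) = (LINT x|M. f x * g x :: real)"
proof -
  have sets [measurable_cong]: "sets M = sets borel" using M by (simp add: on_compact_def)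
  have [measurable]: "f \<in> borel_measurable borel" using f(1) by (rule borel_measurable_continuous_onI)
  have "emeasure (density M f) (space (density M f)) = (\<integral>\<^sup>+ x. f x \<partial>M)"
    by (auto simp: emeasure_density intro!: nn_integral_cong)
  also have "\<dots> = ennreal (LINT x|M. f x)"
    using on_compact_integrable[OF M f(1)] f(2) by (intro nn_integral_eq_integral) auto
  finally have "prob_space (density M f)" by (intro prob_spaceI) (simp add: one)
  moreover have "AE x in density M f. x \<in> K"
    using M by (subst AE_density) (auto simp: on_compact_def elim!: AE_mp)
  ultimately show "on_compact K (density M f)"
    using M by (simp add: on_compact_def)
  assume g: "continuous_on UNIV g"
  then have [measurable]: "g \<in> borel_measurable borel" by (rule borel_measurable_continuous_onI)
  show "(LINT x|density M f. g x) = (LINT x|M. f x * g x)"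
    using f(2) by (subst integral_real_density) auto
qed

lemma on_compact_distr:
  fixes T :: "'a::metric_space \<Rightarrow> 'b::metric_space"
  assumes M: "on_compact K M" and T: "continuous_on UNIV T" and KL: "T ` K \<subseteq> L" and L: "compact L"
  shows "on_compact L (distr M borel T)"
    and "continuous_on UNIV g \<Longrightarrow> (LINT x|distr M borel T. g x) = (LINT x|M. g (T x) :: real)"
proof -
  have sets [measurable_cong]: "sets M = sets borel" using M by (simp add: on_compact_def)
  interpret prob_space M using M by (simp add: on_compact_def)
  have [measurable]: "T \<in> borel_measurable borel" using T by (rule borel_measurable_continuous_onI)
  have [measurable]: "L \<in> sets borel" using L by (simp add: borel_closed compact_imp_closed)
  have "AE x in distr M borel T. x \<in> L"
    using M KL by (subst AE_distr_iff) (auto simp: on_compact_def elim!: AE_mp)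
  moreover have "prob_space (distr M borel T)" by (rule prob_space_distr) simp
  ultimately show "on_compact L (distr M borel T)"
    using L by (simp add: on_compact_def)
  assume g: "continuous_on UNIV g"
  then have [measurable]: "g \<in> borel_measurable borel" by (rule borel_measurable_continuous_onI)
  show "(LINT x|distr M borel T. g x) = (LINT x|M. g (T x))"
    by (rule integral_distr) auto
qed

text \<open>
  Integrating out the second coordinate shows that the uniform distribution has the density
  \<open>r(x) = \<integral> c exp (\<theta> F(x, y)) dY(y)\<close> with respect to \<open>X\<close>. As \<open>F\<close> is bounded, \<open>r\<close> is bounded away from \<open>0\<close>
  and infinity, and so \<open>X\<close> has the density \<open>1 / r\<close> with respect to the uniform distribution. The
  marginal constraint thus supplies the absolute continuity of \<open>X\<close>, and likewise of \<open>Y\<close>.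
\<close>

lemma gibbs_form_of_tilted_product:
  fixes X Y :: "real measure"
  assumes F: "continuous_on UNIV F" and B: "\<And>z. \<bar>F z\<bar> \<le> B" and c: "0 < c"
    and X: "on_compact {0..1} X" and Y: "on_compact {0..1} Y"
    and one: "(LINT z|(X \<Otimes>\<^sub>M Y). c * exp (\<theta> * F z)) = 1"
    and margX: "\<And>f. continuous_on UNIV f \<Longrightarrow> (LINT z|(X \<Otimes>\<^sub>M Y). c * exp (\<theta> * F z) * f (fst z))
        = (LINT x|unif. f x)"
    and margY: "\<And>f. continuous_on UNIV f \<Longrightarrow> (LINT z|(X \<Otimes>\<^sub>M Y). c * exp (\<theta> * F z) * f (snd z))
        = (LINT x|unif. f x)"
  shows "gibbs_form F \<theta> (density (X \<Otimes>\<^sub>M Y) (\<lambda>z. c * exp (\<theta> * F z)))"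
proof -
  define g where "g z = c * exp (\<theta> * F z)" for z
  have gc: "continuous_on UNIV g" unfolding g_def by (intro continuous_intros F)
  define l u where "l = c * exp (- \<bar>\<theta>\<bar> * B)" and "u = c * exp (\<bar>\<theta>\<bar> * B)"
  have \<theta>F: "\<bar>\<theta> * F z\<bar> \<le> \<bar>\<theta>\<bar> * B" for z by (simp add: abs_mult mult_left_mono B)
  have gl: "l \<le> g z" and gu: "g z \<le> u" for z
    using \<theta>F[of z] c by (auto simp: l_def u_def g_def abs_le_iff)
  have l0: "0 < l" using c by (simp add: l_def)
  have g0: "0 \<le> g z" for z using gl[of z] l0 by linarith
  interpret X: prob_space X using X by (simp add: on_compact_def)
  interpret Y: prob_space Y using Y by (simp add: on_compact_def)
  interpret XY: pair_prob_space X Y ..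
  have XYc: "on_compact unit_square (X \<Otimes>\<^sub>M Y)" by (rule on_compact_pair[OF X Y])
  have setsX [measurable_cong]: "sets X = sets borel" and setsY [measurable_cong]: "sets Y = sets borel"
    using X Y by (auto simp: on_compact_def)
  have gm [measurable]: "g \<in> borel_measurable (borel \<Otimes>\<^sub>M borel)"
    unfolding borel_prod using gc by (rule borel_measurable_continuous_onI)
  \<comment> \<open>The densities of the uniform distribution with respect to \<open>X\<close> and \<open>Y\<close>\<close>
  define r s where "r x = (LINT y|Y. g (x, y))" and "s y = (LINT x|X. g (x, y))" for x y
  have rm [measurable]: "r \<in> borel_measurable borel" and sm [measurable]: "s \<in> borel_measurable borel"
    unfolding r_def s_def by measurable
  have g1: "continuous_on UNIV (\<lambda>y. g (x, y))" "continuous_on UNIV (\<lambda>x. g (x, y))" for x y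
    by (intro continuous_on_Pair_compose[OF gc] continuous_intros)+
  have rb: "l \<le> r x" "r x \<le> u" for x
  proof -
    have "(LINT y|Y. l) \<le> r x" "r x \<le> (LINT y|Y. u)"
      unfolding r_def by (intro integral_mono on_compact_integrable[OF Y g1(1)] gl gu; simp)+
    then show "l \<le> r x" "r x \<le> u" by (simp_all add: Y.prob_space)
  qed
  have sb: "l \<le> s y" "s y \<le> u" for y
  proof -
    have "(LINT x|X. l) \<le> s y" "s y \<le> (LINT x|X. u)"
      unfolding s_def by (intro integral_mono on_compact_integrable[OF X g1(2)] gl gu; simp)+
    then show "l \<le> s y" "s y \<le> u" by (simp_all add: X.prob_space)
  qed
  have r0: "0 < r x" and s0: "0 < s x" for x using rb[of x] sb[of x] l0 by linarith+
  have X_r: "(LINT x|X. r x * f x) = (LINT x|unif. f x)" if f: "continuous_on UNIV f" for f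
  proof -
    have "(LINT x|X. r x * f x) = (LINT x|X. LINT y|Y. g (x, y) * f x)"
      unfolding r_def by simp
    also have "\<dots> = (LINT z|(X \<Otimes>\<^sub>M Y). g z * f (fst z))"
      using XY.integral_fst'[OF on_compact_integrable[OF XYc continuous_on_mult[OF gc continuous_on_fst_snd_UNIV(1)[OF f]]]] by simp
    finally show ?thesis using margX[OF f] by (simp add: g_def)
  qed
  have Y_s: "(LINT y|Y. s y * f y) = (LINT x|unif. f x)" if f: "continuous_on UNIV f" for f
  proof -
    have "(LINT y|Y. s y * f y) = (LINT y|Y. LINT x|X. g (x, y) * f y)"
      unfolding s_def by simp
    also have "\<dots> = (LINT z|(X \<Otimes>\<^sub>M Y). g z * f (snd z))"
    proof -
      have "(\<lambda>(x, y). g (x, y) * f y) = (\<lambda>z. g z * f (snd z))" by auto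
      from XY.integral_snd[of "\<lambda>x y. g (x, y) * f y", unfolded this,
          OF on_compact_integrable[OF XYc continuous_on_mult[OF gc continuous_on_fst_snd_UNIV(2)[OF f]]]]
      show ?thesis .
    qed
    finally show ?thesis using margY[OF f] by (simp add: g_def)
  qed
  have unif_eq: "density P q = unif"
    if P: "on_compact {0..1} P" and q [measurable]: "q \<in> borel_measurable borel" "\<And>x. 0 \<le> q x" "\<And>x. q x \<le> u"
      and eq: "\<And>f. continuous_on UNIV f \<Longrightarrow> (LINT x|P. q x * f x) = (LINT x|unif. f x)" for P
          and q :: "real \<Rightarrow> real"
  proof (rule real_measure_eqI_continuous)
    interpret P: prob_space P using P by (simp add: on_compact_def)
    interpret unif: prob_space unif by (rule prob_space_unif)
    have [measurable_cong]: "sets P = sets borel" using P by (simp add: on_compact_def)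
    have "emeasure (density P q) (space (density P q)) = (\<integral>\<^sup>+ x. q x \<partial>P)"
      by (auto simp: emeasure_density intro!: nn_integral_cong)
    also have "\<dots> = ennreal (LINT x|P. q x)"
      using q by (intro nn_integral_eq_integral P.integrable_const_bound[of _ u]) auto
    also have "(LINT x|P. q x) = 1" using eq[of "\<lambda>_. 1"] unif.prob_space by simp
    finally show "prob_space (density P q)" by (intro prob_spaceI) simp
    show "sets (density P q) = sets borel" using P by (simp add: on_compact_def)
    fix f :: "real \<Rightarrow> real" assume f: "continuous_on UNIV f"
    have [measurable]: "f \<in> borel_measurable borel" using f by (rule borel_measurable_continuous_onI)
    show "(LINT x|density P q. f x) = (LINT x|unif. f x)"
      unfolding eq[OF f, symmetric] using q by (subst integral_real_density) auto
  qed (auto simp: prob_space_unif)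
  have inv: "P = density unif (\<lambda>x. ennreal (1 / q x))"
    if "density P q = unif" and [measurable_cong]: "sets P
        = sets borel" and [measurable]: "q \<in> borel_measurable borel" and q0: "\<And>x. 0 < q x" for P
            and q :: "real \<Rightarrow> real"
  proof -
    have "density unif (\<lambda>x. ennreal (1 / q x)) = density P (\<lambda>x. ennreal (q x) * ennreal (1 / q x))"
      unfolding that(1)[symmetric] by (rule density_density_eq) auto
    also have "\<dots> = density P (\<lambda>_. 1)"
      using q0 by (intro arg_cong[where f =
          "density P"] ext) (simp add: less_imp_le less_imp_neq[symmetric] flip: ennreal_mult)
    finally show ?thesis by (simp add: density_1)
  qed
  have X_eq: "X = density unif (\<lambda>x. ennreal (1 / r x))"
    by (rule inv[OF unif_eq[OF X rm less_imp_le[OF r0] rb(2) X_r] setsX rm r0])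
  have Y_eq: "Y = density unif (\<lambda>x. ennreal (1 / s x))"
    by (rule inv[OF unif_eq[OF Y sm less_imp_le[OF s0] sb(2) Y_s] setsY sm s0])
  have prod_eq: "X \<Otimes>\<^sub>M Y = density (unif \<Otimes>\<^sub>M unif) (\<lambda>(x, y). ennreal (1 / r x) * ennreal (1 / s y))"
  proof -
    have "sigma_finite_measure (density unif (\<lambda>x. ennreal (1 / s x)))"
      unfolding Y_eq[symmetric] by unfold_locales
    then have "density unif (\<lambda>x. ennreal (1 / r x)) \<Otimes>\<^sub>M density unif (\<lambda>x. ennreal (1 / s x))
      = density (unif \<Otimes>\<^sub>M unif) (\<lambda>(x, y). ennreal (1 / r x) * ennreal (1 / s y))"
      using prob_space_imp_sigma_finite[OF prob_space_unif] by (intro pair_measure_density) auto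
    then show ?thesis by (simp only: X_eq[symmetric] Y_eq[symmetric])
  qed
  have dens: "density (X \<Otimes>\<^sub>M Y) (\<lambda>z. ennreal (g z))
      = density (unif \<Otimes>\<^sub>M unif) (\<lambda>z. ennreal ((c / r (fst z)) * (1 / s (snd z)) * exp (\<theta> * F z)))"
  proof -
    have "density (X \<Otimes>\<^sub>M Y) (\<lambda>z. ennreal (g z))
      = density (unif \<Otimes>\<^sub>M unif) (\<lambda>z. (case z of (x, y) \<Rightarrow> ennreal (1 / r x) * ennreal (1 / s y))
          * ennreal (g z))"
      unfolding prod_eq by (rule density_density_eq) auto
    also have "\<dots> = density (unif \<Otimes>\<^sub>M unif) (\<lambda>z. ennreal ((c / r (fst z)) * (1 / s (snd z)) * exp (\<theta> * F z)))"
      using r0 s0 c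
      by (intro arg_cong[where f = "density (unif \<Otimes>\<^sub>M unif)"] ext)
         (auto simp: g_def less_imp_le field_simps simp flip: ennreal_mult)
    finally show ?thesis .
  qed
  note D = on_compact_density[OF XYc gc g0 one[folded g_def]]
  have marg: "distr (density (X \<Otimes>\<^sub>M Y) g) borel T = unif"
    if T: "continuous_on UNIV T" "T ` unit_square \<subseteq> {0..1}"
      and eq: "\<And>f. continuous_on UNIV f \<Longrightarrow> (LINT z|(X \<Otimes>\<^sub>M Y). c * exp (\<theta> * F z) * f (T z))
          = (LINT x|unif. f x)" for T
  proof (rule real_measure_eqI_continuous)
    note T' = on_compact_distr[OF D(1) T(1,2) compact_Icc]
    show "prob_space (distr (density (X \<Otimes>\<^sub>M Y) g) borel T)" using T'(1) by (simp add: on_compact_def)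
    fix f :: "real \<Rightarrow> real" assume f: "continuous_on UNIV f"
    have "continuous_on UNIV (\<lambda>z. f (T z))" by (rule continuous_on_compose2[OF f T(1)]) simp
    then show "(LINT x|distr (density (X \<Otimes>\<^sub>M Y) g) borel T. f x) = (LINT x|unif. f x)"
      by (simp add: T'(2)[OF f] D(2) eq[OF f, folded g_def])
  qed (auto simp: prob_space_unif)
  have perm: "density (X \<Otimes>\<^sub>M Y) g \<in> permutons"
    using D(1) marg[of fst] marg[of snd] margX margY
    by (simp add: permutons_def on_compact_def continuous_on_fst continuous_on_snd)
  have l': "0 < min (c / u) (1 / u)" and u0: "0 < u" using c by (auto simp: u_def)
  have "min (c / u) (1 / u) \<le> c / r x \<and> c / r x \<le> max (c / l) (1 / l)"
    "min (c / u) (1 / u) \<le> 1 / s x \<and> 1 / s x \<le> max (c / l) (1 / l)" for x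
    using rb[of x] sb[of x] r0[of x] s0[of x] l0 c u0
    by (auto simp: min_le_iff_disj le_max_iff_disj frac_le)
  with l' perm show ?thesis
    unfolding gibbs_form_def dens[unfolded g_def] g_def[symmetric]
    by (intro conjI exI[of _ "\<lambda>x. c / r x"] exI[of _ "\<lambda>x. 1 / s x"] exI[of _ "min (c / u) (1 / u)"]
         exI[of _ "max (c / l) (1 / l)"]) (auto simp: dens)
qed

text \<open>
  The empirical measures \<open>M k\<close> are tilted by \<open>exp (- \<theta> F)\<close> into \<open>Q k\<close>. The marginals of \<open>Q k\<close> live on
  the real line and converge along a subsequence by Helly's theorem; vanishing defects make the
  integral of \<open>x\<^sup>a y\<^sup>b\<close> under \<open>Q k\<close> asymptotically the product of the marginal integrals, so \<open>Q k\<close>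
  converges to the product of the limits.
\<close>

lemma gibbs_limit_exists:
  fixes m :: "nat \<Rightarrow> nat" and ps :: "nat \<Rightarrow> nat \<Rightarrow> nat"
  assumes F: "continuous_on UNIV F" and B: "\<And>z. \<bar>F z\<bar> \<le> B"
    and m: "filterlim m at_top sequentially" and m1: "\<And>k. 1 \<le> m k" and ps: "\<And>k. ps k \<in> perms (m k)"
    and defect: "\<And>a b. (\<lambda>k. pair_sum (defect_kernel F \<theta> a b) (m k) (ps k) / (real (m k))\<^sup>2) \<longlonglongrightarrow> 0"
  obtains r \<mu> where "strict_mono (r :: nat \<Rightarrow> nat)" "gibbs_form F \<theta> \<mu>"
    "weak_lim (\<lambda>k. emp (m (r k)) (ps (r k))) \<mu>"
proof -
  define M where "M k = emp (m k) (ps k)" for k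
  define w where "w z = exp (- \<theta> * F z)" for z
  define c where "c k = (LINT z|M k. w z)" for k
  have Mc: "on_compact unit_square (M k)" for k
    unfolding M_def by (rule on_compact_emp[OF ps m1])
  have wc: "continuous_on UNIV w" unfolding w_def by (intro continuous_intros F)
  define l u where "l = exp (- \<bar>\<theta>\<bar> * B)" and "u = exp (\<bar>\<theta>\<bar> * B)"
  have \<theta>F: "\<bar>\<theta> * F z\<bar> \<le> \<bar>\<theta>\<bar> * B" for z by (simp add: abs_mult mult_left_mono B)
  have wl: "l \<le> w z" and wu: "w z \<le> u" for z
    using \<theta>F[of z] by (auto simp: l_def u_def w_def abs_le_iff)
  have l0: "0 < l" by (simp add: l_def)
  have w0: "0 < w z" for z by (simp add: w_def)
  have c_bounds: "c k \<in> {l..u}" for k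
  proof -
    interpret prob_space "M k" using Mc[of k] by (simp add: on_compact_def)
    have "(LINT z|M k. l) \<le> c k" "c k \<le> (LINT z|M k. u)"
      unfolding c_def by (intro integral_mono on_compact_integrable[OF Mc wc] wl wu; simp)+
    then show ?thesis by (simp add: prob_space)
  qed
  have c0: "0 < c k" for k using c_bounds[of k] l0 by auto
  define Q where "Q k = density (M k) (\<lambda>z. w z / c k)" for k
  have wcc: "continuous_on UNIV (\<lambda>z. w z / c k)" "\<And>z. 0 \<le> w z / c k" "(LINT z|M k. w z / c k) = 1" for k
    using wc c0[of k] w0 by (auto simp: c_def less_imp_le intro!: continuous_intros)
  have Qc: "on_compact unit_square (Q k)" for k
    unfolding Q_def by (rule on_compact_density(1)[OF Mc wcc])
  have Q_int: "(LINT z|Q k. f z) = (LINT z|M k. w z * f z) / c k" if "continuous_on UNIV f" for f k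
    using on_compact_density(2)[OF Mc wcc that] by (simp add: Q_def)
  define X where "X k = distr (Q k) borel fst" for k
  define Y where "Y k = distr (Q k) borel snd" for k
  have cfst: "continuous_on UNIV (fst :: real \<times> real \<Rightarrow> real)" "fst ` unit_square \<subseteq> {0..1 :: real}"
    and csnd: "continuous_on UNIV (snd :: real \<times> real \<Rightarrow> real)" "snd ` unit_square \<subseteq> {0..1 :: real}"
    by (auto intro: continuous_on_fst continuous_on_snd)
  have Xc: "on_compact {0..1} (X k)" and Yc: "on_compact {0..1} (Y k)" for k
    unfolding X_def Y_def
    by (rule on_compact_distr(1)[OF Qc cfst compact_Icc] on_compact_distr(1)[OF Qc csnd compact_Icc])+
  have X_int: "(LINT x|X k. f x) = (LINT z|Q k. f (fst z))"
    and Y_int: "(LINT x|Y k. f x) = (LINT z|Q k. f (snd z))"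
        if "continuous_on UNIV f" for f :: "real \<Rightarrow> real" and k
    unfolding X_def Y_def
    using on_compact_distr(2)[OF Qc cfst compact_Icc that] on_compact_distr(2)[OF Qc csnd compact_Icc that]
        by auto
  \<comment> \<open>Successive subsequences make the normalising constants and then each marginal converge.\<close>
  have "seq_compact {l..u}" by (rule compact_imp_seq_compact) simp
  then have "(\<forall>n. c n \<in> {l..u}) \<longrightarrow> (\<exists>c'\<in>{l..u}. \<exists>r0. strict_mono r0 \<and> (c \<circ> r0) \<longlonglongrightarrow> c')"
    unfolding seq_compact_def by (rule spec)
  with c_bounds have "\<exists>c'\<in>{l..u}. \<exists>r0. strict_mono r0 \<and> (c \<circ> r0) \<longlonglongrightarrow> c'" by simp
  then obtain c' r0 where c': "c' \<in> {l..u}" and r0: "strict_mono r0" and c'_lim: "(c \<circ> r0) \<longlonglongrightarrow> c'"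
    by (elim bexE exE conjE) (rule that)
  obtain r1 X' where r1: "strict_mono r1" and X': "real_distribution X'" "weak_conv_m (X \<circ> r0 \<circ> r1) X'"
    using tight_imp_convergent_subsubsequence[OF tight_on_unit_interval[of X, OF Xc] r0] by blast
  have r01: "strict_mono (r0 \<circ> r1)" using r0 r1 by (rule strict_mono_o)
  obtain r2 Y' where r2: "strict_mono r2" and Y': "real_distribution Y'" "weak_conv_m (Y \<circ> (r0 \<circ> r1) \<circ> r2) Y'"
    using tight_imp_convergent_subsubsequence[OF tight_on_unit_interval[of Y, OF Yc] r01] by blast
  define r where "r = (r0 \<circ> r1) \<circ> r2"
  have r: "strict_mono r" unfolding r_def by (rule strict_mono_o[OF r01 r2])
  have X'c: "on_compact {0..1} X'" and X'_lim0: "weak_lim (X \<circ> r0 \<circ> r1) X'"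
    using weak_conv_m_on_unit_interval[OF _ X'] Xc by (auto simp: comp_def)
  have X'_lim: "weak_lim (\<lambda>k. X (r k)) X'"
    using weak_lim_subseq[OF X'_lim0 r2] by (simp add: r_def comp_def)
  have Y'c: "on_compact {0..1} Y'" and Y'_lim: "weak_lim (\<lambda>k. Y (r k)) Y'"
    using weak_conv_m_on_unit_interval[OF _ Y'] Yc by (auto simp: comp_def r_def)
  have c_lim: "(\<lambda>k. c (r k)) \<longlonglongrightarrow> c'"
    using LIMSEQ_subseq_LIMSEQ[OF c'_lim strict_mono_o[OF r1 r2]] by (simp add: r_def comp_def)
  have c'0: "0 < c'" using c' l0 by auto
  \<comment> \<open>The vanishing defects turn the limits of the marginals into a limit of the joint laws.\<close>
  let ?P = "X' \<Otimes>\<^sub>M Y'"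
  have Pc: "on_compact unit_square ?P" by (rule on_compact_pair[OF X'c Y'c])
  let ?G = "range (\<lambda>a (x :: real). x ^ a)"
  have Q_lim: "weak_lim (\<lambda>k. Q (r k)) ?P"
  proof (rule weak_limI_tensor_span[where K = "{0..1}" and L = "{0..1}" and G = ?G and H = ?G])
    show "\<exists>g\<in>tensor_span ?G ?G. \<forall>z\<in>unit_square. \<bar>f z - g z\<bar> < e" if "continuous_on UNIV f" "0 < e" for f e
    proof (rule tensor_span_dense[OF compact_Icc compact_Icc _ that(2)])
      show "continuous_on unit_square f" using that(1) by (rule continuous_on_subset) auto
      show one: "(\<lambda>x. 1) \<in> ?G" by (rule image_eqI[of _ _ 0]) auto
      show "(\<lambda>x. 1) \<in> ?G" by fact
      show mult: "(\<lambda>x. g x * g' x) \<in> ?G" if "g \<in> ?G" "g' \<in> ?G" for g g'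
      proof -
        from that obtain a b where "g = (\<lambda>x. x ^ a)" "g' = (\<lambda>x. x ^ b)" by auto
        then show ?thesis by (intro image_eqI[of _ _ "a + b"]) (auto simp: power_add)
      qed
      show "(\<lambda>x. g x * g' x) \<in> ?G" if "g \<in> ?G" "g' \<in> ?G" for g g' by (rule mult[OF that])
      show sep: "\<exists>g\<in>?G. g x \<noteq> g x'" if "x \<noteq> x'" for x x' :: real
        using that by (intro bexI[OF _ rangeI[of _ 1]]) simp
      show "\<exists>g\<in>?G. g x \<noteq> g x'" if "x \<noteq> x'" for x x' :: real by (rule sep[OF that])
    qed (auto intro!: continuous_intros)
    fix g h :: "real \<Rightarrow> real" assume "g \<in> ?G" "h \<in> ?G"
    then obtain a b where gh: "g = (\<lambda>x. x ^ a)" "h = (\<lambda>x. x ^ b)" by auto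
    have pc: "continuous_on UNIV (\<lambda>x :: real. x ^ k)" for k by (intro continuous_intros)
    have "(LINT z|Q k. fst z ^ a * snd z ^ b)
       = (LINT x|X k. x ^ a) * (LINT y|Y k. y ^ b)
         - pair_sum (defect_kernel F \<theta> a b) (m k) (ps k) / (real (m k))\<^sup>2 / (c k)\<^sup>2" for k
    proof -
      let ?A = "LINT z|M k. w z * fst z ^ a" and ?B = "LINT z|M k. w z * snd z ^ b"
        and ?D = "LINT z|M k. w z * (fst z ^ a * snd z ^ b)"
      have "(LINT z|Q k. fst z ^ a * snd z ^ b) = ?D / c k"
        by (intro Q_int continuous_intros)
      moreover have "(LINT x|X k. x ^ a) = ?A / c k" "(LINT y|Y k. y ^ b) = ?B / c k"
        unfolding X_int[OF pc] Y_int[OF pc] by (intro Q_int continuous_intros)+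
      moreover have "pair_sum (defect_kernel F \<theta> a b) (m k) (ps k) / (real (m k))\<^sup>2 = ?A * ?B - ?D * c k"
        unfolding pair_sum_defect_kernel[OF F] by (simp only: w_def M_def c_def)
      moreover have "?D / c k = ?A / c k * (?B / c k) - (?A * ?B - ?D * c k) / (c k)\<^sup>2"
        using c0[of k] by (simp add: diff_divide_distrib power2_eq_square)
      ultimately show ?thesis by (simp only:)
    qed
    moreover have "(\<lambda>k. (LINT x|X (r k). x ^ a) * (LINT y|Y (r k). y ^ b)
         - pair_sum (defect_kernel F \<theta> a b) (m (r k)) (ps (r k)) / (real (m (r k)))\<^sup>2 / (c (r k))\<^sup>2)
       \<longlonglongrightarrow> (LINT x|X'. x ^ a) * (LINT y|Y'. y ^ b) - 0 / c'\<^sup>2"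
      using LIMSEQ_subseq_LIMSEQ[OF defect[of a b] r] c'0
      by (intro tendsto_intros weak_limD[OF X'_lim pc] weak_limD[OF Y'_lim pc] c_lim) (auto simp: comp_def)
    moreover have "(LINT z|?P. fst z ^ a * snd z ^ b) = (LINT x|X'. x ^ a) * (LINT y|Y'. y ^ b)"
      using X'c Y'c by (intro integral_pair_mult on_compact_integrable[OF X'c pc] on_compact_integrable[OF Y'c pc])
        (auto simp: on_compact_def)
    ultimately show "(\<lambda>k. LINT z|Q (r k). g (fst z) * h (snd z)) \<longlonglongrightarrow> (LINT z|?P. g (fst z) * h (snd z))"
      by (simp add: gh)
  qed (use Qc Pc in \<open>auto intro!: continuous_intros\<close>)
  \<comment> \<open>The tilt is undone by testing with \<open>exp (\<theta> F) f\<close>.\<close>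
  have M_lim: "(\<lambda>k. LINT z|M (r k). f z) \<longlonglongrightarrow> (LINT z|?P. c' * exp (\<theta> * F z) * f z)"
    if f: "continuous_on UNIV f" for f
  proof -
    have fc: "continuous_on UNIV (\<lambda>z. exp (\<theta> * F z) * f z)" by (intro continuous_intros F f)
    have "(LINT z|M k. f z) = c k * (LINT z|Q k. exp (\<theta> * F z) * f z)" for k
    proof -
      have "w z * (exp (\<theta> * F z) * f z) = f z" for z by (simp add: w_def flip: exp_add mult.assoc)
      then show ?thesis using c0[of k] unfolding Q_int[OF fc] by (simp only:) simp
    qed
    moreover have "(\<lambda>k. c (r k) * (LINT z|Q (r k). exp (\<theta> * F z) * f z))
        \<longlonglongrightarrow> c' * (LINT z|?P. exp (\<theta> * F z) * f z)"
      by (intro tendsto_intros c_lim weak_limD[OF Q_lim fc])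
    ultimately show ?thesis by (simp add: mult.assoc)
  qed
  have mr: "filterlim (\<lambda>k. m (r k)) sequentially sequentially"
    using filterlim_compose[OF m filterlim_subseq[OF r]] by (simp add: comp_def)
  have riemann: "(\<lambda>k. (\<Sum>i\<in>{1..m (r k)}. f (real i / real (m (r k)))) / real (m (r k))) \<longlonglongrightarrow> (LINT x|unif. f x)"
    if f: "continuous_on UNIV f" for f :: "real \<Rightarrow> real"
    using filterlim_compose[OF riemann_sum_tendsto[OF continuous_on_subset[OF f]] mr]
        by (simp add: integral_unif[OF f])
  have margX: "(LINT z|?P. c' * exp (\<theta> * F z) * f (fst z)) = (LINT x|unif. f x)"
    and margY: "(LINT z|?P. c' * exp (\<theta> * F z) * f (snd z)) = (LINT x|unif. f x)"
    if f: "continuous_on UNIV f" for f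
    by (rule LIMSEQ_unique[OF M_lim[OF continuous_on_fst_snd_UNIV(1)[OF f]]]
        LIMSEQ_unique[OF M_lim[OF continuous_on_fst_snd_UNIV(2)[OF f]]];
        use riemann[OF f] in \<open>simp only: M_def emp_marginal[OF ps f]\<close>)+
  have one: "(LINT z|?P. c' * exp (\<theta> * F z)) = 1"
    using margX[of "\<lambda>_. 1"] prob_space.prob_space[OF prob_space_unif] by simp
  have gibbs: "gibbs_form F \<theta> (density ?P (\<lambda>z. c' * exp (\<theta> * F z)))"
    by (rule gibbs_form_of_tilted_product[OF F B c'0 X'c Y'c one margX margY])
  have "weak_lim (\<lambda>k. emp (m (r k)) (ps (r k))) (density ?P (\<lambda>z. c' * exp (\<theta> * F z)))"
    unfolding weak_lim_def
  proof (intro allI impI)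
    fix f :: "real \<times> real \<Rightarrow> real" assume f: "continuous_on UNIV f"
    have "continuous_on UNIV (\<lambda>z. c' * exp (\<theta> * F z))" by (intro continuous_intros F)
    from on_compact_density(2)[OF Pc this _ one f] c'0 M_lim[OF f]
    show "(\<lambda>k. LINT z|emp (m (r k)) (ps (r k)). f z) \<longlonglongrightarrow> (LINT z|density ?P (\<lambda>z. c' * exp (\<theta> * F z)). f z)"
      by (simp add: M_def less_imp_le)
  qed
  from that[OF r gibbs this] show ?thesis .
qed

section \<open>The law of large numbers\<close>

lemma perm_law_markov:
  assumes f: "\<And>p. p \<in> perms n \<Longrightarrow> 0 \<le> f p" and c: "0 < c"
  shows "measure (perm_law F n \<theta>) {p \<in> perms n. c \<le> f p} \<le> (LINT p|perm_law F n \<theta>. f p) / c"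
proof -
  have "measure (perm_law F n \<theta>) {p \<in> perms n. c \<le> f p}
      = (LINT p|perm_law F n \<theta>. indicator {p \<in> perms n. c \<le> f p} p)"
    by (subst Bochner_Integration.integral_indicator) (auto intro!: arg_cong[where f = "measure _"])
  also have "\<dots> \<le> (LINT p|perm_law F n \<theta>. f p / c)"
    using f c by (intro integral_mono) (auto simp: indicator_def)
  finally show ?thesis by simp
qed

lemma perm_law_measure_mono:
  assumes "\<And>p. p \<in> perms n \<Longrightarrow> P p \<Longrightarrow> Q p"
  shows "measure (perm_law F n \<theta>) {p \<in> perms n. P p} \<le> measure (perm_law F n \<theta>) {p \<in> perms n. Q p}"
proof -
  interpret prob_space "perm_law F n \<theta>" by (rule prob_space_perm_law)
  show ?thesis using assms by (intro finite_measure_mono) auto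
qed

text \<open>
  Only the degrees below \<open>K\<close> enter, so that the expectation is of order \<open>1 / n\<close> for fixed \<open>K\<close>.
\<close>

definition defect_norm :: "(real \<times> real \<Rightarrow> real) \<Rightarrow> real \<Rightarrow> nat \<Rightarrow> nat \<Rightarrow> (nat \<Rightarrow> nat) \<Rightarrow> real" where
  "defect_norm F \<theta> K n p = (\<Sum>a<K. \<Sum>b<K. (pair_sum (defect_kernel F \<theta> a b) n p / (real n)\<^sup>2)\<^sup>2)"

lemma defect_norm_nonneg: "0 \<le> defect_norm F \<theta> K n p"
  unfolding defect_norm_def by (intro sum_nonneg) auto

lemma defect_norm_expectation:
  assumes B: "\<And>z. \<bar>F z\<bar> \<le> B" and n: "1 \<le> n"
  shows "(LINT p|perm_law F n \<theta>. defect_norm F \<theta> K n p) \<le> (real K)\<^sup>2 * (4 * (exp (2 * \<bar>\<theta>\<bar> * B))\<^sup>2) / real n"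
proof -
  have "(LINT p|perm_law F n \<theta>. defect_norm F \<theta> K n p)
     = (\<Sum>a<K. \<Sum>b<K. (LINT p|perm_law F n \<theta>. (pair_sum (defect_kernel F \<theta> a b) n p)\<^sup>2) / real n ^ 4)"
    unfolding defect_norm_def
    by (simp only: Bochner_Integration.integral_sum integrable_perm_law power_divide power_mult[symmetric]
        integral_divide_zero) simp
  also have "\<dots> \<le> (\<Sum>a<K. \<Sum>b<K. (4 * (exp (2 * \<bar>\<theta>\<bar> * B))\<^sup>2) / real n)"
  proof (intro sum_mono)
    fix a b
    have "(LINT p|perm_law F n \<theta>. (pair_sum (defect_kernel F \<theta> a b) n p)\<^sup>2)
       \<le> 4 * (exp (2 * \<bar>\<theta>\<bar> * B))\<^sup>2 * real n ^ 3"
      by (rule pair_sum_second_moment[OF swap_odd_defect_kernel defect_kernel_bound[OF B]])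
    then have "(LINT p|perm_law F n \<theta>. (pair_sum (defect_kernel F \<theta> a b) n p)\<^sup>2) / real n ^ 4
       \<le> (4 * (exp (2 * \<bar>\<theta>\<bar> * B))\<^sup>2 * real n ^ 3) / real n ^ 4"
      by (rule divide_right_mono) simp
    also have "\<dots> = (4 * (exp (2 * \<bar>\<theta>\<bar> * B))\<^sup>2) / real n"
      using n by (simp add: field_simps power_eq_if)
    finally show "(LINT p|perm_law F n \<theta>. (pair_sum (defect_kernel F \<theta> a b) n p)\<^sup>2) / real n ^ 4
       \<le> (4 * (exp (2 * \<bar>\<theta>\<bar> * B))\<^sup>2) / real n" .
  qed
  also have "\<dots> = (real K)\<^sup>2 * (4 * (exp (2 * \<bar>\<theta>\<bar> * B))\<^sup>2) / real n"
    by (simp add: power2_eq_square)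
  finally show ?thesis .
qed

text \<open>
  A compactness argument: if no \<open>K\<close> worked, some sequence of permutations would have all its defects
  tending to \<open>0\<close> while \<open>T\<close> stays away from \<open>\<tau>\<close>. But a subsequence converges to a permuton of Gibbs
  form, where \<open>T\<close> tends to \<open>\<tau>\<close> by assumption.
\<close>

lemma small_defect_imp_close:
  assumes F: "continuous_on UNIV F" and B: "\<And>z. \<bar>F z\<bar> \<le> B"
    and conv: "\<And>m ps \<mu>. filterlim m at_top sequentially \<Longrightarrow> (\<And>k. 1 \<le> m k) \<Longrightarrow> (\<And>k. ps k \<in> perms (m k))
        \<Longrightarrow> gibbs_form F \<theta> \<mu> \<Longrightarrow> weak_lim (\<lambda>k. emp (m k) (ps k)) \<mu> \<Longrightarrow> (\<lambda>k. T (m k) (ps k)) \<longlonglongrightarrow> (\<tau> :: real)"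
    and e: "0 < e"
  shows "\<exists>K. \<forall>n>K. \<forall>p\<in>perms n. defect_norm F \<theta> K n p < 1 / real (Suc K) \<longrightarrow> \<bar>T n p - \<tau>\<bar> \<le> e"
proof (rule ccontr)
  assume "\<not> ?thesis"
  then have "\<forall>K. \<exists>n p. K < n \<and> p \<in> perms n \<and> defect_norm F \<theta> K n p < 1 / real (Suc K) \<and> \<not> \<bar>T n p - \<tau>\<bar> \<le> e"
    by blast
  then obtain m ps where m: "\<And>K. K < m K" and ps: "\<And>K. ps K \<in> perms (m K)"
    and small: "\<And>K. defect_norm F \<theta> K (m K) (ps K) < 1 / real (Suc K)" and far: "\<And>K. \<not> \<bar>T (m K) (ps K) - \<tau>\<bar> \<le> e"
    by metis
  have m_lim: "filterlim m at_top sequentially"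
    by (rule filterlim_at_top_mono[OF filterlim_ident]) (use m in \<open>auto intro!: always_eventually less_imp_le\<close>)
  have m1: "1 \<le> m K" for K using m[of K] by simp
  \<comment> \<open>For fixed degrees the defect is one of the summands of the norm as soon as \<open>K\<close> exceeds both.\<close>
  have defect: "(\<lambda>K. pair_sum (defect_kernel F \<theta> a b) (m K) (ps K) / (real (m K))\<^sup>2) \<longlonglongrightarrow> 0" (is "?d \<longlonglongrightarrow> 0") for a b
  proof -
    have "(\<lambda>K. (?d K)\<^sup>2) \<longlonglongrightarrow> 0"
    proof (rule tendsto_sandwich[OF _ _ tendsto_const LIMSEQ_inverse_real_of_nat])
      show "eventually (\<lambda>K. (?d K)\<^sup>2 \<le> inverse (real (Suc K))) sequentially"
        using eventually_gt_at_top[of a] eventually_gt_at_top[of b]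
      proof eventually_elim
        case (elim K)
        have "(?d K)\<^sup>2 \<le> (\<Sum>b<K. (pair_sum (defect_kernel F \<theta> a b) (m K) (ps K) / (real (m K))\<^sup>2)\<^sup>2)"
          using elim by (intro member_le_sum) auto
        also have "\<dots> \<le> defect_norm F \<theta> K (m K) (ps K)"
          unfolding defect_norm_def using elim
          by (intro member_le_sum[where f = "\<lambda>a. \<Sum>b<K. (pair_sum (defect_kernel F \<theta> a b) (m K) (ps K) / (real (m K))\<^sup>2)\<^sup>2"] sum_nonneg) auto
        finally show ?case using small[of K] by (simp add: inverse_eq_divide)
      qed
    qed auto
    then show ?thesis by (simp add: power_tendsto_0_iff)
  qed
  obtain r \<mu> where r: "strict_mono r" and \<mu>: "gibbs_form F \<theta> \<mu>" "weak_lim (\<lambda>k. emp (m (r k)) (ps (r k))) \<mu>"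
    by (rule gibbs_limit_exists[where ps = ps and m = m, OF F B m_lim m1 ps defect])
  have "filterlim (\<lambda>k. m (r k)) at_top sequentially"
    using filterlim_compose[OF m_lim filterlim_subseq[OF r]] by (simp add: comp_def)
  from conv[OF this m1 ps \<mu>] have "(\<lambda>k. T (m (r k)) (ps (r k))) \<longlonglongrightarrow> \<tau>" .
  from LIMSEQ_D[OF this e] far show False by (metis less_imp_le order.refl real_norm_def)
qed

text \<open>
  The hypothesis concerns deterministic sequences only. Randomness enters through the fact that all
  permutations with small defects, hence with \<open>T\<close> close to \<open>\<tau>\<close>, together have probability near \<open>1\<close>.
\<close>

theorem lln_in_probability:
  assumes F: "continuous_on UNIV F" and B: "\<And>z. \<bar>F z\<bar> \<le> B"
    and conv: "\<And>m ps \<mu>. filterlim m at_top sequentially \<Longrightarrow> (\<And>k. 1 \<le> m k) \<Longrightarrow> (\<And>k. ps k \<in> perms (m k))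
        \<Longrightarrow> gibbs_form F \<theta> \<mu> \<Longrightarrow> weak_lim (\<lambda>k. emp (m k) (ps k)) \<mu> \<Longrightarrow> (\<lambda>k. T (m k) (ps k)) \<longlonglongrightarrow> (\<tau> :: real)"
    and e: "0 < e"
  shows "(\<lambda>n. measure (perm_law F n \<theta>) {p \<in> perms n. e < \<bar>T n p - \<tau>\<bar>}) \<longlonglongrightarrow> 0"
proof -
  have "\<exists>K. \<forall>n>K. \<forall>p\<in>perms n. defect_norm F \<theta> K n p < 1 / real (Suc K) \<longrightarrow> \<bar>T n p - \<tau>\<bar> \<le> e"
    by (rule small_defect_imp_close[where T = T and \<tau> = \<tau>, OF F B _ e]) (rule conv)
  then obtain K where
    K: "\<And>n p. K < n \<Longrightarrow> p \<in> perms n \<Longrightarrow> defect_norm F \<theta> K n p < 1 / real (Suc K) \<Longrightarrow> \<bar>T n p - \<tau>\<bar> \<le> e"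
    by blast
  define C where "C = (real K)\<^sup>2 * (4 * (exp (2 * \<bar>\<theta>\<bar> * B))\<^sup>2) * real (Suc K)"
  have le: "measure (perm_law F n \<theta>) {p \<in> perms n. e < \<bar>T n p - \<tau>\<bar>} \<le> C / real n" if n: "K < n" for n
  proof -
    have "measure (perm_law F n \<theta>) {p \<in> perms n. e < \<bar>T n p - \<tau>\<bar>}
       \<le> measure (perm_law F n \<theta>) {p \<in> perms n. 1 / real (Suc K) \<le> defect_norm F \<theta> K n p}"
    proof (rule perm_law_measure_mono)
      fix p assume "p \<in> perms n" "e < \<bar>T n p - \<tau>\<bar>"
      then show "1 / real (Suc K) \<le> defect_norm F \<theta> K n p" using K[OF n, of p] by linarith
    qed
    also have "\<dots> \<le> (LINT p|perm_law F n \<theta>. defect_norm F \<theta> K n p) / (1 / real (Suc K))"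
      by (intro perm_law_markov defect_norm_nonneg) simp
    also have "\<dots> \<le> ((real K)\<^sup>2 * (4 * (exp (2 * \<bar>\<theta>\<bar> * B))\<^sup>2) / real n) / (1 / real (Suc K))"
      using n by (intro divide_right_mono defect_norm_expectation B) auto
    also have "\<dots> = C / real n" by (simp add: C_def)
    finally show ?thesis .
  qed
  have lim: "(\<lambda>n. C / real n) \<longlonglongrightarrow> 0" by (rule lim_const_over_n)
  show ?thesis
    by (rule tendsto_sandwich[OF _ _ tendsto_const lim])
       (use le in \<open>auto intro!: eventually_mono[OF eventually_gt_at_top[of K]]\<close>)
qed

text \<open>
  Otherwise the hypothesis on \<open>T\<close> in the law of large numbers would be vacuous, and the constant
  statistic \<open>1\<close> would converge to \<open>0\<close> in probability.
\<close>

lemma gibbs_form_exists: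
  assumes F: "continuous_on UNIV F" and B: "\<And>z. \<bar>F z\<bar> \<le> B"
  shows "\<exists>\<mu>. gibbs_form F \<theta> \<mu>"
proof (rule ccontr)
  assume no: "\<nexists>\<mu>. gibbs_form F \<theta> \<mu>"
  have "(\<lambda>n. measure (perm_law F n \<theta>) {p \<in> perms n. 1 / 2 < \<bar>1 - 0 :: real\<bar>}) \<longlonglongrightarrow> 0"
    using no by (intro lln_in_probability[OF F B]) auto
  moreover have "measure (perm_law F n \<theta>) {p \<in> perms n. 1 / 2 < \<bar>1 - 0 :: real\<bar>} = 1" for n
    using prob_space.prob_space[OF prob_space_perm_law[of F n \<theta>]] by simp
  ultimately show False by (simp add: LIMSEQ_const_iff)
qed

lemma integral_emp_pair:
  fixes f :: "(real \<times> real) \<times> 'b::{metric_space, second_countable_topology} \<Rightarrow> real"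
  assumes p: "p \<in> perms n" "1 \<le> n" and N: "on_compact K N" and f: "continuous_on UNIV f"
  shows "(LINT w|(emp n p \<Otimes>\<^sub>M N). f w) = (\<Sum>i\<in>{1..n}. LINT v|N. f (grid_pt n p i, v)) / real n"
proof -
  note E = on_compact_emp[OF p]
  interpret E: prob_space "emp n p" using E by (simp add: on_compact_def)
  interpret N: prob_space N using N by (simp add: on_compact_def)
  interpret pair_prob_space "emp n p" N ..
  have int: "integrable (emp n p \<Otimes>\<^sub>M N) f" by (rule on_compact_integrable[OF on_compact_pair[OF E N] f])
  have "sets (emp n p) = sets borel" using E by (simp add: on_compact_def)
  then have "(\<lambda>z. LINT v|N. f (z, v)) \<in> borel_measurable borel"
    using N.borel_measurable_lebesgue_integral[of "\<lambda>z v. f (z, v)" "emp n p"] int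
    by (simp cong: measurable_cong_sets)
  then show ?thesis
    using integral_fst'[OF int] by (simp add: integral_emp)
qed

lemma lln_triple:
  fixes f :: "(real \<times> real) \<times> (real \<times> real) \<times> (real \<times> real) \<Rightarrow> real"
  assumes F: "continuous_on UNIV F" and B: "\<And>z. \<bar>F z\<bar> \<le> B" and \<mu>: "gibbs_form F \<theta> \<mu>"
    and f: "continuous_on UNIV f" and e: "0 < e"
  shows "(\<lambda>n. measure (perm_law F n \<theta>) {p \<in> perms n. e < \<bar>
    (\<Sum>i\<in>{1..n}. \<Sum>j\<in>{1..n}. \<Sum>k\<in>{1..n}. f (grid_pt n p i, grid_pt n p j, grid_pt n p k)) / real n ^ 3
     - (LINT w|(\<mu> \<Otimes>\<^sub>M (\<mu> \<Otimes>\<^sub>M \<mu>)). f w)\<bar>}) \<longlonglongrightarrow> 0"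
proof (rule lln_in_probability[OF F B _ e])
  fix m ps \<mu>'
  assume m: "\<And>k. 1 \<le> m k" and ps: "\<And>k. ps k \<in> perms (m k)" and \<mu>': "gibbs_form F \<theta> \<mu>'"
    and lim: "weak_lim (\<lambda>k. emp (m k) (ps k)) \<mu>'"
  have "\<mu>' = \<mu>" using mu_opt_eq[OF F \<mu>] mu_opt_eq[OF F \<mu>'] by simp
  with lim have lim: "weak_lim (\<lambda>k. emp (m k) (ps k)) \<mu>" by simp
  have \<mu>c: "on_compact unit_square \<mu>" using \<mu> by (simp add: gibbs_form_def permutons_on_compact)
  have Ec: "on_compact unit_square (emp (m k) (ps k))" for k by (rule on_compact_emp[OF ps m])
  have sum: "(LINT w|(emp n p \<Otimes>\<^sub>M (emp n p \<Otimes>\<^sub>M emp n p)). f w)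
      = (\<Sum>i\<in>{1..n}. \<Sum>j\<in>{1..n}. \<Sum>k\<in>{1..n}. f (grid_pt n p i, grid_pt n p j, grid_pt n p k)) / real n ^ 3"
    if p: "p \<in> perms n" "1 \<le> n" for n p
  proof -
    note E = on_compact_emp[OF p]
    have c1: "continuous_on UNIV (\<lambda>v. f (z, v))" for z
        by (intro continuous_on_Pair_compose[OF f] continuous_intros)
    have c2: "continuous_on UNIV (\<lambda>v. f (z, z', v))" for z z'
        by (intro continuous_on_Pair_compose[OF f] continuous_intros)
    show ?thesis
      by (simp add: integral_emp_pair[OF p on_compact_pair[OF E E] f] integral_emp_pair[OF p E c1]
          integral_emp[OF borel_measurable_continuous_onI[OF c2]] sum_divide_distrib power3_eq_cube)
  qed
  have "weak_lim (\<lambda>k. emp (m k) (ps k) \<Otimes>\<^sub>M (emp (m k) (ps k) \<Otimes>\<^sub>M emp (m k) (ps k))) (\<mu> \<Otimes>\<^sub>M (\<mu> \<Otimes>\<^sub>M \<mu>))"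
    by (intro weak_lim_pair[of unit_square _ _
        "unit_square \<times> unit_square"] weak_lim_pair[of unit_square _ _ unit_square]
        on_compact_pair Ec \<mu>c lim)
  from weak_limD[OF this f] show "(\<lambda>k. (\<Sum>i\<in>{1..m k}. \<Sum>j\<in>{1..m k}. \<Sum>l\<in>{1..m k}.
      f (grid_pt (m k) (ps k) i, grid_pt (m k) (ps k) j, grid_pt (m k) (ps k) l)) / real (m k) ^ 3)
     \<longlonglongrightarrow> (LINT w|(\<mu> \<Otimes>\<^sub>M (\<mu> \<Otimes>\<^sub>M \<mu>)). f w)"
    by (simp add: sum[OF ps m])
qed

lemma lln_pair:
  fixes f :: "(real \<times> real) \<times> (real \<times> real) \<Rightarrow> real"
  assumes F: "continuous_on UNIV F" and B: "\<And>z. \<bar>F z\<bar> \<le> B" and \<mu>: "gibbs_form F \<theta> \<mu>"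
    and f: "continuous_on UNIV f" and e: "0 < e"
  shows "(\<lambda>n. measure (perm_law F n \<theta>) {p \<in> perms n. e < \<bar>
    (\<Sum>i\<in>{1..n}. \<Sum>j\<in>{1..n}. f (grid_pt n p i, grid_pt n p j)) / (real n)\<^sup>2
     - (LINT w|(\<mu> \<Otimes>\<^sub>M \<mu>). f w)\<bar>}) \<longlonglongrightarrow> 0"
proof (rule lln_in_probability[OF F B _ e])
  fix m ps \<mu>'
  assume m: "\<And>k. 1 \<le> m k" and ps: "\<And>k. ps k \<in> perms (m k)" and \<mu>': "gibbs_form F \<theta> \<mu>'"
    and lim: "weak_lim (\<lambda>k. emp (m k) (ps k)) \<mu>'"
  have "\<mu>' = \<mu>" using mu_opt_eq[OF F \<mu>] mu_opt_eq[OF F \<mu>'] by simp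
  with lim have lim: "weak_lim (\<lambda>k. emp (m k) (ps k)) \<mu>" by simp
  have \<mu>c: "on_compact unit_square \<mu>" using \<mu> by (simp add: gibbs_form_def permutons_on_compact)
  have Ec: "on_compact unit_square (emp (m k) (ps k))" for k by (rule on_compact_emp[OF ps m])
  have sum: "(LINT w|(emp n p \<Otimes>\<^sub>M emp n p). f w)
      = (\<Sum>i\<in>{1..n}. \<Sum>j\<in>{1..n}. f (grid_pt n p i, grid_pt n p j)) / (real n)\<^sup>2"
    if p: "p \<in> perms n" "1 \<le> n" for n p
  proof -
    note E = on_compact_emp[OF p]
    have c1: "continuous_on UNIV (\<lambda>v. f (z, v))" for z
        by (intro continuous_on_Pair_compose[OF f] continuous_intros)
    show ?thesis
      by (simp add: integral_emp_pair[OF p E f] integral_emp[OF borel_measurable_continuous_onI[OF c1]]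
          sum_divide_distrib power2_eq_square)
  qed
  have "weak_lim (\<lambda>k. emp (m k) (ps k) \<Otimes>\<^sub>M emp (m k) (ps k)) (\<mu> \<Otimes>\<^sub>M \<mu>)"
    by (intro weak_lim_pair[of unit_square _ _ unit_square] Ec \<mu>c lim)
  from weak_limD[OF this f] show "(\<lambda>k. (\<Sum>i\<in>{1..m k}. \<Sum>j\<in>{1..m k}.
      f (grid_pt (m k) (ps k) i, grid_pt (m k) (ps k) j)) / (real (m k))\<^sup>2) \<longlonglongrightarrow> (LINT w|(\<mu> \<Otimes>\<^sub>M \<mu>). f w)"
    by (simp add: sum[OF ps m])
qed

section \<open>The central limit theorem for the score\<close>

definition score_kernel :: "(real \<times> real \<Rightarrow> real) \<Rightarrow> real \<Rightarrow> real \<times> real \<Rightarrow> real \<times> real \<Rightarrow> real" where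
  "score_kernel F \<theta> z w = G_diff F z w / (1 + exp (\<theta> * G_diff F z w))"

lemma one_plus_exp_pos: "0 < 1 + exp (x :: real)"
  by (simp add: add_pos_pos)

lemma continuous_score_kernel:
  assumes "continuous_on UNIV F" "continuous_on A f" "continuous_on A g"
  shows "continuous_on A (\<lambda>x. score_kernel F \<theta> (f x) (g x))"
  unfolding score_kernel_def using one_plus_exp_pos
  by (intro continuous_intros continuous_G_diff assms) (auto simp: less_imp_neq[symmetric])

text \<open>
  The exchange replaces \<open>G\<close> by \<open>- G\<close>, and \<open>- g exp (- \<theta> g) / (1 + exp (- \<theta> g)) = - g / (1 + exp (\<theta> g))\<close>.
\<close>

lemma swap_odd_score_kernel: "swap_odd F \<theta> (score_kernel F \<theta>)"
  unfolding swap_odd_def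
proof (intro allI)
  fix x1 y1 x2 y2
  define g where "g = G_diff F (x1, y1) (x2, y2)"
  have "G_diff F (x1, y2) (x2, y1) = - g" by (simp add: G_diff_def g_def)
  moreover have "- g / (1 + exp (- (\<theta> * g))) * exp (- (\<theta> * g)) = - (g / (1 + exp (\<theta> * g)))"
    using one_plus_exp_pos[of "\<theta> * g"] one_plus_exp_pos[of "- (\<theta> * g)"]
    by (simp add: field_simps exp_minus)
  ultimately show "score_kernel F \<theta> (x1, y2) (x2, y1) * exp (- \<theta> * G_diff F (x1, y1) (x2, y2))
      = - score_kernel F \<theta> (x1, y1) (x2, y2)"
    by (simp add: score_kernel_def g_def[symmetric])
qed

lemma G_diff_sym: "G_diff F z w = G_diff F w z"
  by (simp add: G_diff_def)

lemma score_kernel_sym: "score_kernel F \<theta> z w = score_kernel F \<theta> w z"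
  by (simp add: score_kernel_def G_diff_sym)

lemma G_diff_bound:
  assumes B: "\<And>z. \<bar>F z\<bar> \<le> B"
  shows "\<bar>G_diff F z w\<bar> \<le> 4 * B"
  using B[of "(fst z, snd z)"] B[of "(fst w, snd w)"] B[of "(fst z, snd w)"] B[of "(fst w, snd z)"]
  unfolding G_diff_def by linarith

lemma score_kernel_bound:
  assumes B: "\<And>z. \<bar>F z\<bar> \<le> B"
  shows "\<bar>score_kernel F \<theta> z w\<bar> \<le> 4 * B"
proof -
  have "\<bar>score_kernel F \<theta> z w\<bar> = \<bar>G_diff F z w\<bar> / (1 + exp (\<theta> * G_diff F z w))"
    using one_plus_exp_pos[of "\<theta> * G_diff F z w"] by (simp add: score_kernel_def abs_divide)
  also have "\<dots> \<le> \<bar>G_diff F z w\<bar> / 1" by (intro divide_left_mono) (auto intro: add_pos_pos)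
  also have "\<dots> \<le> 4 * B" using G_diff_bound[of F B, OF B] by simp
  finally show ?thesis .
qed

text \<open>
  The kernel is symmetric and vanishes on the diagonal.
\<close>

lemma PL_score_eq_pair_sum: "PL_score F n p t = pair_sum (score_kernel F t) n p / 2"
proof -
  define q where "q i j = score_kernel F t (grid_pt n p i) (grid_pt n p j)" for i j
  have sym: "q i j = q j i" for i j unfolding q_def by (rule score_kernel_sym)
  have diag: "q i i = 0" for i by (simp add: q_def score_kernel_def G_diff_def)
  have split: "(\<Sum>i\<in>{1..n}. q i j) = (\<Sum>i = 1..<j. q i j) + (\<Sum>i\<in>{j<..n}. q i j)" if "j \<in> {1..n}" for j
  proof -
    have "{1..n} = {1..<j} \<union> ({j} \<union> {j<..n})" using that by auto
    then have "(\<Sum>i\<in>{1..n}. q i j) = (\<Sum>i\<in>{1..<j}. q i j) + ((\<Sum>i\<in>{j}. q i j) + (\<Sum>i\<in>{j<..n}. q i j))"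
      by (subst (1) \<open>{1..n} = _\<close>, subst sum.union_disjoint, simp, simp, force, subst sum.union_disjoint) auto
    then show ?thesis by (simp add: diag)
  qed
  have swap: "(\<Sum>j\<in>{1..n}. \<Sum>i\<in>{j<..n}. q i j) = (\<Sum>j\<in>{1..n}. \<Sum>i = 1..<j. q i j)"
  proof -
    have "(\<Sum>j\<in>{1..n}. \<Sum>i\<in>{j<..n}. q i j) = (\<Sum>j\<in>{1..n}. \<Sum>i\<in>{1..n}. if j < i then q i j else 0)"
      by (intro sum.cong refl sum.mono_neutral_cong_left) auto
    also have "\<dots> = (\<Sum>i\<in>{1..n}. \<Sum>j\<in>{1..n}. if j < i then q i j else 0)" by (rule sum.swap)
    also have "\<dots> = (\<Sum>i\<in>{1..n}. \<Sum>j = 1..<i. q i j)"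
      by (intro sum.cong refl sum.mono_neutral_cong_right) auto
    also have "\<dots> = (\<Sum>i\<in>{1..n}. \<Sum>j = 1..<i. q j i)" by (intro sum.cong refl sym)
    finally show ?thesis by (simp only:)
  qed
  have "pair_sum (score_kernel F t) n p = (\<Sum>j\<in>{1..n}. \<Sum>i\<in>{1..n}. q j i)"
    by (simp add: pair_sum_def q_def)
  also have "\<dots> = (\<Sum>j\<in>{1..n}. \<Sum>i\<in>{1..n}. q i j)" by (intro sum.cong refl sym)
  also have "\<dots> = (\<Sum>j\<in>{1..n}. (\<Sum>i = 1..<j. q i j) + (\<Sum>i\<in>{j<..n}. q i j))"
    by (intro sum.cong refl split)
  also have "\<dots> = 2 * (\<Sum>j\<in>{1..n}. \<Sum>i = 1..<j. q i j)" unfolding sum.distrib swap by simp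
  finally show ?thesis
    by (simp add: PL_score_def q_def score_kernel_def y_diff_eq_G_diff)
qed

lemma expectation_abs_le:
  fixes f :: "(nat \<Rightarrow> nat) \<Rightarrow> real"
  assumes f: "\<And>p. p \<in> perms n \<Longrightarrow> \<bar>f p\<bar> \<le> M" and e: "0 \<le> e"
  shows "(LINT p|perm_law F n \<theta>. \<bar>f p\<bar>) \<le> e + M * measure (perm_law F n \<theta>) {p \<in> perms n. e < \<bar>f p\<bar>}"
proof -
  interpret prob_space "perm_law F n \<theta>" by (rule prob_space_perm_law)
  let ?A = "{p \<in> perms n. e < \<bar>f p\<bar>}"
  have "(LINT p|perm_law F n \<theta>. \<bar>f p\<bar>) \<le> (LINT p|perm_law F n \<theta>. e + M * indicator ?A p)"
    using f e by (intro integral_mono) (force simp: indicator_def)+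
  also have "\<dots> = (LINT p|perm_law F n \<theta>. e) + (LINT p|perm_law F n \<theta>. M * indicator ?A p)"
    by (rule Bochner_Integration.integral_add) auto
  also have "\<dots> = e + M * measure (perm_law F n \<theta>) ?A"
    using prob_space by (simp add: Int_absorb1[of ?A "perms n"] Int_commute)
  finally show ?thesis .
qed

lemma expectation_abs_tendsto:
  fixes f :: "nat \<Rightarrow> (nat \<Rightarrow> nat) \<Rightarrow> real"
  assumes f: "\<And>n p. p \<in> perms n \<Longrightarrow> \<bar>f n p\<bar> \<le> M" 
    and lim: "\<And>e. 0 < e \<Longrightarrow> (\<lambda>n. measure (perm_law F n \<theta>) {p \<in> perms n. e < \<bar>f n p\<bar>}) \<longlonglongrightarrow> 0"
  shows "(\<lambda>n. LINT p|perm_law F n \<theta>. \<bar>f n p\<bar>) \<longlonglongrightarrow> 0"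
proof (rule LIMSEQ_I)
  fix r :: real assume r: "0 < r"
  have "(\<lambda>n. r / 2 + M * measure (perm_law F n \<theta>) {p \<in> perms n. r / 2 < \<bar>f n p\<bar>}) \<longlonglongrightarrow> r / 2 + M * 0"
    using r by (intro tendsto_intros lim) simp
  then have "eventually (\<lambda>n. r / 2 + M * measure (perm_law F n \<theta>) {p \<in> perms n. r / 2 < \<bar>f n p\<bar>}
      < r) sequentially"
    by (rule order_tendstoD) (use r in simp)
  then show "\<exists>no. \<forall>n\<ge>no. norm ((LINT p|perm_law F n \<theta>. \<bar>f n p\<bar>) - 0) < r"
    unfolding eventually_sequentially
  proof (elim exE, intro exI allI impI)
    fix N n assume N: "\<forall>n\<ge>N. r / 2 + M * measure (perm_law F n \<theta>) {p \<in> perms n. r / 2 < \<bar>f n p\<bar>} < r" and "N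
        \<le> n"
    moreover have "0 \<le> (LINT p|perm_law F n \<theta>. \<bar>f n p\<bar>)" by (rule integral_nonneg_AE) simp
    moreover have "(LINT p|perm_law F n \<theta>. \<bar>f n p\<bar>)
        \<le> r / 2 + M * measure (perm_law F n \<theta>) {p \<in> perms n. r / 2 < \<bar>f n p\<bar>}"
      using r f by (intro expectation_abs_le) auto
    ultimately show "norm ((LINT p|perm_law F n \<theta>. \<bar>f n p\<bar>) - 0) < r" by fastforce
  qed
qed

definition triple_mean :: "(real \<times> real \<Rightarrow> real) \<Rightarrow> real \<Rightarrow> nat \<Rightarrow> (nat \<Rightarrow> nat) \<Rightarrow> real" where
  "triple_mean F \<theta> n p = (\<Sum>i\<in>{1..n}. \<Sum>j\<in>{1..n}. \<Sum>k\<in>{1..n}.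
     score_kernel F \<theta> (grid_pt n p i) (grid_pt n p j)
         * score_kernel F \<theta> (grid_pt n p i) (grid_pt n p k)) / real n ^ 3"

text \<open>
  The triple sum is the sum over \<open>i\<close> of the squares of the row sums of the kernel.
\<close>

lemma triple_mean_bounds:
  assumes B: "\<And>z. \<bar>F z\<bar> \<le> B"
  shows "0 \<le> triple_mean F \<theta> n p" and "triple_mean F \<theta> n p \<le> (4 * B)\<^sup>2"
proof -
  have eq: "triple_mean F \<theta> n p
      = (\<Sum>i\<in>{1..n}. (\<Sum>j\<in>{1..n}. score_kernel F \<theta> (grid_pt n p i) (grid_pt n p j))\<^sup>2) / real n ^ 3"
    unfolding triple_mean_def by (simp add: power2_eq_square sum_product)
  show "0 \<le> triple_mean F \<theta> n p" unfolding eq by (intro divide_nonneg_nonneg sum_nonneg) auto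
  have B0: "0 \<le> B" using B[of undefined] by linarith
  have "(\<Sum>j\<in>{1..n}. score_kernel F \<theta> z (grid_pt n p j))\<^sup>2 \<le> (real n * (4 * B))\<^sup>2" for z
  proof -
    have "\<bar>\<Sum>j\<in>{1..n}. score_kernel F \<theta> z (grid_pt n p j)\<bar> \<le> (\<Sum>j\<in>{1..n}. 4 * B)"
      by (intro order.trans[OF sum_abs] sum_mono score_kernel_bound B)
    then show ?thesis using B0 by (intro abs_le_square_iff[THEN iffD1]) simp
  qed
  then have "(\<Sum>i\<in>{1..n}. (\<Sum>j\<in>{1..n}. score_kernel F \<theta> (grid_pt n p i) (grid_pt n p j))\<^sup>2)
      \<le> (\<Sum>i\<in>{1..n}. (real n * (4 * B))\<^sup>2)"
    by (rule sum_mono)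
  also have "\<dots> = (4 * B)\<^sup>2 * real n ^ 3" by (simp add: power2_eq_square power3_eq_cube)
  finally show "triple_mean F \<theta> n p \<le> (4 * B)\<^sup>2"
    unfolding eq by (cases "n = 0") (auto simp: divide_le_eq)
qed

text \<open>
  Convergence in probability improves to convergence in mean by boundedness; the limit inherits
  nonnegativity from the averages.
\<close>

lemma triple_mean_converges:
  assumes F: "continuous_on UNIV F" and B: "\<And>z. \<bar>F z\<bar> \<le> B"
  shows "(\<lambda>n. LINT p|perm_law F n \<theta>. \<bar>triple_mean F \<theta> n p - sigma_sq F \<theta>\<bar>) \<longlonglongrightarrow> 0"
    and "0 \<le> sigma_sq F \<theta>"
proof -
  obtain \<mu> where \<mu>: "gibbs_form F \<theta> \<mu>" using gibbs_form_exists[OF F B] by blast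
  let ?f = "\<lambda>w. score_kernel F \<theta> (fst w) (fst (snd w)) * score_kernel F \<theta> (fst w) (snd (snd w))"
  have fc: "continuous_on UNIV ?f" by (intro continuous_intros continuous_score_kernel F)
  have \<sigma>: "sigma_sq F \<theta> = (LINT w|(\<mu> \<Otimes>\<^sub>M (\<mu> \<Otimes>\<^sub>M \<mu>)). ?f w)"
    unfolding sigma_sq_eq[OF F \<mu>] score_kernel_def ..
  have bd: "\<bar>triple_mean F \<theta> n p - sigma_sq F \<theta>\<bar> \<le> (4 * B)\<^sup>2 + \<bar>sigma_sq F \<theta>\<bar>" for n p
    using triple_mean_bounds[of F B \<theta> n p, OF B] by linarith
  show lim: "(\<lambda>n. LINT p|perm_law F n \<theta>. \<bar>triple_mean F \<theta> n p - sigma_sq F \<theta>\<bar>) \<longlonglongrightarrow> 0"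
  proof (rule expectation_abs_tendsto[OF bd])
    fix e :: real assume "0 < e"
    from lln_triple[OF F B \<mu> fc this]
    show "(\<lambda>n. measure (perm_law F n \<theta>) {p \<in> perms n. e < \<bar>triple_mean F \<theta> n p - sigma_sq F \<theta>\<bar>}) \<longlonglongrightarrow> 0"
      by (simp add: \<sigma> triple_mean_def)
  qed
  show "0 \<le> sigma_sq F \<theta>"
  proof -
    have "- sigma_sq F \<theta> \<le> (LINT p|perm_law F n \<theta>. \<bar>triple_mean F \<theta> n p - sigma_sq F \<theta>\<bar>)" for n
    proof -
      interpret prob_space "perm_law F n \<theta>" by (rule prob_space_perm_law)
      have "(LINT p|perm_law F n \<theta>. - sigma_sq F \<theta>)
          \<le> (LINT p|perm_law F n \<theta>. \<bar>triple_mean F \<theta> n p - sigma_sq F \<theta>\<bar>)"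
      proof (intro integral_mono)
        fix p
        show "- sigma_sq F \<theta> \<le> \<bar>triple_mean F \<theta> n p - sigma_sq F \<theta>\<bar>"
          using triple_mean_bounds(1)[of F B \<theta> n p, OF B] by linarith
      qed auto
      then show ?thesis using prob_space by simp
    qed
    with LIMSEQ_le_const[OF lim, of "- sigma_sq F \<theta>"] show ?thesis by simp
  qed
qed

definition scaled_score :: "(real \<times> real \<Rightarrow> real) \<Rightarrow> real \<Rightarrow> nat \<Rightarrow> (nat \<Rightarrow> nat) \<Rightarrow> real" where
  "scaled_score F \<theta> n p = PL_score F n p \<theta> / (real n * sqrt (real n))"

lemma scaled_score_second_moment:
  assumes B: "\<And>z. \<bar>F z\<bar> \<le> B" and n: "1 \<le> n"
  shows "(LINT p|perm_law F n \<theta>. (scaled_score F \<theta> n p)\<^sup>2) \<le> (4 * B)\<^sup>2"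
proof -
  have "(LINT p|perm_law F n \<theta>. (pair_sum (score_kernel F \<theta>) n p)\<^sup>2) \<le> 4 * (4 * B)\<^sup>2 * real n ^ 3"
    by (rule pair_sum_second_moment[OF swap_odd_score_kernel score_kernel_bound[OF B]])
  moreover have "(scaled_score F \<theta> n p)\<^sup>2 = (pair_sum (score_kernel F \<theta>) n p)\<^sup>2 / (4 * real n ^ 3)" for p
    by (simp add: scaled_score_def PL_score_eq_pair_sum power_divide power_mult_distrib power3_eq_cube power2_eq_square)
  ultimately show ?thesis using n by (simp add: divide_le_eq)
qed

text \<open>
  Stein's identity at \<open>\<tau> = t / (n sqrt n)\<close>. Replacing the random variance by its limit costs its mean
  distance from that limit, and the sum of squares in \<^const>\<open>stein_var\<close> is of lower order.
\<close>

lemma scaled_stein: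
  assumes B: "\<And>z. \<bar>F z\<bar> \<le> B" and n: "1 \<le> n"
  shows "cmod ((LINT p|perm_law F n \<theta>. scaled_score F \<theta> n p * iexp (t * scaled_score F \<theta> n p))
     - \<i> * t * sigma_sq F \<theta> * (LINT p|perm_law F n \<theta>. iexp (t * scaled_score F \<theta> n p)))
    \<le> t\<^sup>2 * (4 * B) ^ 3 / sqrt (real n)
      + \<bar>t\<bar> * ((LINT p|perm_law F n \<theta>. \<bar>triple_mean F \<theta> n p - sigma_sq F \<theta>\<bar>) + (4 * B)\<^sup>2 / real n)"
proof -
  let ?E = "\<lambda>f. (LINT p|perm_law F n \<theta>. f p)"
  let ?v = "sigma_sq F \<theta>"
  define N where "N = real n * sqrt (real n)"
  define S where "S p = pair_sum (score_kernel F \<theta>) n p / 2" for p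
  define W where "W p = scaled_score F \<theta> n p" for p
  define V where "V p = stein_var (score_kernel F \<theta>) n p" for p
  have n0: "0 < real n" using n by simp
  have N0: "0 < N" using n by (simp add: N_def)
  have N2: "N\<^sup>2 = real n ^ 3" by (simp add: N_def power_mult_distrib power3_eq_cube power2_eq_square)
  have W: "W p = S p / N" for p by (simp add: W_def S_def N_def scaled_score_def PL_score_eq_pair_sum)
  \<comment> \<open>The frequency at which the unscaled score has the phase of \<open>t\<close> times the scaled one\<close>
  define \<tau> where "\<tau> = t / N"
  have arg: "t * W p = \<tau> * S p" for p by (simp add: W \<tau>_def)
  have B0: "0 \<le> B" using B[of undefined] by linarith
  have st: "cmod (?E (\<lambda>p. S p * iexp (\<tau> * S p)) - \<i> * \<tau> * ?E (\<lambda>p. V p * iexp (\<tau> * S p)))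
      \<le> \<tau>\<^sup>2 * (4 * B) ^ 3 * real n ^ 4"
    unfolding S_def V_def
    by (rule stein_identity[OF swap_odd_score_kernel score_kernel_sym score_kernel_bound[OF B]])
  have E1: "?E (\<lambda>p. W p * iexp (t * W p)) = ?E (\<lambda>p. S p * iexp (\<tau> * S p)) / N"
    unfolding arg by (simp add: W)
  have E2: "\<i> * t * ?E (\<lambda>p. of_real (V p / N\<^sup>2) * iexp (t * W p)) = \<i> * \<tau> * ?E (\<lambda>p. V p * iexp (\<tau> * S p)) / N"
    unfolding arg using N0 by (simp add: \<tau>_def power2_eq_square)
  have part1: "cmod (?E (\<lambda>p. W p * iexp (t * W p)) - \<i> * t * ?E (\<lambda>p. of_real (V p / N\<^sup>2) * iexp (t * W p)))
      \<le> t\<^sup>2 * (4 * B) ^ 3 / sqrt (real n)"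
  proof -
    have "cmod (?E (\<lambda>p. W p * iexp (t * W p)) - \<i> * t * ?E (\<lambda>p. of_real (V p / N\<^sup>2) * iexp (t * W p)))
      = cmod (?E (\<lambda>p. S p * iexp (\<tau> * S p)) - \<i> * \<tau> * ?E (\<lambda>p. V p * iexp (\<tau> * S p))) / N"
      unfolding E1 E2 diff_divide_distrib[symmetric] norm_divide using N0 by simp
    also have "\<dots> \<le> (\<tau>\<^sup>2 * (4 * B) ^ 3 * real n ^ 4) / N"
      using st N0 by (intro divide_right_mono) auto
    also have "\<dots> = t\<^sup>2 * (4 * B) ^ 3 * (real n ^ 4 / (N\<^sup>2 * N))"
      by (simp add: \<tau>_def power_divide)
    also have "real n ^ 4 / (N\<^sup>2 * N) = 1 / sqrt (real n)"
      unfolding N2 N_def using n0 by (simp add: field_simps power_eq_if)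
    finally show ?thesis by simp
  qed
  have V_close: "\<bar>V p / N\<^sup>2 - ?v\<bar> \<le> \<bar>triple_mean F \<theta> n p - ?v\<bar> + (4 * B)\<^sup>2 / real n" for p
  proof -
    let ?D = "\<Sum>i\<in>{1..n}. \<Sum>j\<in>{1..n}. (score_kernel F \<theta> (grid_pt n p i) (grid_pt n p j))\<^sup>2"
    have "V p / N\<^sup>2 = triple_mean F \<theta> n p - ?D / 2 / real n ^ 3"
      by (simp add: V_def stein_var_def triple_mean_def N2 diff_divide_distrib)
    moreover have "0 \<le> ?D" by (intro sum_nonneg) auto
    moreover have "?D / 2 / real n ^ 3 \<le> (4 * B)\<^sup>2 / real n"
    proof -
      have "?D \<le> (\<Sum>i\<in>{1..n}. \<Sum>j\<in>{1..n}. (4 * B)\<^sup>2)"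
        using B0 score_kernel_bound[of F B, OF B]
        by (intro sum_mono abs_le_square_iff[THEN iffD1]) simp
      then have "?D / 2 / real n ^ 3 \<le> (real n * (real n * (4 * B)\<^sup>2)) / 1 / real n ^ 3"
        by (intro divide_right_mono frac_le) auto
      also have "\<dots> = (4 * B)\<^sup>2 / real n" using n0 by (simp add: power3_eq_cube)
      finally show ?thesis .
    qed
    moreover have "0 \<le> ?D / 2 / real n ^ 3" using \<open>0 \<le> ?D\<close> by simp
    ultimately show ?thesis by linarith
  qed
  have part2: "cmod (\<i> * t * ?E (\<lambda>p. of_real (V p / N\<^sup>2) * iexp (t * W p)) - \<i> * t * ?v * ?E (\<lambda>p. iexp (t
      * W p)))
     \<le> \<bar>t\<bar> * (?E (\<lambda>p. \<bar>triple_mean F \<theta> n p - ?v\<bar>) + (4 * B)\<^sup>2 / real n)"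
  proof -
    interpret prob_space "perm_law F n \<theta>" by (rule prob_space_perm_law)
    have "\<i> * t * ?E (\<lambda>p. of_real (V p / N\<^sup>2) * iexp (t * W p)) - \<i> * t * ?v * ?E (\<lambda>p. iexp (t * W p))
       = \<i> * t * (?E (\<lambda>p. of_real (V p / N\<^sup>2) * iexp (t * W p)) - ?E (\<lambda>p. ?v * iexp (t * W p)))"
      by (simp add: right_diff_distrib mult.assoc)
    also have "\<dots> = \<i> * t * ?E (\<lambda>p. of_real (V p / N\<^sup>2 - ?v) * iexp (t * W p))"
      unfolding Bochner_Integration.integral_diff[OF integrable_perm_law integrable_perm_law, symmetric]
      by (simp only: left_diff_distrib of_real_diff)
    finally have "cmod (\<i> * t * ?E (\<lambda>p. of_real (V p / N\<^sup>2) * iexp (t * W p)) - \<i> * t * ?v * ?E (\<lambda>p. iexp (t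
        * W p)))
       = \<bar>t\<bar> * cmod (?E (\<lambda>p. of_real (V p / N\<^sup>2 - ?v) * iexp (t * W p)))"
      by (simp only: norm_mult) simp
    also have "\<dots> \<le> \<bar>t\<bar> * ?E (\<lambda>p. cmod (of_real (V p / N\<^sup>2 - ?v) * iexp (t * W p)))"
      by (intro mult_left_mono integral_norm_bound) auto
    also have "\<dots> \<le> \<bar>t\<bar> * ?E (\<lambda>p. \<bar>triple_mean F \<theta> n p - ?v\<bar> + (4 * B)\<^sup>2 / real n)"
    proof (intro mult_left_mono integral_mono integrable_perm_law)
      fix p show "cmod (of_real (V p / N\<^sup>2 - ?v) * iexp (t * W p))
          \<le> \<bar>triple_mean F \<theta> n p - ?v\<bar> + (4 * B)\<^sup>2 / real n"
        using V_close[of p] unfolding norm_mult norm_of_real norm_exp_i_times by simp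
    qed auto
    also have "?E (\<lambda>p. \<bar>triple_mean F \<theta> n p - ?v\<bar> + (4 * B)\<^sup>2 / real n)
        = ?E (\<lambda>p. \<bar>triple_mean F \<theta> n p - ?v\<bar>) + (4 * B)\<^sup>2 / real n"
      using prob_space by (subst Bochner_Integration.integral_add) auto
    finally show ?thesis .
  qed
  show ?thesis
    using norm_triangle_mono[OF part1 part2] by (simp add: W_def)
qed

lemma expectation_vector_derivative:
  fixes g :: "real \<Rightarrow> (nat \<Rightarrow> nat) \<Rightarrow> complex"
  assumes "\<And>p. p \<in> perms n \<Longrightarrow> ((\<lambda>t. g t p) has_vector_derivative g' p) (at t within S)"
  shows "((\<lambda>t. LINT p|perm_law F n \<theta>. g t p) has_vector_derivative (LINT p|perm_law F n \<theta>. g' p)) (at t within S)"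
  unfolding integral_perm_law
  using assms by (intro has_vector_derivative_sum bounded_linear.has_vector_derivative[OF bounded_linear_scaleR_right])

text \<open>
  The function \<open>\<psi>(t) = exp (\<sigma>\<^sup>2 t\<^sup>2 / 2) \<phi>(t)\<close>, with \<open>\<phi>\<close> the characteristic function of the scaled score,
  would be constant if \<open>\<phi>'(t) = - \<sigma>\<^sup>2 t \<phi>(t)\<close> held exactly. The error in Stein's identity bounds \<open>\<psi>'\<close>,
  and \<open>\<psi>(0) = 1\<close>.
\<close>

lemma scaled_score_char_bound:
  assumes B: "\<And>z. \<bar>F z\<bar> \<le> B" and n: "1 \<le> n" and v0: "0 \<le> sigma_sq F \<theta>"
  shows "cmod ((LINT p|perm_law F n \<theta>. iexp (t * scaled_score F \<theta> n p)) - exp (- (sigma_sq F \<theta> * t\<^sup>2 / 2)))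
    \<le> (t\<^sup>2 * (4 * B) ^ 3 / sqrt (real n)
      + \<bar>t\<bar> * ((LINT p|perm_law F n \<theta>. \<bar>triple_mean F \<theta> n p - sigma_sq F \<theta>\<bar>) + (4 * B)\<^sup>2 / real n)) * \<bar>t\<bar>"
    (is "cmod (?\<phi> t - _) \<le> ?R t * _")
proof -
  let ?E = "\<lambda>f. (LINT p|perm_law F n \<theta>. f p)"
  define v where "v = sigma_sq F \<theta>"
  define W where "W p = scaled_score F \<theta> n p" for p
  \<comment> \<open>A complex argument lets the derivative be taken by the rules for holomorphic functions.\<close>
  define g where "g z p = exp (of_real v * z\<^sup>2 / 2 + \<i> * z * of_real (W p))" for z :: complex and p
  define \<psi> where "\<psi> s = ?E (g (of_real s))" for s :: real
  define \<psi>' where "\<psi>' s = ?E (\<lambda>p. (of_real v * of_real s + \<i> * of_real (W p)) * g (of_real s) p)" for s :: real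
  have B0: "0 \<le> B" using B[of undefined] by linarith
  have d0: "0 \<le> (LINT p|perm_law F n \<theta>. \<bar>triple_mean F \<theta> n p - sigma_sq F \<theta>\<bar>)" by (rule integral_nonneg_AE) simp
  have g_eq: "g (of_real s) p = exp (v * s\<^sup>2 / 2) * iexp (s * W p)" for s p
    by (simp add: g_def exp_add exp_of_real[symmetric] mult.assoc)
  have \<psi>_eq: "\<psi> s = exp (v * s\<^sup>2 / 2) * ?\<phi> s" for s
    unfolding \<psi>_def g_eq W_def by simp
  have der: "(\<psi> has_vector_derivative \<psi>' s) (at s within T)" for s T
    unfolding \<psi>_def \<psi>'_def
  proof (rule expectation_vector_derivative)
    fix p
    have "((\<lambda>z. g z p) has_field_derivative (of_real v * of_real s + \<i> * of_real (W p))
        * g (of_real s) p) (at (of_real s))"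
      unfolding g_def by (auto intro!: derivative_eq_intros)
    then show "((\<lambda>s. g (of_real s) p) has_vector_derivative
        (of_real v * of_real s + \<i> * of_real (W p)) * g (of_real s) p) (at s within T)"
      by (rule has_vector_derivative_real_field)
  qed
  have \<psi>'_eq: "\<psi>' s = exp (v * s\<^sup>2 / 2) * (\<i> * (?E (\<lambda>p. W p * iexp (s * W p)) - \<i> * s * v * ?\<phi> s))" for s
  proof -
    have "\<psi>' s = ?E (\<lambda>p. exp (v * s\<^sup>2 / 2) * (\<i> * (W p * iexp (s * W p))) + exp (v * s\<^sup>2 / 2) * (v * s * iexp (s
        * W p)))"
      unfolding \<psi>'_def g_eq by (simp add: algebra_simps)
    also have "\<dots> = exp (v * s\<^sup>2 / 2) * (\<i> * ?E (\<lambda>p. W p * iexp (s * W p))) + exp (v * s\<^sup>2 / 2) * (v * s * ?\<phi> s)"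
      unfolding W_def[symmetric]
      by (simp only: Bochner_Integration.integral_add integrable_perm_law integral_mult_right_zero)
    also have "\<dots> = exp (v * s\<^sup>2 / 2) * (\<i> * (?E (\<lambda>p. W p * iexp (s * W p)) - \<i> * s * v * ?\<phi> s))"
      by (simp add: algebra_simps)
    finally show ?thesis .
  qed
  have bound: "cmod (\<psi>' s) \<le> exp (v * t\<^sup>2 / 2) * ?R t" if "s \<in> closed_segment 0 t" for s
  proof -
    have st: "\<bar>s\<bar> \<le> \<bar>t\<bar>" using that by (auto simp: closed_segment_eq_real_ivl split: if_splits)
    then have s2: "s\<^sup>2 \<le> t\<^sup>2" by (simp add: abs_le_square_iff)
    have "cmod (\<psi>' s) = exp (v * s\<^sup>2 / 2) * cmod (?E (\<lambda>p. W p * iexp (s * W p)) - \<i> * s * v * ?\<phi> s)"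
      unfolding \<psi>'_eq norm_mult by simp
    also have "\<dots> \<le> exp (v * t\<^sup>2 / 2) * ?R s"
      using scaled_stein[of F B n \<theta> s, OF B n] s2 v0
      by (intro mult_mono) (auto simp: W_def v_def intro!: divide_right_mono mult_left_mono)
    also have "\<dots> \<le> exp (v * t\<^sup>2 / 2) * ?R t"
      using s2 st B0 d0 by (intro mult_left_mono add_mono mult_right_mono divide_right_mono) auto
    finally show ?thesis .
  qed
  have "norm (\<psi> t - \<psi> 0) \<le> (exp (v * t\<^sup>2 / 2) * ?R t) * norm (t - 0)"
  proof (rule differentiable_bound[where S = "closed_segment 0 t" and f' = "\<lambda>s h. h *\<^sub>R \<psi>' s"])
    show "(\<psi> has_derivative (\<lambda>h. h *\<^sub>R \<psi>' s)) (at s within closed_segment 0 t)" for s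
      using der[of s "closed_segment 0 t"] by (simp add: has_vector_derivative_def)
    show "onorm (\<lambda>h. h *\<^sub>R \<psi>' s) \<le> exp (v * t\<^sup>2 / 2) * ?R t" if "s \<in> closed_segment 0 t" for s
    proof (rule onorm_bound)
      have "0 \<le> cmod (\<psi>' s)" by simp
      then show "0 \<le> exp (v * t\<^sup>2 / 2) * ?R t" using bound[OF that] by linarith
      show "norm (h *\<^sub>R \<psi>' s) \<le> exp (v * t\<^sup>2 / 2) * ?R t * norm h" for h :: real
        using mult_left_mono[OF bound[OF that], of "\<bar>h\<bar>"] by (simp add: mult.commute)
    qed
  qed auto
  moreover have "\<psi> 0 = 1"
    using prob_space.prob_space[OF prob_space_perm_law[of F n \<theta>]] by (simp add: \<psi>_def g_def)
  ultimately have main: "cmod (\<psi> t - 1) \<le> exp (v * t\<^sup>2 / 2) * (?R t * \<bar>t\<bar>)" by (simp add: mult.assoc)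
  have "?\<phi> t - exp (- (v * t\<^sup>2 / 2)) = exp (- (v * t\<^sup>2 / 2)) * (\<psi> t - 1)"
  proof -
    have "complex_of_real (exp (- (v * t\<^sup>2 / 2))) * complex_of_real (exp (v * t\<^sup>2 / 2)) = 1"
      by (simp only: of_real_mult[symmetric] exp_add[symmetric]) simp
    then show ?thesis unfolding \<psi>_eq right_diff_distrib mult.assoc[symmetric] by simp
  qed
  then have "cmod (?\<phi> t - exp (- (v * t\<^sup>2 / 2))) = exp (- (v * t\<^sup>2 / 2)) * cmod (\<psi> t - 1)"
    by (simp only: norm_mult norm_of_real) simp
  also have "\<dots> \<le> exp (- (v * t\<^sup>2 / 2)) * (exp (v * t\<^sup>2 / 2) * (?R t * \<bar>t\<bar>))"
    by (intro mult_left_mono main) auto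
  also have "\<dots> = ?R t * \<bar>t\<bar>"
    by (simp only: mult.assoc[symmetric] exp_add[symmetric]) simp
  finally show ?thesis by (simp add: v_def)
qed

theorem scaled_score_char_tendsto:
  assumes F: "continuous_on UNIV F" and B: "\<And>z. \<bar>F z\<bar> \<le> B"
  shows "(\<lambda>n. LINT p|perm_law F n \<theta>. iexp (t * scaled_score F \<theta> n p)) \<longlonglongrightarrow> exp (- (sigma_sq F \<theta> * t\<^sup>2 / 2))"
proof -
  note d = triple_mean_converges[of F B \<theta>, OF F B]
  have inv: "(\<lambda>n. c / real n) \<longlonglongrightarrow> 0" for c by (rule lim_const_over_n)
  have sq: "(\<lambda>n. c / sqrt (real n)) \<longlonglongrightarrow> 0" for c
    by (intro tendsto_divide_0[OF tendsto_const] filterlim_at_top_imp_at_infinity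
        filterlim_compose[OF sqrt_at_top filterlim_real_sequentially])
  have "(\<lambda>n. (t\<^sup>2 * (4 * B) ^ 3 / sqrt (real n)
      + \<bar>t\<bar> * ((LINT p|perm_law F n \<theta>. \<bar>triple_mean F \<theta> n p - sigma_sq F \<theta>\<bar>) + (4 * B)\<^sup>2 / real n)) * \<bar>t\<bar>)
     \<longlonglongrightarrow> (0 + \<bar>t\<bar> * (0 + 0)) * \<bar>t\<bar>"
    by (intro tendsto_intros d sq inv)
  then have R: "(\<lambda>n. (t\<^sup>2 * (4 * B) ^ 3 / sqrt (real n)
      + \<bar>t\<bar> * ((LINT p|perm_law F n \<theta>. \<bar>triple_mean F \<theta> n p - sigma_sq F \<theta>\<bar>) + (4 * B)\<^sup>2 / real n)) * \<bar>t\<bar>) \<longlonglongrightarrow> 0"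
    by simp
  show ?thesis
    by (rule Lim_transform2[OF tendsto_const], rule Lim_null_comparison[OF _ R])
       (use scaled_score_char_bound[of F B _ \<theta>, OF B _ d(2)] in
        \<open>auto intro!: eventually_mono[OF eventually_ge_at_top[of 1]] simp: norm_minus_commute\<close>)
qed

section \<open>The estimator near the true parameter\<close>

text \<open>
  The second derivative of \<open>1 / (1 + exp x)\<close> is bounded by \<open>1\<close>.
\<close>

lemma logistic_taylor:
  fixes u v :: real
  shows "\<bar>1 / (1 + exp (u + v)) - 1 / (1 + exp u) + v * exp u / (1 + exp u)\<^sup>2\<bar> \<le> v\<^sup>2"
proof -
  define L' where "L' x = - exp x / (1 + exp x)\<^sup>2" for x :: real
  define L'' where "L'' x = exp x * (exp x - 1) / (1 + exp x) ^ 3" for x :: real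
  have pos: "0 < 1 + exp x" for x :: real by (rule one_plus_exp_pos)
  have dL: "((\<lambda>x. 1 / (1 + exp x)) has_vector_derivative L' x) (at x within S)" for x S
    unfolding has_real_derivative_iff_has_vector_derivative[symmetric] L'_def using pos[of x]
    by (auto intro!: derivative_eq_intros simp: power2_eq_square)
  have dL': "(L' has_field_derivative L'' x) (at x within S)" for x S
  proof -
    define c where "c = 1 + exp x"
    have c: "c \<noteq> 0" and e: "exp x = c - 1" using pos[of x] by (auto simp: c_def)
    have "(L' has_field_derivative - ((exp x * c\<^sup>2 - exp x * (2 * (exp x * c))) / (c\<^sup>2 * c\<^sup>2))) (at x within S)"
      unfolding L'_def c_def using pos[of x] by (auto intro!: derivative_eq_intros)
    also have "- ((exp x * c\<^sup>2 - exp x * (2 * (exp x * c))) / (c\<^sup>2 * c\<^sup>2)) = L'' x"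
      unfolding L''_def c_def[symmetric] unfolding e using c
      by (simp add: divide_simps) algebra
    finally show ?thesis .
  qed
  have L''_bound: "norm (L'' x) \<le> 1" for x
  proof -
    have "\<bar>exp x * (exp x - 1)\<bar> \<le> (1 + exp x) * (1 + exp x)"
      using exp_gt_zero[of x] unfolding abs_mult by (intro mult_mono) linarith+
    also have "\<dots> \<le> (1 + exp x) ^ 3"
      using mult_left_mono[of 1 "1 + exp x" "(1 + exp x) * (1 + exp x)"] by (simp add: power3_eq_cube)
    finally show ?thesis using pos[of x] by (simp add: L''_def abs_divide divide_le_eq)
  qed
  have lip: "norm (L' x - L' u) \<le> \<bar>v\<bar>" if "x \<in> closed_segment u (u + v)" for x
  proof -
    have "norm (L' x - L' u) \<le> 1 * norm (x - u)"
      by (rule field_differentiable_bound[OF convex_UNIV]) (use dL' L''_bound in auto)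
    also have "\<dots> \<le> \<bar>v\<bar>"
      using that by (auto simp: closed_segment_eq_real_ivl split: if_splits)
    finally show ?thesis .
  qed
  have "norm (1 / (1 + exp (u + v)) - 1 / (1 + exp u) - (u + v - u) *\<^sub>R L' u) \<le> norm (u + v - u) * \<bar>v\<bar>"
    by (rule vector_differentiable_bound_linearization[where S
        = "closed_segment u (u + v)", OF dL order.refl lip]) auto
  then show ?thesis by (simp add: L'_def power2_eq_square)
qed

lemma score_kernel_taylor:
  assumes B: "\<And>z. \<bar>F z\<bar> \<le> B"
  shows "\<bar>score_kernel F (\<theta> + \<delta>) z w - score_kernel F \<theta> z w + \<delta> * info_kernel F \<theta> z w\<bar> \<le> \<delta>\<^sup>2 * (4 * B) ^ 3"
proof -
  define y where "y = G_diff F z w"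
  have yB: "\<bar>y\<bar> \<le> 4 * B" unfolding y_def by (rule G_diff_bound[OF B])
  have "score_kernel F (\<theta> + \<delta>) z w - score_kernel F \<theta> z w + \<delta> * info_kernel F \<theta> z w
     = y * (1 / (1 + exp (\<theta> * y + \<delta> * y)) - 1 / (1 + exp (\<theta> * y)) + (\<delta> * y) * exp (\<theta> * y) / (1 + exp (\<theta>
         * y))\<^sup>2)"
    by (simp add: score_kernel_def info_kernel_def y_def[symmetric] algebra_simps power2_eq_square)
  then have "\<bar>score_kernel F (\<theta> + \<delta>) z w - score_kernel F \<theta> z w + \<delta> * info_kernel F \<theta> z w\<bar>
     \<le> \<bar>y\<bar> * (\<delta> * y)\<^sup>2"
    by (simp only: abs_mult mult_left_mono logistic_taylor abs_ge_zero)
  also have "\<dots> = \<delta>\<^sup>2 * \<bar>y\<bar> ^ 3" by (simp add: power_mult_distrib power3_eq_cube power2_eq_square mult_ac)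
  also have "\<dots> \<le> \<delta>\<^sup>2 * (4 * B) ^ 3" using yB by (intro mult_left_mono power_mono) auto
  finally show ?thesis .
qed

definition mean_info :: "(real \<times> real \<Rightarrow> real) \<Rightarrow> real \<Rightarrow> nat \<Rightarrow> (nat \<Rightarrow> nat) \<Rightarrow> real" where
  "mean_info F \<theta> n p = (\<Sum>i\<in>{1..n}. \<Sum>j\<in>{1..n}. info_kernel F \<theta> (grid_pt n p i) (grid_pt n p j)) / (real n)\<^sup>2 / 2"

text \<open>
  Each of the \<open>n\<^sup>2\<close> pairs contributes an error of order \<open>x\<^sup>2 / n\<close> before the division by \<open>n sqrt n\<close>.
\<close>

lemma scaled_score_expansion:
  assumes B: "\<And>z. \<bar>F z\<bar> \<le> B" and n: "1 \<le> n"
  shows "\<bar>PL_score F n p (\<theta> + x / sqrt (real n)) / (real n * sqrt (real n)) - (scaled_score F \<theta> n p - x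
      * mean_info F \<theta> n p)\<bar>
     \<le> x\<^sup>2 * (4 * B) ^ 3 / sqrt (real n)"
proof -
  define \<delta> where "\<delta> = x / sqrt (real n)"
  let ?z = "grid_pt n p"
  have n0: "0 < real n" using n by simp
  let ?D = "\<Sum>i\<in>{1..n}. \<Sum>j\<in>{1..n}. score_kernel F (\<theta> + \<delta>) (?z i) (?z j) - score_kernel F \<theta> (?z i) (?z j) + \<delta>
      * info_kernel F \<theta> (?z i) (?z j)"
  have B0: "0 \<le> B" using B[of undefined] by linarith
  have "\<bar>?D\<bar> \<le> (\<Sum>i\<in>{1..n}. \<Sum>j\<in>{1..n}. \<delta>\<^sup>2 * (4 * B) ^ 3)"
    by (intro order.trans[OF sum_abs] sum_mono score_kernel_taylor B)
  then have D: "\<bar>?D\<bar> \<le> (real n)\<^sup>2 * (\<delta>\<^sup>2 * (4 * B) ^ 3)" by (simp add: power2_eq_square)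
  let ?I = "\<Sum>i\<in>{1..n}. \<Sum>j\<in>{1..n}. info_kernel F \<theta> (?z i) (?z j)"
  have "?D = 2 * PL_score F n p (\<theta> + \<delta>) - 2 * PL_score F n p \<theta> + \<delta> * ?I"
    by (simp add: PL_score_eq_pair_sum pair_sum_def sum.distrib sum_subtractf flip: sum_distrib_left)
  then have "PL_score F n p (\<theta> + \<delta>) / (real n * sqrt (real n)) - (scaled_score F \<theta> n p - x * mean_info F \<theta> n p)
      = ?D / 2 / (real n * sqrt (real n)) + (x * mean_info F \<theta> n p - \<delta> * ?I / 2 / (real n * sqrt (real n)))"
    by (simp add: scaled_score_def add_divide_distrib diff_divide_distrib)
  also have "\<delta> * ?I / 2 / (real n * sqrt (real n)) = x * mean_info F \<theta> n p"
    using n0 by (simp add: \<delta>_def mean_info_def power2_eq_square)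
  finally have "\<bar>PL_score F n p (\<theta> + \<delta>) / (real n * sqrt (real n)) - (scaled_score F \<theta> n p - x
      * mean_info F \<theta> n p)\<bar>
      = \<bar>?D\<bar> / 2 / (real n * sqrt (real n))" by (simp add: abs_divide abs_mult)
  also have "\<dots> \<le> \<bar>?D\<bar> / (real n * sqrt (real n))" by (intro divide_right_mono) auto
  also have "\<dots> \<le> (real n)\<^sup>2 * (\<delta>\<^sup>2 * (4 * B) ^ 3) / (real n * sqrt (real n))"
    using D by (intro divide_right_mono) auto
  also have "\<dots> = x\<^sup>2 * (4 * B) ^ 3 / sqrt (real n)"
    using n0 by (simp add: \<delta>_def power_divide power2_eq_square)
  finally show ?thesis by (simp add: \<delta>_def)
qed

lemma mean_info_converges:
  assumes F: "continuous_on UNIV F" and B: "\<And>z. \<bar>F z\<bar> \<le> B" and e: "0 < e"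
  shows "(\<lambda>n. measure (perm_law F n \<theta>) {p \<in> perms n. e < \<bar>mean_info F \<theta> n p - a_coeff F \<theta>\<bar>}) \<longlonglongrightarrow> 0"
proof -
  obtain \<mu> where \<mu>: "gibbs_form F \<theta> \<mu>" using gibbs_form_exists[OF F B] by blast
  have fc: "continuous_on UNIV (\<lambda>w. info_kernel F \<theta> (fst w) (snd w) / 2)"
    by (intro continuous_intros continuous_info_kernel F) simp
  from lln_pair[OF F B \<mu> fc e] show ?thesis
    by (simp add: a_coeff_eq[OF F \<mu>] mean_info_def sum_divide_distrib mult.commute)
qed

lemma score_kernel_antimono:
  assumes "s \<le> t"
  shows "score_kernel F t z w \<le> score_kernel F s z w"
    and "s < t \<Longrightarrow> score_kernel F t z w = score_kernel F s z w \<Longrightarrow> G_diff F z w = 0"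
proof -
  define y where "y = G_diff F z w"
  have pos: "0 < 1 + exp (t * y)" "0 < 1 + exp (s * y)" by (rule one_plus_exp_pos)+
  have diff: "score_kernel F s z w - score_kernel F t z w
      = y * (exp (t * y) - exp (s * y)) / ((1 + exp (s * y)) * (1 + exp (t * y)))"
    using pos by (simp add: score_kernel_def y_def[symmetric] field_simps)
  have "0 \<le> y * (exp (t * y) - exp (s * y))"
  proof (cases "0 \<le> y")
    case True
    then show ?thesis using assms by (intro mult_nonneg_nonneg) (auto intro: mult_right_mono)
  next
    case False
    then show ?thesis using assms by (intro mult_nonpos_nonpos) (auto intro: mult_right_mono_neg)
  qed
  then have "0 \<le> score_kernel F s z w - score_kernel F t z w"
    unfolding diff using pos by (intro divide_nonneg_nonneg) auto
  then show "score_kernel F t z w \<le> score_kernel F s z w" by simp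
  assume "s < t" and eq: "score_kernel F t z w = score_kernel F s z w"
  then have "y * (exp (t * y) - exp (s * y)) = 0" using diff pos by simp
  then show "G_diff F z w = 0" using \<open>s < t\<close> unfolding y_def[symmetric] by auto
qed

text \<open>
  Every summand is decreasing in the parameter, strictly unless its value of \<open>G\<close> is \<open>0\<close>. Two distinct
  roots would make all these values \<open>0\<close>, hence the score identically \<open>0\<close>.
\<close>

lemma PL_score_root:
  assumes st: "s \<le> t" and s: "0 < PL_score F n p s" and t: "PL_score F n p t < 0"
  shows "PL_exists F n p" and "theta_PL F n p \<in> {s..t}"
proof -
  let ?q = "\<lambda>\<theta> i j. score_kernel F \<theta> (grid_pt n p i) (grid_pt n p j)"
  have cont: "continuous_on {s..t} (PL_score F n p)"
    unfolding PL_score_def using one_plus_exp_pos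
    by (intro continuous_intros) (auto simp: less_imp_neq[symmetric])
  obtain x where x: "x \<in> {s..t}" "PL_score F n p x = 0"
    using IVT2'[of "PL_score F n p" t 0 s] cont st s t by auto
  have no_two: False if ab: "a < b" "PL_score F n p a = 0" "PL_score F n p b = 0" for a b
  proof -
    have "pair_sum (score_kernel F a) n p - pair_sum (score_kernel F b) n p = 0"
      using ab by (simp add: PL_score_eq_pair_sum)
    then have sum0: "(\<Sum>i\<in>{1..n}. \<Sum>j\<in>{1..n}. ?q a i j - ?q b i j) = 0"
      by (simp add: pair_sum_def sum_subtractf)
    have nn: "0 \<le> ?q a i j - ?q b i j" for i j
      using score_kernel_antimono(1)[OF less_imp_le[OF ab(1)]] by simp
    have "(\<Sum>j\<in>{1..n}. ?q a i j - ?q b i j) = 0" if "i \<in> {1..n}" for i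
      using sum0 that nn by (subst (asm) sum_nonneg_eq_0_iff) (auto intro: sum_nonneg)
    then have "?q a i j - ?q b i j = 0" if "i \<in> {1..n}" "j \<in> {1..n}" for i j
      using that nn sum_nonneg_eq_0_iff[of "{1..n}" "\<lambda>j. ?q a i j - ?q b i j"] by auto
    then have "G_diff F (grid_pt n p i) (grid_pt n p j) = 0" if "i \<in> {1..n}" "j \<in> {1..n}" for i j
      using that score_kernel_antimono(2)[OF less_imp_le[OF ab(1)] ab(1)] by simp
    then have "pair_sum (score_kernel F s) n p = 0"
      unfolding pair_sum_def by (intro sum.neutral ballI) (simp add: score_kernel_def)
    with s show False by (simp add: PL_score_eq_pair_sum)
  qed
  have uniq: "y = x" if "PL_score F n p y = 0" for y
    using no_two[of x y] no_two[of y x] that x(2) by (cases x y rule: linorder_cases) auto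
  show "PL_exists F n p" unfolding PL_exists_def by (rule ex1I[of "\<lambda>t. PL_score F n p t = 0" x, OF x(2) uniq])
  have "theta_PL F n p = x" unfolding theta_PL_def by (rule the_equality[of "\<lambda>t. PL_score F n p t
      = 0" x, OF x(2) uniq])
  with x show "theta_PL F n p \<in> {s..t}" by simp
qed

definition rescaled_PL :: "(real \<times> real \<Rightarrow> real) \<Rightarrow> real \<Rightarrow> nat \<Rightarrow> (nat \<Rightarrow> nat) \<Rightarrow> real" where
  "rescaled_PL F \<theta> n p = sqrt (real n) * (theta_PL F n p - \<theta>)"

text \<open>
  Let \<open>X\<close> be the scaled score divided by \<open>a\<close>. The score at \<open>\<theta> + x / sqrt n\<close> is, after scaling, within
  \<open>a e\<close> of \<open>a (X - x)\<close> for \<open>\<bar>x\<bar> \<le> M + 1\<close>, so it changes sign between \<open>x = X - e\<close> and \<open>x = X + e\<close>.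
\<close>

lemma estimator_close_to_score:
  assumes B: "\<And>z. \<bar>F z\<bar> \<le> B" and n: "1 \<le> n" and a: "0 < a" and e: "0 < e" "e \<le> 1"
    and W: "\<bar>scaled_score F \<theta> n p / a\<bar> \<le> M"
    and A: "(M + 1) * \<bar>mean_info F \<theta> n p - a\<bar> + (M + 1)\<^sup>2 * (4 * B) ^ 3 / sqrt (real n) < a * e"
  shows "PL_exists F n p \<and> \<bar>rescaled_PL F \<theta> n p - scaled_score F \<theta> n p / a\<bar> \<le> e"
proof -
  define X where "X = scaled_score F \<theta> n p / a"
  define b where "b = mean_info F \<theta> n p"
  define N where "N = real n * sqrt (real n)"
  have n0: "0 < sqrt (real n)" using n by simp
  have N0: "0 < N" using n by (simp add: N_def)
  have WX: "scaled_score F \<theta> n p = a * X" using a by (simp add: X_def)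
  have B0: "0 \<le> B" using B[of undefined] by linarith
  have M: "\<bar>X\<bar> \<le> M" using W by (simp add: X_def)
  have err: "\<bar>PL_score F n p (\<theta> + x / sqrt (real n)) / N - a * (X - x)\<bar> < a * e" if x: "\<bar>x\<bar> \<le> M + 1" for x
  proof -
    have "\<bar>PL_score F n p (\<theta> + x / sqrt (real n)) / N - (a * X - x * b)\<bar> \<le> x\<^sup>2 * (4 * B) ^ 3 / sqrt (real n)"
      using scaled_score_expansion[of F B n p \<theta> x, OF B n] by (simp add: WX b_def N_def)
    also have "\<dots> \<le> (M + 1)\<^sup>2 * (4 * B) ^ 3 / sqrt (real n)"
      using x B0 by (intro divide_right_mono mult_right_mono abs_le_square_iff[THEN iffD1]) auto
    finally have 1: "\<bar>PL_score F n p (\<theta> + x / sqrt (real n)) / N - (a * X - x * b)\<bar>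
        \<le> (M + 1)\<^sup>2 * (4 * B) ^ 3 / sqrt (real n)" .
    have "\<bar>(a * X - x * b) - a * (X - x)\<bar> = \<bar>x\<bar> * \<bar>b - a\<bar>"
      by (simp add: abs_mult[symmetric] algebra_simps abs_minus_commute)
    also have "\<dots> \<le> (M + 1) * \<bar>b - a\<bar>" by (intro mult_right_mono x) auto
    finally have "\<bar>(a * X - x * b) - a * (X - x)\<bar> \<le> (M + 1) * \<bar>b - a\<bar>" .
    with 1 A show ?thesis unfolding b_def[symmetric] by linarith
  qed
  have "PL_score F n p (\<theta> + (X + e) / sqrt (real n)) / N < 0"
    using err[of "X + e"] M e by (simp add: algebra_simps) linarith
  then have neg: "PL_score F n p (\<theta> + (X + e) / sqrt (real n)) < 0" using N0 by (simp add: divide_less_0_iff)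
  have "0 < PL_score F n p (\<theta> + (X - e) / sqrt (real n)) / N"
    using err[of "X - e"] M e by (simp add: algebra_simps) linarith
  then have pos: "0 < PL_score F n p (\<theta> + (X - e) / sqrt (real n))" using N0 by (simp add: zero_less_divide_iff)
  have le: "\<theta> + (X - e) / sqrt (real n) \<le> \<theta> + (X + e) / sqrt (real n)"
    using n0 e by (intro add_left_mono divide_right_mono) auto
  note root = PL_score_root[OF le pos neg]
  have "(X - e) / sqrt (real n) \<le> theta_PL F n p - \<theta>" "theta_PL F n p - \<theta> \<le> (X + e) / sqrt (real n)"
    using root(2) by auto
  then have "X - e \<le> rescaled_PL F \<theta> n p" "rescaled_PL F \<theta> n p \<le> X + e"
    using n0 by (simp_all add: rescaled_PL_def divide_le_eq le_divide_eq mult.commute)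
  then show ?thesis using root(1) unfolding X_def[symmetric] by (simp add: abs_le_iff)
qed

lemma estimator_close_in_probability:
  assumes F: "continuous_on UNIV F" and B: "\<And>z. \<bar>F z\<bar> \<le> B" and a: "0 < a_coeff F \<theta>" and e: "0 < e" "e \<le> 1"
  shows "(\<lambda>n. measure (perm_law F n \<theta>) {p \<in> perms n.
     \<not> (PL_exists F n p \<and> \<bar>rescaled_PL F \<theta> n p - scaled_score F \<theta> n p / a_coeff F \<theta>\<bar> \<le> e)}) \<longlonglongrightarrow> 0"
    (is "?P \<longlonglongrightarrow> 0")
proof (rule LIMSEQ_I)
  fix r :: real assume r: "0 < r"
  define a where "a = a_coeff F \<theta>"
  have a0: "0 < a" using a by (simp add: a_def)
  have B0: "0 \<le> B" using B[of undefined] by linarith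
  \<comment> \<open>By Chebyshev's inequality the scaled score divided by \<open>a\<close> exceeds this level with probability below \<open>r / 2\<close>.\<close>
  define M where "M = 1 + 2 * (4 * B)\<^sup>2 / (a\<^sup>2 * r)"
  have M1: "1 \<le> M" using r a0 by (simp add: M_def)
  have M0: "0 < M" using M1 by linarith
  have cheb: "(4 * B)\<^sup>2 / (a\<^sup>2 * M\<^sup>2) < r / 2"
  proof -
    have "2 * (4 * B)\<^sup>2 / (a\<^sup>2 * r) < M" by (simp add: M_def)
    also have "M \<le> M\<^sup>2" using M1 by (simp add: power2_eq_square)
    finally have "2 * (4 * B)\<^sup>2 < M\<^sup>2 * (a\<^sup>2 * r)" using a0 r by (simp add: divide_less_eq)
    then show ?thesis using a0 M0 by (simp add: divide_less_eq algebra_simps)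
  qed
  define d where "d = a * e / (2 * (M + 1))"
  have d0: "0 < d" using a0 e M0 by (simp add: d_def)
  have sq: "(\<lambda>n. (M + 1)\<^sup>2 * (4 * B) ^ 3 / sqrt (real n)) \<longlonglongrightarrow> 0"
    by (intro tendsto_divide_0[OF tendsto_const] filterlim_at_top_imp_at_infinity
        filterlim_compose[OF sqrt_at_top filterlim_real_sequentially])
  have ev1: "eventually (\<lambda>n. (M + 1)\<^sup>2 * (4 * B) ^ 3 / sqrt (real n) < a * e / 2) sequentially"
    using a0 e by (intro order_tendstoD(2)[OF sq]) simp
  have ev2: "eventually (\<lambda>n. measure (perm_law F n \<theta>) {p \<in> perms n. d < \<bar>mean_info F \<theta> n p - a\<bar>}
      < r / 2) sequentially"
    using r unfolding a_def by (intro order_tendstoD(2)[OF mean_info_converges[OF F B d0]]) simp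
  have "eventually (\<lambda>n. ?P n < r) sequentially"
    using ev1 ev2 eventually_ge_at_top[of 1]
  proof eventually_elim
    case (elim n)
    interpret prob_space "perm_law F n \<theta>" by (rule prob_space_perm_law)
    let ?A1 = "{p \<in> perms n. M\<^sup>2 \<le> (scaled_score F \<theta> n p / a)\<^sup>2}" and ?A2
        = "{p \<in> perms n. d < \<bar>mean_info F \<theta> n p - a\<bar>}"
    have sub: "{p \<in> perms n. \<not> (PL_exists F n p \<and> \<bar>rescaled_PL F \<theta> n p - scaled_score F \<theta> n p / a\<bar>
        \<le> e)} \<subseteq> ?A1 \<union> ?A2"
    proof (rule ccontr)
      assume "\<not> ?thesis"
      then obtain p where p: "p \<in> perms n" "\<not> (PL_exists F n p \<and> \<bar>rescaled_PL F \<theta> n p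
          - scaled_score F \<theta> n p / a\<bar> \<le> e)"
        "\<not> M\<^sup>2 \<le> (scaled_score F \<theta> n p / a)\<^sup>2" "\<not> d < \<bar>mean_info F \<theta> n p - a\<bar>" by blast
      have "\<bar>scaled_score F \<theta> n p / a\<bar> \<le> M"
        using p(3) M0 abs_le_square_iff[of "scaled_score F \<theta> n p / a" M] by simp
      moreover have "(M + 1) * \<bar>mean_info F \<theta> n p - a\<bar> + (M + 1)\<^sup>2 * (4 * B) ^ 3 / sqrt (real n) < a * e"
      proof -
        have "(M + 1) * \<bar>mean_info F \<theta> n p - a\<bar> \<le> (M + 1) * d" using p(4) M0 by (intro mult_left_mono) auto
        also have "\<dots> = a * e / 2" using M0 by (simp add: d_def field_simps)
        finally show ?thesis using elim(1) by linarith
      qed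
      ultimately show False using estimator_close_to_score[of F B n a e \<theta> p M, OF B elim(3) a0 e] p(2) by blast
    qed
    have "?P n \<le> prob (?A1 \<union> ?A2)"
      using sub unfolding a_def by (intro finite_measure_mono) auto
    also have "\<dots> \<le> prob ?A1 + prob ?A2" by (intro measure_Un_le) auto
    also have "prob ?A1 \<le> (LINT p|perm_law F n \<theta>. (scaled_score F \<theta> n p / a)\<^sup>2) / M\<^sup>2"
      using M0 by (intro perm_law_markov) auto
    also have "\<dots> = (LINT p|perm_law F n \<theta>. (scaled_score F \<theta> n p)\<^sup>2) / (a\<^sup>2 * M\<^sup>2)"
      by (simp add: power_divide)
    also have "\<dots> \<le> (4 * B)\<^sup>2 / (a\<^sup>2 * M\<^sup>2)"
      using elim(3) by (intro divide_right_mono scaled_score_second_moment B) auto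
    finally show ?case using cheb elim(2) by linarith
  qed
  then show "\<exists>no. \<forall>n\<ge>no. norm (?P n - 0) < r"
    unfolding eventually_sequentially by simp
qed

lemma char_normal_law:
  assumes "0 \<le> v"
  shows "real_distribution (normal_law 0 v)" and "char (normal_law 0 v) t = exp (- (v * t\<^sup>2 / 2))"
proof -
  have "real_distribution (normal_law 0 v) \<and> char (normal_law 0 v) t = exp (- (v * t\<^sup>2 / 2))"
  proof (cases "v = 0")
    case True
    have "prob_space (return borel (0 :: real))" by (rule prob_space_return) simp
    moreover have "char (return borel (0 :: real)) t = 1"
      unfolding char_def by (subst integral_return) auto
    ultimately show ?thesis
      by (simp add: True normal_law_def real_distribution_def real_distribution_axioms_def)
  next
    case False
    define \<sigma> where "\<sigma> = sqrt v"
    have \<sigma>: "0 < \<sigma>" "\<sigma>\<^sup>2 = v" using False assms by (auto simp: \<sigma>_def)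
    interpret S: real_distribution std_normal_distribution by (rule real_dist_normal_dist)
    have "distributed std_normal_distribution lborel (\<lambda>x. x) std_normal_density"
    proof -
      have "distr std_normal_distribution lborel (\<lambda>x. x) = std_normal_distribution"
        by (rule distr_id2) simp
      then show ?thesis by (simp add: distributed_def)
    qed
    from S.normal_density_affine[OF this, of \<sigma> 0] \<sigma>
    have "distributed std_normal_distribution lborel (\<lambda>x. \<sigma> * x) (normal_density 0 \<sigma>)" by simp
    then have "distr std_normal_distribution lborel (\<lambda>x. \<sigma> * x) = density lborel (normal_density 0 \<sigma>)"
      by (simp add: distributed_def)
    moreover have "distr std_normal_distribution borel (\<lambda>x. \<sigma> * x)
        = distr std_normal_distribution lborel (\<lambda>x. \<sigma> * x)"
      by (rule distr_cong) auto
    ultimately have eq: "normal_law 0 v = distr std_normal_distribution borel (\<lambda>x. \<sigma> * x)"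
      using False by (simp add: normal_law_def \<sigma>_def)
    have "char (normal_law 0 v) t = char std_normal_distribution (t * \<sigma>)"
      unfolding eq char_def by (subst integral_distr) (auto simp: mult.assoc)
    also have "\<dots> = exp (- (v * t\<^sup>2 / 2))"
      using \<sigma>(2) by (simp add: char_std_normal_distribution power_mult_distrib mult.commute)
    finally show ?thesis using eq S.real_distribution_distr[of "\<lambda>x. \<sigma> * x"] by simp
  qed
  then show "real_distribution (normal_law 0 v)" "char (normal_law 0 v) t = exp (- (v * t\<^sup>2 / 2))" by auto
qed

lemma cmod_iexp_diff_le: "cmod (iexp x - iexp y) \<le> \<bar>x - y\<bar>"
proof -
  have "iexp x - iexp y = iexp y * (iexp (x - y) - 1)"
    by (simp add: right_diff_distrib flip: exp_add)
  then have "cmod (iexp x - iexp y) = cmod (iexp (x - y) - 1)"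
    by (simp only: norm_mult norm_exp_i_times mult_1)
  also have "\<dots> \<le> \<bar>x - y\<bar>" using iexp_approx1[of "x - y" 0] by simp
  finally show ?thesis .
qed

text \<open>
  The rescaled error of the estimator differs from the scaled score divided by \<open>a\<close> by a term that
  vanishes in probability, so both have the same limiting characteristic function.
\<close>

theorem PL_asymptotic_normality_continuous:
  assumes FC: "F \<in> class_C" and F: "continuous_on UNIV F" and B: "\<And>z. \<bar>F z\<bar> \<le> B"
  shows "(\<lambda>n. measure (perm_law F n \<theta>) {p \<in> perms n. PL_exists F n p}) \<longlonglongrightarrow> 1"
    and "a_coeff F \<theta> \<noteq> 0"
    and "weak_conv_m (\<lambda>n. distr (perm_law F n \<theta>) borel (rescaled_PL F \<theta> n))
        (normal_law 0 (sigma_sq F \<theta> / (a_coeff F \<theta>)\<^sup>2))"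
proof -
  define a where "a = a_coeff F \<theta>"
  obtain \<mu> where \<mu>: "gibbs_form F \<theta> \<mu>" using gibbs_form_exists[OF F B] by blast
  have a0: "0 < a" unfolding a_def by (rule a_coeff_pos[OF FC F \<mu>])
  then show "a_coeff F \<theta> \<noteq> 0" by (simp add: a_def)
  let ?bad = "\<lambda>e n. {p \<in> perms n.
    \<not> (PL_exists F n p \<and> \<bar>rescaled_PL F \<theta> n p - scaled_score F \<theta> n p / a\<bar> \<le> e)}"
  note close = estimator_close_in_probability[OF F B a0[unfolded a_def], folded a_def]
  show "(\<lambda>n. measure (perm_law F n \<theta>) {p \<in> perms n. PL_exists F n p}) \<longlonglongrightarrow> 1"
  proof (rule tendsto_sandwich)
    show "(\<lambda>n. 1 - measure (perm_law F n \<theta>) (?bad 1 n)) \<longlonglongrightarrow> 1"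
      using tendsto_diff[OF tendsto_const[of 1] close[of 1]] by simp
    show "eventually (\<lambda>n. 1 - measure (perm_law F n \<theta>) (?bad 1 n)
        \<le> measure (perm_law F n \<theta>) {p \<in> perms n. PL_exists F n p}) sequentially"
    proof (intro always_eventually allI)
      fix n
      interpret prob_space "perm_law F n \<theta>" by (rule prob_space_perm_law)
      let ?A = "{p \<in> perms n. PL_exists F n p}"
      have "1 - prob ?A = prob (space (perm_law F n \<theta>) - ?A)" by (intro prob_compl[symmetric]) auto
      also have "\<dots> \<le> prob (?bad 1 n)"
        by (intro finite_measure_mono) auto
      finally show "1 - prob (?bad 1 n) \<le> prob ?A" by linarith
    qed
    show "eventually (\<lambda>n. measure (perm_law F n \<theta>) {p \<in> perms n. PL_exists F n p} \<le> 1) sequentially"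
      using prob_space.prob_le_1[OF prob_space_perm_law] by (intro always_eventually) blast
  qed (rule tendsto_const)
  have v0: "0 \<le> sigma_sq F \<theta>" by (rule triple_mean_converges(2)[OF F B])
  show "weak_conv_m (\<lambda>n. distr (perm_law F n \<theta>) borel (rescaled_PL F \<theta> n))
        (normal_law 0 (sigma_sq F \<theta> / (a_coeff F \<theta>)\<^sup>2))"
    unfolding a_def[symmetric]
  proof (rule levy_continuity)
    show "real_distribution (distr (perm_law F n \<theta>) borel (rescaled_PL F \<theta> n))" for n
      by (rule prob_space.real_distribution_distr[OF prob_space_perm_law]) simp
    have v0': "0 \<le> sigma_sq F \<theta> / a\<^sup>2" using v0 by simp
    note normal = char_normal_law[OF v0']
    show "real_distribution (normal_law 0 (sigma_sq F \<theta> / a\<^sup>2))" by (rule normal(1))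
    fix t :: real
    let ?f = "\<lambda>n p. iexp (t * rescaled_PL F \<theta> n p) - iexp (t * (scaled_score F \<theta> n p / a))"
    have "(\<lambda>n. LINT p|perm_law F n \<theta>. \<bar>cmod (?f n p)\<bar>) \<longlonglongrightarrow> 0"
    proof (rule expectation_abs_tendsto)
      show "\<bar>cmod (?f n p)\<bar> \<le> 2" for n p
        using norm_triangle_ineq4[of "iexp (t * rescaled_PL F \<theta> n p)" "iexp (t * (scaled_score F \<theta> n p / a))"]
        unfolding norm_exp_i_times by simp
      fix e :: real assume e: "0 < e"
      \<comment> \<open>The \<open>+ 1\<close> only guards against \<open>t = 0\<close>.\<close>
      define e' where "e' = min 1 (e / (\<bar>t\<bar> + 1))"
      have e': "0 < e'" "e' \<le> 1" using e by (auto simp: e'_def)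
      show "(\<lambda>n. measure (perm_law F n \<theta>) {p \<in> perms n. e < \<bar>cmod (?f n p)\<bar>}) \<longlonglongrightarrow> 0"
      proof (rule tendsto_sandwich[OF _ _ tendsto_const close[OF e']])
        show "eventually (\<lambda>n. measure (perm_law F n \<theta>) {p \<in> perms n. e < \<bar>cmod (?f n p)\<bar>}
          \<le> measure (perm_law F n \<theta>) (?bad e' n)) sequentially"
        proof (intro always_eventually allI perm_law_measure_mono notI)
          fix n p assume "e < \<bar>cmod (?f n p)\<bar>" "PL_exists F n p \<and> \<bar>rescaled_PL F \<theta> n p
              - scaled_score F \<theta> n p / a\<bar> \<le> e'"
          moreover have "cmod (?f n p) \<le> \<bar>t\<bar> * \<bar>rescaled_PL F \<theta> n p - scaled_score F \<theta> n p / a\<bar>"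
            using cmod_iexp_diff_le[of "t * rescaled_PL F \<theta> n p" "t * (scaled_score F \<theta> n p / a)"]
            unfolding right_diff_distrib[symmetric] abs_mult .
          moreover have "\<bar>t\<bar> * \<bar>rescaled_PL F \<theta> n p - scaled_score F \<theta> n p / a\<bar> \<le> \<bar>t\<bar> * e'"
            using calculation(2) by (intro mult_left_mono) auto
          moreover have "\<bar>t\<bar> * e' \<le> e"
          proof -
            have "\<bar>t\<bar> * e' \<le> (\<bar>t\<bar> + 1) * (e / (\<bar>t\<bar> + 1))"
              using e by (intro mult_mono) (auto simp: e'_def)
            then show ?thesis by simp
          qed
          ultimately show False by simp
        qed
      qed (auto intro: always_eventually)
    qed
    then have "(\<lambda>n. LINT p|perm_law F n \<theta>. cmod (?f n p)) \<longlonglongrightarrow> 0" by simp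
    then have diff: "(\<lambda>n. LINT p|perm_law F n \<theta>. ?f n p) \<longlonglongrightarrow> 0"
      by (rule Lim_null_comparison[rotated]) (intro always_eventually allI integral_norm_bound)
    have "(\<lambda>n. LINT p|perm_law F n \<theta>. iexp (t / a * scaled_score F \<theta> n p))
        \<longlonglongrightarrow> exp (- (sigma_sq F \<theta> * (t / a)\<^sup>2 / 2))"
      by (rule scaled_score_char_tendsto[OF F B])
    moreover have "(LINT p|perm_law F n \<theta>. iexp (t * rescaled_PL F \<theta> n p))
        = (LINT p|perm_law F n \<theta>. ?f n p) + (LINT p|perm_law F n \<theta>. iexp (t / a * scaled_score F \<theta> n p))" for n
      unfolding Bochner_Integration.integral_diff[OF integrable_perm_law integrable_perm_law] by simp
    ultimately have "(\<lambda>n. LINT p|perm_law F n \<theta>. iexp (t * rescaled_PL F \<theta> n p))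
        \<longlonglongrightarrow> exp (- (sigma_sq F \<theta> * (t / a)\<^sup>2 / 2))"
      using tendsto_add[OF diff] by fastforce
    moreover have "char (distr (perm_law F n \<theta>) borel (rescaled_PL F \<theta> n)) t
        = (LINT p|perm_law F n \<theta>. iexp (t * rescaled_PL F \<theta> n p))" for n
      unfolding char_def by (subst integral_distr) auto
    moreover have "sigma_sq F \<theta> * (t / a)\<^sup>2 / 2 = sigma_sq F \<theta> / a\<^sup>2 * t\<^sup>2 / 2"
      by (simp add: power_divide)
    ultimately show "(\<lambda>n. char (distr (perm_law F n \<theta>) borel (rescaled_PL F \<theta> n)) t)
       \<longlonglongrightarrow> char (normal_law 0 (sigma_sq F \<theta> / a\<^sup>2)) t"
      by (simp only: normal(2))
  qed
qed

section \<open>Reduction to a continuous function on the plane\<close>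

text \<open>
  The retraction of the plane onto the square. Composition with it extends a function that is
  continuous on the square to a bounded continuous function on the plane, and none of the objects
  in the theorem depends on values off the square.
\<close>

definition clamp_square :: "real \<times> real \<Rightarrow> real \<times> real" where
  "clamp_square z = (max 0 (min 1 (fst z)), max 0 (min 1 (snd z)))"

lemma clamp_square_in: "clamp_square z \<in> unit_square"
  by (auto simp: clamp_square_def)

lemma clamp_square_id: "z \<in> unit_square \<Longrightarrow> clamp_square z = z"
  by (auto simp: clamp_square_def)

lemma continuous_clamp_square: "continuous_on UNIV clamp_square"
  unfolding clamp_square_def by (intro continuous_intros)

lemma perm_stat_cong:
  assumes "\<And>z. z \<in> unit_square \<Longrightarrow> F z = F' z" and "p \<in> perms n"
  shows "perm_stat F n p = perm_stat F' n p"
  unfolding perm_stat_def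
  using assms(1) grid_pt_in_square[OF assms(2)] by (intro sum.cong refl) (simp add: grid_pt_def)

lemma perm_law_cong:
  assumes F: "\<And>z. z \<in> unit_square \<Longrightarrow> F z = F' z"
  shows "perm_law F n \<theta> = perm_law F' n \<theta>"
proof -
  have "log_Z F n \<theta> = log_Z F' n \<theta>"
    unfolding log_Z_def using perm_stat_cong[of F F', OF F] by (simp cong: sum.cong)
  then show ?thesis
    unfolding perm_law_def point_measure_def using perm_stat_cong[of F F', OF F]
    by (intro density_cong) auto
qed

lemma G_diff_cong:
  assumes "\<And>z. z \<in> unit_square \<Longrightarrow> F z = F' z" and "z \<in> unit_square" "w \<in> unit_square"
  shows "G_diff F z w = G_diff F' z w"
  using assms by (auto simp: G_diff_def)

lemma PL_score_cong:
  assumes F: "\<And>z. z \<in> unit_square \<Longrightarrow> F z = F' z" and p: "p \<in> perms n"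
  shows "PL_score F n p = PL_score F' n p"
proof
  fix t
  have "y_diff F n p i j = y_diff F' n p i j" if "i \<in> {1..n}" "j \<in> {1..n}" for i j
    unfolding y_diff_eq_G_diff using that by (intro G_diff_cong F grid_pt_in_square[OF p])
  then show "PL_score F n p t = PL_score F' n p t"
    unfolding PL_score_def by (intro sum.cong refl) auto
qed

lemma mu_opt_cong:
  assumes F: "\<And>z. z \<in> unit_square \<Longrightarrow> F z = F' z"
  shows "mu_opt F \<theta> = mu_opt F' \<theta>"
proof -
  have "(\<lambda>z. indicator unit_square z *\<^sub>R F z) = (\<lambda>z. indicator unit_square z *\<^sub>R F' z)"
    using F by (auto simp: fun_eq_iff indicator_def)
  then have "objective F \<theta> = objective F' \<theta>"
    unfolding objective_def set_lebesgue_integral_def by (simp only:)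
  then show ?thesis by (simp add: mu_opt_def)
qed

lemma sigma_sq_cong:
  assumes F: "\<And>z. z \<in> unit_square \<Longrightarrow> F z = F' z"
  shows "sigma_sq F \<theta> = sigma_sq F' \<theta>"
proof -
  have "mu_opt F \<theta> = mu_opt F' \<theta>" by (rule mu_opt_cong) (rule F)
  then show ?thesis
    unfolding sigma_sq_def set_lebesgue_integral_def using G_diff_cong[of F F', OF F]
    by (intro Bochner_Integration.integral_cong) (auto simp: indicator_def)
qed

lemma a_coeff_cong:
  assumes F: "\<And>z. z \<in> unit_square \<Longrightarrow> F z = F' z"
  shows "a_coeff F \<theta> = a_coeff F' \<theta>"
proof -
  have "mu_opt F \<theta> = mu_opt F' \<theta>" by (rule mu_opt_cong) (rule F)
  then show ?thesis
    unfolding a_coeff_def set_lebesgue_integral_def using G_diff_cong[of F F', OF F]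
    by (intro arg_cong[where f = "(*) (1 / 2)"] Bochner_Integration.integral_cong) (auto simp: indicator_def)
qed

lemma class_C_cong:
  assumes F: "\<And>z. z \<in> unit_square \<Longrightarrow> F z = F' z" and FC: "F \<in> class_C"
  shows "F' \<in> class_C"
proof -
  have sq: "AE z in uniform_measure lborel unit_square. z \<in> unit_square"
    using on_compact_pair[OF on_compact_unif on_compact_unif]
    unfolding uniform_square_eq_pair on_compact_def by blast
  have "continuous_on unit_square F'"
    using FC F by (subst continuous_on_cong[of _ unit_square F' F]) (auto simp: class_C_def)
  moreover have "\<not> (AE z in uniform_measure lborel unit_square. F' z = 0)"
  proof
    assume "AE z in uniform_measure lborel unit_square. F' z = 0"
    with sq have "AE z in uniform_measure lborel unit_square. F z = 0"
      by eventually_elim (simp add: F)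
    with FC show False by (simp add: class_C_def)
  qed
  moreover have "integral {0..1} (\<lambda>z. F' (x, z)) = 0" "integral {0..1} (\<lambda>z. F' (z, x))
      = 0" if x: "x \<in> {0..1}" for x
  proof -
    have "integral {0..1} (\<lambda>z. F' (x, z)) = integral {0..1} (\<lambda>z. F (x, z))"
      "integral {0..1} (\<lambda>z. F' (z, x)) = integral {0..1} (\<lambda>z. F (z, x))"
      using x by (intro Henstock_Kurzweil_Integration.integral_cong; auto simp: F)+
    then show "integral {0..1} (\<lambda>z. F' (x, z)) = 0" "integral {0..1} (\<lambda>z. F' (z, x)) = 0"
      using FC x by (auto simp: class_C_def)
  qed
  ultimately show ?thesis by (simp add: class_C_def)
qed

theorem corollary1p6:
  fixes F :: "real \<times> real \<Rightarrow> real" and \<theta>\<^sub>0 :: real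
  assumes "F \<in> class_C"
  shows "(\<lambda>n. measure (perm_law F n \<theta>\<^sub>0) {p \<in> perms n. PL_exists F n p}) \<longlonglongrightarrow> 1
    \<and> a_coeff F \<theta>\<^sub>0 \<noteq> 0
    \<and> weak_conv_m
        (\<lambda>n. distr (perm_law F n \<theta>\<^sub>0) borel (\<lambda>p. sqrt (real n) * (theta_PL F n p - \<theta>\<^sub>0)))
        (normal_law 0 (sigma_sq F \<theta>\<^sub>0 / (a_coeff F \<theta>\<^sub>0)\<^sup>2))"
proof -
  define F' where "F' z = F (clamp_square z)" for z
  have eq: "F z = F' z" if "z \<in> unit_square" for z
    using that by (simp add: F'_def clamp_square_id del: mem_Times_iff)
  have Fc: "continuous_on unit_square F" using assms by (simp add: class_C_def)
  have F'c: "continuous_on UNIV F'"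
    unfolding F'_def
    by (rule continuous_on_compose2[OF Fc continuous_clamp_square]) (intro image_subsetI clamp_square_in)
  have "compact (F ` unit_square)"
    by (intro compact_continuous_image Fc compact_Times) auto
  then obtain B where bound: "\<And>z. z \<in> unit_square \<Longrightarrow> \<bar>F z\<bar> \<le> B"
    using compact_imp_bounded[of "F ` unit_square"] by (force simp: bounded_iff)
  have B: "\<bar>F' z\<bar> \<le> B" for z
    unfolding F'_def by (rule bound[OF clamp_square_in])
  have F'C: "F' \<in> class_C" using eq assms by (rule class_C_cong)
  note main = PL_asymptotic_normality_continuous[OF F'C F'c B, of \<theta>\<^sub>0]
  have law: "perm_law F n \<theta>\<^sub>0 = perm_law F' n \<theta>\<^sub>0" for n using eq by (rule perm_law_cong)
  have score: "PL_score F n p = PL_score F' n p" if "p \<in> perms n" for n p using eq that by (rule PL_score_cong)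
  have sigma: "sigma_sq F \<theta>\<^sub>0 = sigma_sq F' \<theta>\<^sub>0" using eq by (rule sigma_sq_cong)
  have a: "a_coeff F \<theta>\<^sub>0 = a_coeff F' \<theta>\<^sub>0" using eq by (rule a_coeff_cong)
  have ex: "{p \<in> perms n. PL_exists F n p} = {p \<in> perms n. PL_exists F' n p}" for n
    unfolding PL_exists_def by (intro Collect_cong conj_cong refl) (simp only: score)
  have est: "distr (perm_law F n \<theta>\<^sub>0) borel (\<lambda>p. sqrt (real n) * (theta_PL F n p - \<theta>\<^sub>0))
      = distr (perm_law F' n \<theta>\<^sub>0) borel (rescaled_PL F' \<theta>\<^sub>0 n)" for n
    unfolding law rescaled_PL_def theta_PL_def
    by (rule distr_cong) (simp_all only: space_perm_law score)
  show ?thesis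
    unfolding ex est sigma a unfolding law using main by blast
qed

end
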